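(* Let $\gamma\ge1$, $d,d_Y\in\mathbb N$ and $a_n = n^{-\frac{2\gamma}{2\gamma+d+d_Y}}$. Suppose that - $F \ge 1$, - $L_f \ge \log_2(n)\log_2(4(d+d_Y)\vee 4\gamma)$, - $\min_{i=1,\dots,L_f}p_{f,i} \gtrsim na_n$, - $s_f \gtrsim \log(n)\, na_n$, where the constants in the asymptotic expressions depend on $\gamma,d,d_Y$. Then there exist constants $C > 0$, $K \in (0,1)$ only depending on $\gamma,d,d_Y,F$ such that $$\sup_{f\in C^{\gamma}([0,1]^{d+d_Y},K),\ \|f\|_L \le 1}\ \inf_{\tilde f\in \mathcal{R}(L_f,\mathbf{p}_f,s_f)}\|f - \tilde f\|_{\infty} \le C a_n^{1/2}.$$ In particular, for any measurable $g:\mathbb R^{d_Z+d_Y} \to \mathbb R^d$ with $g(Z,Y)\in[0,1]^d$, $$W_1^{c,\gamma}(g) \le W^c_{1,n}(g) + Ca_n^{1/2},$$ where $W_1^{c,\gamma}$ is defined with this constant $K$.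
   Context: Notation: $a\gtrsim b$ means $a\ge cb$ for a suitable constant $c>0$ (here depending only on $\gamma,d,d_Y$). $(X,Y)$ is a random vector with values in $[0,1]^d\times[0,1]^{d_Y}$, and $Z$ a random variable with values in $[0,1]^{d_Z}$, independent of $(X,Y)$. Hölder classes: for $T\subset\mathbb R^r$, $\beta\ge1$, $K>0$, $C^\beta(T,K)$ is the set of $f:T\to\mathbb R$ with $\sum_{0\le|\alpha|<\beta}\|\partial^\alpha f\|_\infty+\sum_{|\alpha|=\beta-1}\sup_{x\ne y}\frac{|\partial^\alpha f(x)-\partial^\alpha f(y)|}{|x-y|_\infty}\le K$ ($\alpha$ multi-indices). $\|f\|_L$ is the Lipschitz constant of $f$ with respect to the Euclidean norm; $\|f-\tilde f\|_\infty$ is the supremum norm over $[0,1]^{d+d_Y}$. Networks: $\sigma(x)=\max\{x,0\}$, $\sigma_v(x)=\sigma(x-v)$ componentwise. For $L\in\mathbb N$, $\mathbf p=(p_0,\dots,p_{L+1})\in\mathbb N^{L+2}$, $s>0$, $F>0$, $\mathcal R(L,\mathbf p,s)=\mathcal R(L,\mathbf p,s,F)$ is the set of $h:\mathbb R^{p_0}\to\mathbb R^{p_{L+1}}$ of the form $h(x)=W^{(L)}\sigma_{v^{(L)}}W^{(L-1)}\cdots W^{(1)}\sigma_{v^{(1)}}W^{(0)}x$ with $W^{(l)}\in\mathbb R^{p_{l+1}\times p_l}$, $v^{(l)}\in\mathbb R^{p_l}$, all entries bounded by 1 in absolute value, at most $s$ nonzero entries in total, and $\sup_{x\in[0,1]^{p_0}}|h(x)|_\infty\le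 F$. The critic class is $\mathcal R(L_f,\mathbf p_f,s_f)$ with $p_{f,0}=d+d_Y$, $p_{f,L_f+1}=1$; its parameters may depend on $n$. $W^c_{1,n}(g)=\sup_{f\in\mathcal R(L_f,\mathbf p_f,s_f),\|f\|_L\le1}\{\mathbb Ef(X,Y)-\mathbb Ef(g(Z,Y),Y)\}$ and $W_1^{c,\gamma}(g)=\sup_{f\in C^\gamma([0,1]^{d+d_Y},K),\|f\|_L\le1}\{\mathbb Ef(X,Y)-\mathbb Ef(g(Z,Y),Y)\}$.
   Formalization: Adds s_f ≳ L_f (constant depending only on γ,d,d_Y): if L_f ≥ s_f all networks are constant and the claim fails. For non-integer γ, C^γ is the standard Hölder class with exponent γ−⌊γ⌋ on top derivatives, as the printed class (empty second sum) is too large for the rate. *)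

theory Defs
  imports "HOL-Probability.Probability"
begin

text \<open>
  A vector in $R^r$ is a function on the index set \<open>{..<r}\<close>, extended by \<open>undefined\<close>
  (the convention of \<^const>\<open>PiE\<close> and \<^const>\<open>PiM\<close>), so that network widths can vary freely.
\<close>

definition vecs :: "nat \<Rightarrow> (nat \<Rightarrow> real) set" where
  "vecs r = PiE {..<r} (\<lambda>_. UNIV)"

definition cube :: "nat \<Rightarrow> (nat \<Rightarrow> real) set" where
  "cube r = PiE {..<r} (\<lambda>_. {0..1})"

definition vec_borel :: "nat \<Rightarrow> (nat \<Rightarrow> real) measure" where
  "vec_borel r = PiM {..<r} (\<lambda>_. borel)"

definition vec_append :: "nat \<Rightarrow> nat \<Rightarrow> (nat \<Rightarrow> real) \<Rightarrow> (nat \<Rightarrow> real) \<Rightarrow> nat \<Rightarrow> real" where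
  "vec_append d e x y = (\<lambda>i\<in>{..<d + e}. if i < d then x i else y (i - d))"

definition dist_sup :: "nat \<Rightarrow> (nat \<Rightarrow> real) \<Rightarrow> (nat \<Rightarrow> real) \<Rightarrow> real" where
  "dist_sup r x y = Max ((\<lambda>i. \<bar>x i - y i\<bar>) ` {..<r})"

definition dist_eucl :: "nat \<Rightarrow> (nat \<Rightarrow> real) \<Rightarrow> (nat \<Rightarrow> real) \<Rightarrow> real" where
  "dist_eucl r x y = L2_set (\<lambda>i. x i - y i) {..<r}"

definition sup_norm_on :: "(nat \<Rightarrow> real) set \<Rightarrow> ((nat \<Rightarrow> real) \<Rightarrow> real) \<Rightarrow> ennreal" where
  "sup_norm_on T f = (SUP x\<in>T. ennreal \<bar>f x\<bar>)"

definition lip_const :: "nat \<Rightarrow> (nat \<Rightarrow> real) set \<Rightarrow> ((nat \<Rightarrow> real) \<Rightarrow> real) \<Rightarrow> ennreal" where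
  "lip_const r T f =
    (SUP (x, y)\<in>{(x, y). x \<in> T \<and> y \<in> T \<and> x \<noteq> y}. ennreal (\<bar>f x - f y\<bar> / dist_eucl r x y))"

text \<open>
  \<open>f'\<close> is the \<open>i\<close>-th partial derivative of \<open>f\<close> on \<open>T\<close>; the derivative is taken within \<open>T\<close>,
  hence is one-sided at the faces of the cube.
\<close>

definition has_partial_on ::
  "(nat \<Rightarrow> real) set \<Rightarrow> nat \<Rightarrow> ((nat \<Rightarrow> real) \<Rightarrow> real) \<Rightarrow> ((nat \<Rightarrow> real) \<Rightarrow> real) \<Rightarrow> bool" where
  "has_partial_on T i f f' \<longleftrightarrow>
    (\<forall>x\<in>T. ((\<lambda>t. f (x(i := t))) has_real_derivative f' x) (at (x i) within {t. x(i := t) \<in> T}))"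

definition multi_indices :: "nat \<Rightarrow> (nat \<Rightarrow> nat) set" where
  "multi_indices r = {\<alpha>. \<forall>i\<ge>r. \<alpha> i = 0}"

definition mi_size :: "nat \<Rightarrow> (nat \<Rightarrow> nat) \<Rightarrow> nat" where
  "mi_size r \<alpha> = (\<Sum>i<r. \<alpha> i)"

text \<open>The largest integer strictly smaller than \<open>\<beta>\<close>; equal to \<open>\<beta> - 1\<close> if \<open>\<beta>\<close> is an integer.\<close>

definition strict_floor :: "real \<Rightarrow> nat" where
  "strict_floor \<beta> = nat (\<lceil>\<beta>\<rceil> - 1)"

text \<open>
  \<open>D \<alpha>\<close> is the partial derivative of \<open>f\<close> of multi-index \<open>\<alpha>\<close>. On a cube these derivatives are
  determined by \<open>f\<close>; requiring one family \<open>D\<close> amounts to existence and symmetry of all partial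
  derivatives of order less than \<open>\<beta>\<close>. For an integer \<open>\<beta>\<close> the second sum ranges over
  \<open>|\<alpha>| = \<beta> - 1\<close> and the exponent \<open>\<beta> - strict_floor \<beta>\<close> is 1. A function is a member by virtue of its
  values on \<open>T\<close> only.
\<close>

definition hoelder_class ::
  "nat \<Rightarrow> real \<Rightarrow> (nat \<Rightarrow> real) set \<Rightarrow> real \<Rightarrow> ((nat \<Rightarrow> real) \<Rightarrow> real) set" where
  "hoelder_class r \<beta> T K = {f. \<exists>D :: (nat \<Rightarrow> nat) \<Rightarrow> (nat \<Rightarrow> real) \<Rightarrow> real.
    (\<forall>x\<in>T. D (\<lambda>_. 0) x = f x) \<and>
    (\<forall>\<alpha>\<in>multi_indices r. \<forall>i<r. real (mi_size r \<alpha> + 1) < \<beta> \<longrightarrow>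
      has_partial_on T i (D \<alpha>) (D (\<alpha>(i := \<alpha> i + 1)))) \<and>
    (\<Sum>\<alpha>\<in>{\<alpha> \<in> multi_indices r. real (mi_size r \<alpha>) < \<beta>}. sup_norm_on T (D \<alpha>)) +
    (\<Sum>\<alpha>\<in>{\<alpha> \<in> multi_indices r. mi_size r \<alpha> = strict_floor \<beta>}.
      (SUP (x, y)\<in>{(x, y). x \<in> T \<and> y \<in> T \<and> x \<noteq> y}.
        ennreal (\<bar>D \<alpha> x - D \<alpha> y\<bar> / dist_sup r x y powr (\<beta> - real (strict_floor \<beta>)))))
    \<le> ennreal K}"

definition relu :: "real \<Rightarrow> real" where
  "relu x = max x 0"

text \<open>
  \<open>W l i j\<close> is the entry in row \<open>i < p (Suc l)\<close> and column \<open>j < p l\<close> of the \<open>l\<close>-th weight matrix,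
  \<open>v l j\<close> the \<open>j\<close>-th entry of the \<open>l\<close>-th shift vector (\<open>1 \<le> l \<le> L\<close>). The value \<open>network p W v L x\<close>
  is the output of the network with \<open>L\<close> hidden layers.
\<close>

primrec network ::
  "(nat \<Rightarrow> nat) \<Rightarrow> (nat \<Rightarrow> nat \<Rightarrow> nat \<Rightarrow> real) \<Rightarrow> (nat \<Rightarrow> nat \<Rightarrow> real) \<Rightarrow> nat \<Rightarrow> (nat \<Rightarrow> real) \<Rightarrow> nat \<Rightarrow> real"
where
  "network p W v 0 x = (\<lambda>i\<in>{..<p 1}. \<Sum>j<p 0. W 0 i j * x j)"
| "network p W v (Suc l) x =
    (\<lambda>i\<in>{..<p (Suc (Suc l))}. \<Sum>j<p (Suc l). W (Suc l) i j * relu (network p W v l x j - v (Suc l) j))"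

definition relu_networks ::
  "nat \<Rightarrow> (nat \<Rightarrow> nat) \<Rightarrow> real \<Rightarrow> real \<Rightarrow> ((nat \<Rightarrow> real) \<Rightarrow> nat \<Rightarrow> real) set" where
  "relu_networks L p s F = {h. \<exists>W v. h = network p W v L \<and>
    (\<forall>l\<le>L. \<forall>i<p (Suc l). \<forall>j<p l. \<bar>W l i j\<bar> \<le> 1) \<and>
    (\<forall>l\<in>{1..L}. \<forall>j<p l. \<bar>v l j\<bar> \<le> 1) \<and>
    real (card {(l, i, j). l \<le> L \<and> i < p (Suc l) \<and> j < p l \<and> W l i j \<noteq> 0} +
          card {(l, j). l \<in> {1..L} \<and> j < p l \<and> v l j \<noteq> 0}) \<le> s \<and>
    (\<forall>x\<in>cube (p 0). \<forall>i<p (Suc L). \<bar>h x i\<bar> \<le> F)}"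

text \<open>Networks with one-dimensional output, as real-valued functions.\<close>

definition critics :: "nat \<Rightarrow> (nat \<Rightarrow> nat) \<Rightarrow> real \<Rightarrow> real \<Rightarrow> ((nat \<Rightarrow> real) \<Rightarrow> real) set" where
  "critics L p s F = (\<lambda>h x. h x 0) ` relu_networks L p s F"

definition hoelder_lip :: "nat \<Rightarrow> real \<Rightarrow> real \<Rightarrow> ((nat \<Rightarrow> real) \<Rightarrow> real) set" where
  "hoelder_lip r \<beta> K = {f \<in> hoelder_class r \<beta> (cube r) K. lip_const r (cube r) f \<le> 1}"

text \<open>
  Networks are functions on all of $R^r$, $r = p_0$, and their Lipschitz constant is taken there,
  not just on the cube.
\<close>

definition critics_lip :: "nat \<Rightarrow> (nat \<Rightarrow> nat) \<Rightarrow> real \<Rightarrow> real \<Rightarrow> ((nat \<Rightarrow> real) \<Rightarrow> real) set" where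
  "critics_lip L p s F = {f \<in> critics L p s F. lip_const (p 0) (vecs (p 0)) f \<le> 1}"

definition ipm ::
  "'w measure \<Rightarrow> ((nat \<Rightarrow> real) \<Rightarrow> real) set \<Rightarrow> ('w \<Rightarrow> nat \<Rightarrow> real) \<Rightarrow> ('w \<Rightarrow> nat \<Rightarrow> real) \<Rightarrow> ereal" where
  "ipm M \<F> U V = (SUP f\<in>\<F>. ereal ((\<integral>\<omega>. f (U \<omega>) \<partial>M) - (\<integral>\<omega>. f (V \<omega>) \<partial>M)))"

definition W1_hoelder ::
  "'w measure \<Rightarrow> nat \<Rightarrow> nat \<Rightarrow> nat \<Rightarrow> ('w \<Rightarrow> nat \<Rightarrow> real) \<Rightarrow> ('w \<Rightarrow> nat \<Rightarrow> real) \<Rightarrow> ('w \<Rightarrow> nat \<Rightarrow> real) \<Rightarrow>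
    real \<Rightarrow> real \<Rightarrow> ((nat \<Rightarrow> real) \<Rightarrow> nat \<Rightarrow> real) \<Rightarrow> ereal" where
  "W1_hoelder M d dY dZ X Y Z \<gamma> K g =
    ipm M (hoelder_lip (d + dY) \<gamma> K)
      (\<lambda>\<omega>. vec_append d dY (X \<omega>) (Y \<omega>))
      (\<lambda>\<omega>. vec_append d dY (g (vec_append dZ dY (Z \<omega>) (Y \<omega>))) (Y \<omega>))"

definition W1_network ::
  "'w measure \<Rightarrow> nat \<Rightarrow> nat \<Rightarrow> nat \<Rightarrow> ('w \<Rightarrow> nat \<Rightarrow> real) \<Rightarrow> ('w \<Rightarrow> nat \<Rightarrow> real) \<Rightarrow> ('w \<Rightarrow> nat \<Rightarrow> real) \<Rightarrow>
    nat \<Rightarrow> (nat \<Rightarrow> nat) \<Rightarrow> real \<Rightarrow> real \<Rightarrow> ((nat \<Rightarrow> real) \<Rightarrow> nat \<Rightarrow> real) \<Rightarrow> ereal" where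
  "W1_network M d dY dZ X Y Z L p s F g =
    ipm M (critics_lip L p s F)
      (\<lambda>\<omega>. vec_append d dY (X \<omega>) (Y \<omega>))
      (\<lambda>\<omega>. vec_append d dY (g (vec_append dZ dY (Z \<omega>) (Y \<omega>))) (Y \<omega>))"

text \<open>
  \<open>(X, Y)\<close> and \<open>Z\<close> take values in the cubes and are independent. The pair \<open>(X, Y)\<close> enters as one
  vector because \<^const>\<open>prob_space.indep_var\<close> requires both variables to have the same value type.
\<close>

definition cgan_setup ::
  "'w measure \<Rightarrow> nat \<Rightarrow> nat \<Rightarrow> nat \<Rightarrow> ('w \<Rightarrow> nat \<Rightarrow> real) \<Rightarrow> ('w \<Rightarrow> nat \<Rightarrow> real) \<Rightarrow> ('w \<Rightarrow> nat \<Rightarrow> real) \<Rightarrow> bool"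
where
  "cgan_setup M d dY dZ X Y Z \<longleftrightarrow>
    prob_space M \<and>
    X \<in> M \<rightarrow>\<^sub>M vec_borel d \<and> Y \<in> M \<rightarrow>\<^sub>M vec_borel dY \<and> Z \<in> M \<rightarrow>\<^sub>M vec_borel dZ \<and>
    (\<forall>\<omega>\<in>space M. X \<omega> \<in> cube d \<and> Y \<omega> \<in> cube dY \<and> Z \<omega> \<in> cube dZ) \<and>
    prob_space.indep_var M
      (vec_borel (d + dY)) (\<lambda>\<omega>. vec_append d dY (X \<omega>) (Y \<omega>)) (vec_borel dZ) Z"

definition rate :: "real \<Rightarrow> nat \<Rightarrow> nat \<Rightarrow> real" where
  "rate \<gamma> r n = real n powr (- (2 * \<gamma> / (2 * \<gamma> + real r)))"

end

theory Submission
  imports Defs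
begin

text \<open>
  On a grid of mesh \<open>1 / M\<close>, \<open>M\<close> about \<open>n powr (1 / (2 * \<gamma> + r))\<close>, the function \<open>f\<close> is
  replaced by the combination of its Taylor polynomials at the grid points with the hat functions of
  the Kuhn triangulation as weights. This quasi-interpolant is accurate to order \<open>M powr - \<gamma>\<close>,
  and its Lipschitz constant is of order \<open>K\<close>. Hat functions are exact ReLU networks, and products
  are computed by Yarotsky's approximate multiplication, a difference of two approximate squares.
  The approximate square has error \<open>b (T\<^sup>m x) / 4\<^sup>m\<close> with \<open>b x = x - x\<^sup>2\<close> and the tent map \<open>T\<close>,
  so this error and its Lipschitz constant are at most \<open>2\<^sup>-\<^sup>m\<close>. The product is exactly zero when one
  factor is zero, hence the errors of different cells do not accumulate. For small \<open>K\<close> the network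
  is therefore 1-Lipschitz on the cube, and on the whole space because its first two layers clip the
  input to the cube.
\<close>

subsection \<open>ReLU networks as layered lists of features\<close>

text \<open>In the comparison of the distances both suprema range over 1-Lipschitz functions, so a
  small uniform error is not enough: the approximating network must be 1-Lipschitz too. Every error
  estimate is therefore paired with a Lipschitz estimate of the same difference, and
  \<open>close\<close> carries both. The constant \<open>K\<close> brings the quasi-interpolant down
  to size and Lipschitz constant at most 1/2; the other half is left for the network error.

  The bound 1 on weights and shifts forbids large factors, so everything is stored small: hat
  functions without the factor \<open>M\<close>, tents divided by powers of 4, Taylor coefficients
  with absolute sum at most 1/2.

  Depth is the scarce resource. A product tree has about \<open>log 2 \<gamma>\<close> levels of
  about \<open>log 2 n / 2\<close> layers each, a precision that suffices because there are at least
  two coordinates. The depth \<open>L\<close> is prescribed exactly, and copying a value through the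
  surplus layers costs parameters in proportion to \<open>L\<close>; this explains
  \<open>c\<^sub>L\<close>. Small \<open>n\<close>, for which the lower order terms of the depth do
  not fit, are served by the zero network and a large \<open>C\<close>.\<close>

definition lc :: "('a \<Rightarrow> real) list \<Rightarrow> real \<Rightarrow> nat \<Rightarrow> ('a \<Rightarrow> real) \<Rightarrow> bool" where
  "lc A \<beta> c z \<longleftrightarrow> (\<exists>cs. length cs = length A \<and> (\<forall>a\<in>set cs. \<bar>a\<bar> \<le> \<beta>) \<and>
     length (filter (\<lambda>a. a \<noteq> 0) cs) \<le> c \<and> z = (\<lambda>x. \<Sum>(a, h)\<leftarrow>zip cs A. a * h x))"

lemma lc_explicit:
  assumes "length cs = length A" "\<And>a. a \<in> set cs \<Longrightarrow> \<bar>a\<bar> \<le> \<beta>"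
    and "z = (\<lambda>x. \<Sum>(a, h)\<leftarrow>zip cs A. a * h x)" "length A \<le> c"
  shows "lc A \<beta> c z"
proof -
  have "length (filter (\<lambda>a. a \<noteq> 0) cs) \<le> c"
    using length_filter_le[of "\<lambda>a. a \<noteq> 0" cs] assms(1,4) by linarith
  then show ?thesis
    unfolding lc_def using assms(1-3) by (intro exI[of _ cs] conjI) auto
qed

lemma lc_mono:
  assumes "lc A \<beta> c z" "\<beta> \<le> \<beta>'" "c \<le> c'"
  shows "lc A \<beta>' c' z"
proof -
  obtain cs where cs: "length cs = length A" "\<forall>a\<in>set cs. \<bar>a\<bar> \<le> \<beta>"
      "length (filter (\<lambda>a. a \<noteq> 0) cs) \<le> c" "z = (\<lambda>x. \<Sum>(a, h)\<leftarrow>zip cs A. a * h x)"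
    using assms(1) unfolding lc_def by blast
  have "\<forall>a\<in>set cs. \<bar>a\<bar> \<le> \<beta>'"
    using cs(2) assms(2) by (meson order.trans)
  moreover have "length (filter (\<lambda>a. a \<noteq> 0) cs) \<le> c'"
    using cs(3) assms(3) by (rule order.trans)
  ultimately show ?thesis
    unfolding lc_def using cs(1,4) by (intro exI[of _ cs] conjI)
qed

lemma sum_zip_replicate_0: "(\<Sum>(a, h)\<leftarrow>zip (replicate n 0) A. a * h x) = (0::real)"
  by (induction n arbitrary: A) (auto simp: zip_Cons1 split: list.splits)

lemma lc_zero:
  assumes "0 \<le> \<beta>"
  shows "lc A \<beta> c (\<lambda>_. 0)"
  unfolding lc_def using assms
  by (intro exI[of _ "replicate (length A) 0"]) (auto simp: sum_zip_replicate_0)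

lemma lc_append:
  assumes "lc A \<beta> c z" "lc B \<beta> c' z'"
  shows "lc (A @ B) \<beta> (c + c') (\<lambda>x. z x + z' x)"
proof -
  obtain cs cs' where cs: "length cs = length A" "\<forall>a\<in>set cs. \<bar>a\<bar> \<le> \<beta>"
      "length (filter (\<lambda>a. a \<noteq> 0) cs) \<le> c" "z = (\<lambda>x. \<Sum>(a, h)\<leftarrow>zip cs A. a * h x)"
    and cs': "length cs' = length B" "\<forall>a\<in>set cs'. \<bar>a\<bar> \<le> \<beta>"
      "length (filter (\<lambda>a. a \<noteq> 0) cs') \<le> c'" "z' = (\<lambda>x. \<Sum>(a, h)\<leftarrow>zip cs' B. a * h x)"
    using assms unfolding lc_def by blast
  show ?thesis
    unfolding lc_def using cs cs' by (intro exI[of _ "cs @ cs'"]) auto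
qed

lemma lc_append1: "lc A \<beta> c z \<Longrightarrow> 0 \<le> \<beta> \<Longrightarrow> lc (A @ B) \<beta> c z"
  using lc_append[of A \<beta> c z B 0 "\<lambda>_. 0"] lc_zero[of \<beta> B 0] by simp

lemma lc_append2: "lc B \<beta> c z \<Longrightarrow> 0 \<le> \<beta> \<Longrightarrow> lc (A @ B) \<beta> c z"
  using lc_append[of A \<beta> 0 "\<lambda>_. 0" B c z] lc_zero[of \<beta> A 0] by simp

text \<open>Needed when the features of a parallel computation come to stand between the shared
  context and the features in use.\<close>

lemma lc_insert_middle:
  assumes "lc (A @ B) \<beta> c z" "0 \<le> \<beta>"
  shows "lc (A @ C @ B) \<beta> c z"
proof -
  obtain cs where cs: "length cs = length (A @ B)" "\<forall>a\<in>set cs. \<bar>a\<bar> \<le> \<beta>"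
      "length (filter (\<lambda>a. a \<noteq> 0) cs) \<le> c" "z = (\<lambda>x. \<Sum>(a, h)\<leftarrow>zip cs (A @ B). a * h x)"
    using assms(1) unfolding lc_def by blast
  define ca cb where "ca = take (length A) cs" and "cb = drop (length A) cs"
  have split: "cs = ca @ cb" "length ca = length A" "length cb = length B"
    using cs(1) by (auto simp: ca_def cb_def)
  show ?thesis
    unfolding lc_def using cs split assms(2)
    by (intro exI[of _ "ca @ replicate (length C) 0 @ cb"]) (auto simp: sum_zip_replicate_0)
qed

lemma lc_single:
  assumes "h \<in> set A" "\<bar>a\<bar> \<le> \<beta>"
  shows "lc A \<beta> 1 (\<lambda>x. a * h x)"
proof -
  obtain xs ys where A: "A = xs @ h # ys"
    using assms(1) by (meson split_list)
  have "lc [h] \<beta> 1 (\<lambda>x. a * h x)"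
    by (rule lc_explicit[of "[a]"]) (use assms(2) in auto)
  then have "lc (xs @ ([h] @ ys)) \<beta> 1 (\<lambda>x. a * h x)"
    using assms(2) by (intro lc_append2 lc_append1) auto
  then show ?thesis
    by (simp add: A)
qed

lemma lc_scale:
  assumes "lc A \<beta> c z" "\<bar>a\<bar> * \<beta> \<le> \<beta>'"
  shows "lc A \<beta>' c (\<lambda>x. a * z x)"
proof -
  obtain cs where cs: "length cs = length A" "\<forall>a\<in>set cs. \<bar>a\<bar> \<le> \<beta>"
      "length (filter (\<lambda>a. a \<noteq> 0) cs) \<le> c" "z = (\<lambda>x. \<Sum>(a, h)\<leftarrow>zip cs A. a * h x)"
    using assms(1) unfolding lc_def by blast
  have "length (filter (\<lambda>b. b \<noteq> 0) (map ((*) a) cs)) \<le> length (filter (\<lambda>b. b \<noteq> 0) cs)"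
    by (induction cs) auto
  moreover have "\<bar>a * b\<bar> \<le> \<beta>'" if "b \<in> set cs" for b
    using cs(2) that assms(2) by (metis abs_mult abs_ge_zero mult_left_mono order.trans)
  moreover have "a * z x = (\<Sum>(b, h)\<leftarrow>zip (map ((*) a) cs) A. b * h x)" for x
    unfolding cs(4) using cs(1)
    by (induction cs A rule: list_induct2) (auto simp: algebra_simps)
  ultimately show ?thesis
    unfolding lc_def using cs(1,3) by (intro exI[of _ "map ((*) a) cs"]) auto
qed

text \<open>Weight bounds add up when both combinations use the same feature. This is why the bound
  is a parameter of \<open>lc\<close> and not fixed to 1: two combinations with weights at most 1/2
  may be added.\<close>

lemma lc_add:
  assumes "lc A \<beta> c z" "lc A \<beta>' c' z'"
  shows "lc A (\<beta> + \<beta>') (c + c') (\<lambda>x. z x + z' x)"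
proof -
  obtain cs cs' where cs: "length cs = length A" "\<forall>a\<in>set cs. \<bar>a\<bar> \<le> \<beta>"
      "length (filter (\<lambda>a. a \<noteq> 0) cs) \<le> c" "z = (\<lambda>x. \<Sum>(a, h)\<leftarrow>zip cs A. a * h x)"
    and cs': "length cs' = length A" "\<forall>a\<in>set cs'. \<bar>a\<bar> \<le> \<beta>'"
      "length (filter (\<lambda>a. a \<noteq> 0) cs') \<le> c'" "z' = (\<lambda>x. \<Sum>(a, h)\<leftarrow>zip cs' A. a * h x)"
    using assms unfolding lc_def by blast
  have len: "length cs = length cs'"
    using cs cs' by simp
  have "length (filter (\<lambda>b. b \<noteq> 0) (map2 (+) cs cs')) \<le>
      length (filter (\<lambda>b. b \<noteq> 0) cs) + length (filter (\<lambda>b. b \<noteq> 0) cs')"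
    using len by (induction cs cs' rule: list_induct2) auto
  moreover have "\<bar>b\<bar> \<le> \<beta> + \<beta>'" if b: "b \<in> set (map2 (+) cs cs')" for b
  proof -
    obtain u v where uv: "(u, v) \<in> set (zip cs cs')" "b = u + v"
      using b by auto
    then have "u \<in> set cs" "v \<in> set cs'"
      by (meson set_zip_leftD set_zip_rightD)+
    then have "\<bar>u\<bar> \<le> \<beta>" "\<bar>v\<bar> \<le> \<beta>'"
      using cs(2) cs'(2) by auto
    then show ?thesis
      using uv by linarith
  qed
  moreover have "z x + z' x = (\<Sum>(b, h)\<leftarrow>zip (map2 (+) cs cs') A. b * h x)" for x
    unfolding cs(4) cs'(4) using len cs'(1)
    by (induction cs cs' A rule: list_induct3) (auto simp: algebra_simps)
  ultimately show ?thesis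
    unfolding lc_def using cs(1,3) cs'(1,3) by (intro exI[of _ "map2 (+) cs cs'"]) auto
qed

section \<open>Neurons and chains of layers over a shared context\<close>

definition neuron :: "('a \<Rightarrow> real) list \<Rightarrow> nat \<Rightarrow> ('a \<Rightarrow> real) \<Rightarrow> bool" where
  "neuron A c g \<longleftrightarrow> (\<exists>z b. lc A 1 c z \<and> \<bar>b\<bar> \<le> 1 \<and> g = (\<lambda>x. relu (z x - b)))"

lemma neuronI: "lc A 1 c z \<Longrightarrow> \<bar>b\<bar> \<le> 1 \<Longrightarrow> g = (\<lambda>x. relu (z x - b)) \<Longrightarrow> neuron A c g"
  unfolding neuron_def by blast

lemma neuronI0: "lc A 1 c z \<Longrightarrow> g = (\<lambda>x. relu (z x)) \<Longrightarrow> neuron A c g"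
  by (rule neuronI[of A c z 0]) auto

lemma neuron_mono: "neuron A c g \<Longrightarrow> c \<le> c' \<Longrightarrow> neuron A c' g"
  unfolding neuron_def using lc_mono[of A 1 c _ 1 c'] by blast

lemma neuron_append1: "neuron A c g \<Longrightarrow> neuron (A @ B) c g"
  unfolding neuron_def using lc_append1[of A 1 c _ B] by auto

lemma neuron_append2: "neuron B c g \<Longrightarrow> neuron (A @ B) c g"
  unfolding neuron_def using lc_append2[of B 1 c _ A] by auto

lemma neuron_insert_middle: "neuron (A @ B) c g \<Longrightarrow> neuron (A @ C @ B) c g"
  unfolding neuron_def using lc_insert_middle[of A B 1 c _ C] by auto

text \<open>ReLU is the identity on nonnegative values, so a nonnegative feature is copied to the
  next layer by a single weight 1. For this reason all features that have to survive a layer are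
  kept nonnegative.\<close>

lemma neuron_carry:
  assumes "h \<in> set A" "\<And>x. h x \<ge> 0" "1 \<le> c"
  shows "neuron A c h"
proof -
  have "neuron A 1 h"
    by (rule neuronI0[OF lc_single[OF assms(1), of 1 1]]) (auto simp: relu_def assms(2) max_absorb1)
  then show ?thesis
    using assms(3) by (rule neuron_mono)
qed

text \<open>
  \<open>A\<close> is a context of features that stays available in every layer: \<open>B\<close> is transformed into \<open>B'\<close>
  by \<open>k\<close> layers of fan-in at most \<open>c\<close> and width at most \<open>w\<close>, not counting \<open>A\<close>.
\<close>

primrec cchain ::
  "('a \<Rightarrow> real) list \<Rightarrow> nat \<Rightarrow> nat \<Rightarrow> nat \<Rightarrow> ('a \<Rightarrow> real) list \<Rightarrow> ('a \<Rightarrow> real) list \<Rightarrow> bool" where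
  "cchain A c w 0 B B' \<longleftrightarrow> B = B' \<and> length B \<le> w"
| "cchain A c w (Suc k) B B' \<longleftrightarrow>
    length B \<le> w \<and> (\<exists>C. (\<forall>g\<in>set C. neuron (A @ B) c g) \<and> cchain A c w k C B')"

lemma cchain_mono: "cchain A c w k B B' \<Longrightarrow> c \<le> c' \<Longrightarrow> w \<le> w' \<Longrightarrow> cchain A c' w' k B B'"
proof (induction k arbitrary: B)
  case (Suc k)
  then obtain C where C: "\<forall>g\<in>set C. neuron (A @ B) c g" "cchain A c w k C B'"
    by auto
  then have "\<forall>g\<in>set C. neuron (A @ B) c' g" "cchain A c' w' k C B'"
    using Suc.IH[OF C(2)] Suc.prems neuron_mono[OF _ Suc.prems(2)] by auto
  then show ?case
    using Suc.prems by auto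
qed auto

lemma cchain_trans: "cchain A c w k B C \<Longrightarrow> cchain A c w l C D \<Longrightarrow> cchain A c w (k + l) B D"
  by (induction k arbitrary: B) auto

lemma cchain_start_length: "cchain A c w k B C \<Longrightarrow> length B \<le> w"
  by (cases k) auto

text \<open>Widths add up but the fan-in does not, because a neuron reads only the context and its
  own strand.\<close>

lemma cchain_parallel:
  assumes "cchain A c w k B C" "cchain A c w' k B' C'"
  shows "cchain A c (w + w') k (B @ B') (C @ C')"
  using assms
proof (induction k arbitrary: B B')
  case (Suc k)
  obtain D D' where D: "\<forall>g\<in>set D. neuron (A @ B) c g" "cchain A c w k D C"
    and D': "\<forall>g\<in>set D'. neuron (A @ B') c g" "cchain A c w' k D' C'"
    using Suc.prems by auto
  have "\<forall>g\<in>set (D @ D'). neuron (A @ B @ B') c g"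
    using D(1) D'(1) neuron_append1[of "A @ B" c _ B'] neuron_insert_middle[of A B' c _ B] by auto
  moreover have "cchain A c (w + w') k (D @ D') (C @ C')"
    using Suc.IH D(2) D'(2) by blast
  ultimately have "\<exists>C''. (\<forall>g\<in>set C''. neuron (A @ B @ B') c g) \<and> cchain A c (w + w') k C'' (C @ C')"
    by blast
  then show ?case
    using Suc.prems by simp
qed auto

lemma cchain_concat:
  assumes "\<And>j. j \<in> set js \<Longrightarrow> cchain A c w k (B j) (C j)"
  shows "cchain A c (w * length js) k (concat (map B js)) (concat (map C js))"
  using assms
proof (induction js)
  case Nil
  show ?case
    by (induction k) (auto intro!: exI[of _ "[]"])
next
  case (Cons j js)
  have "cchain A c (w + w * length js) k (B j @ concat (map B js)) (C j @ concat (map C js))"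
    by (rule cchain_parallel) (use Cons in auto)
  then show ?case
    by simp
qed

section \<open>Networks that start from the raw input\<close>

text \<open>\<open>L\<close> counts hidden layers, and \<open>w\<close> bounds their widths but not
  that of the input. A neuron costs at most \<open>c\<close> weights and one shift, hence the factor
  \<open>c + 1\<close>. The inequality for \<open>S'\<close> lets the parameter budget be enlarged
  at will.\<close>

inductive nnet ::
  "nat \<Rightarrow> nat \<Rightarrow> nat \<Rightarrow> nat \<Rightarrow> ((nat \<Rightarrow> real) \<Rightarrow> real) list \<Rightarrow> bool" for r w :: nat where
  nnet_input: "nnet r w 0 S (map (\<lambda>i x. x i) [0..<r])"
| nnet_layer: "nnet r w L S A \<Longrightarrow> (\<And>g. g \<in> set B \<Longrightarrow> neuron A c g) \<Longrightarrow> length B \<le> w \<Longrightarrow>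
    S + (c + 1) * length B \<le> S' \<Longrightarrow> nnet r w (Suc L) S' B"

lemma nnet_mono:
  assumes "nnet r w L S A" "S \<le> S'"
  shows "nnet r w L S' A"
  using assms(1)
proof cases
  case (nnet_layer L' S0 A' c)
  have "S0 + (c + 1) * length A \<le> S'"
    using nnet_layer(5) assms(2) by (rule order.trans)
  then show ?thesis
    unfolding nnet_layer(1) using nnet_layer(2-4) by (intro nnet.nnet_layer[of r w L' S0 A' A c])
qed (simp add: nnet_input)

text \<open>The context has to be copied by every layer, so its length enters the width and, with
  the factor \<open>c + 1\<close>, the parameter count of each of the \<open>k\<close>
  layers.\<close>

lemma nnet_cchain:
  assumes "cchain A c w k B B'" "nnet r W L S (A @ B)" "\<And>h x. h \<in> set A \<Longrightarrow> h x \<ge> 0"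
    and "1 \<le> c" "length A + w \<le> W"
  shows "nnet r W (L + k) (S + k * ((c + 1) * (length A + w))) (A @ B')"
  using assms(1,2)
proof (induction k arbitrary: B L S)
  case (Suc k)
  obtain C where C: "\<forall>g\<in>set C. neuron (A @ B) c g" "cchain A c w k C B'"
    using Suc.prems by auto
  have "length (A @ C) \<le> length A + w"
    using cchain_start_length[OF C(2)] by simp
  then have len: "(c + 1) * length (A @ C) \<le> (c + 1) * (length A + w)"
    using mult_le_mono2 by blast
  have "nnet r W (Suc L) (S + (c + 1) * (length A + w)) (A @ C)"
  proof (rule nnet_layer[OF Suc.prems(2)])
    show "neuron (A @ B) c g" if "g \<in> set (A @ C)" for g
      using that C(1) neuron_carry[of g "A @ B" c] assms(3,4) by auto
  qed (use len \<open>length (A @ C) \<le> length A + w\<close> assms(5) in auto)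
  from Suc.IH[OF C(2) this] show ?case
    by (simp add: algebra_simps)
qed auto

section \<open>From feature lists to weight matrices\<close>

text \<open>The vector to which the matrix \<open>W l\<close> is applied. It is needed because
  \<open>network\<close> stops before the activation, whereas a feature list holds values after
  it.\<close>

definition hid ::
  "(nat \<Rightarrow> nat) \<Rightarrow> (nat \<Rightarrow> nat \<Rightarrow> nat \<Rightarrow> real) \<Rightarrow> (nat \<Rightarrow> nat \<Rightarrow> real) \<Rightarrow> nat \<Rightarrow> (nat \<Rightarrow> real) \<Rightarrow> nat \<Rightarrow> real"
where
  "hid p W v l x j = (case l of 0 \<Rightarrow> x j | Suc l' \<Rightarrow> relu (network p W v l' x j - v l j))"

lemma network_hid: "i < p (Suc l) \<Longrightarrow> network p W v l x i = (\<Sum>j<p l. W l i j * hid p W v l x j)"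
  by (cases l) (auto simp: hid_def)

lemma network_cong:
  assumes "\<And>l' i j. l' \<le> l \<Longrightarrow> W l' i j = W' l' i j" "\<And>l' j. l' \<le> l \<Longrightarrow> v l' j = v' l' j"
  shows "network p W v l x = network p W' v' l x"
  using assms
proof (induction l)
  case (Suc l)
  then have "network p W v l x = network p W' v' l x"
    by auto
  then show ?case
    using Suc.prems by (auto simp: fun_eq_iff restrict_def)
qed (auto simp: fun_eq_iff restrict_def)

text \<open>At layer \<open>l\<close> the shift \<open>v l\<close> has been applied but the matrix
  \<open>W l\<close> has not, hence the strict inequality for \<open>W\<close> only. The matrix
  \<open>W l\<close> can thus be filled in later without disturbing the features it reads.\<close>

lemma hid_cong:
  assumes "\<And>l' i j. l' < l \<Longrightarrow> W l' i j = W' l' i j" "\<And>l' j. l' \<le> l \<Longrightarrow> v l' j = v' l' j"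
  shows "hid p W v l x = hid p W' v' l x"
proof (cases l)
  case (Suc k)
  have "network p W v k x = network p W' v' k x"
    by (rule network_cong) (use assms Suc in auto)
  then show ?thesis
    using assms(2)[of l] Suc by (auto simp: hid_def fun_eq_iff)
qed (auto simp: hid_def fun_eq_iff)

definition params :: "(nat \<Rightarrow> nat \<Rightarrow> nat \<Rightarrow> real) \<Rightarrow> (nat \<times> nat \<times> nat) set" where
  "params W = {(l, i, j). W l i j \<noteq> 0}"

definition shifts :: "(nat \<Rightarrow> nat \<Rightarrow> real) \<Rightarrow> (nat \<times> nat) set" where
  "shifts v = {(l, j). v l j \<noteq> 0}"

text \<open>Weights vanish from layer \<open>L\<close> on and shifts beyond it, so extending the
  network only overwrites zeros and the parameters can be counted without index ranges. Prescribed
  widths may exceed what is used, hence \<open>length A \<le> p L\<close>.\<close>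

definition realizes ::
  "(nat \<Rightarrow> nat) \<Rightarrow> nat \<Rightarrow> nat \<Rightarrow> ((nat \<Rightarrow> real) \<Rightarrow> real) list \<Rightarrow>
    (nat \<Rightarrow> nat \<Rightarrow> nat \<Rightarrow> real) \<Rightarrow> (nat \<Rightarrow> nat \<Rightarrow> real) \<Rightarrow> bool" where
  "realizes p L S A W v \<longleftrightarrow>
    (\<forall>l i j. \<bar>W l i j\<bar> \<le> 1) \<and> (\<forall>l j. \<bar>v l j\<bar> \<le> 1) \<and> finite (params W) \<and> finite (shifts v) \<and>
    card (params W) + card (shifts v) \<le> S \<and>
    (\<forall>l i j. W l i j \<noteq> 0 \<longrightarrow> l < L) \<and> (\<forall>l j. v l j \<noteq> 0 \<longrightarrow> l \<le> L) \<and>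
    length A \<le> p L \<and> (\<forall>x. \<forall>j<length A. hid p W v L x j = (A ! j) x)"

lemma sum_zip_nth:
  assumes "length cs = length A"
  shows "(\<Sum>(a, h)\<leftarrow>zip cs A. a * h x) = (\<Sum>j<length A. cs ! j * (A ! j) (x::'a) :: real)"
  using assms by (simp add: sum_list_sum_nth atLeast0LessThan)

text \<open>Serves a hidden layer, with one row for each of its neurons, as well as the output, with
  a single row. Shifts above layer \<open>L\<close> are left free because a hidden layer also
  installs the shifts that follow its matrix.\<close>

lemma realizes_add_weights:
  assumes R: "realizes p L S A W v" and k: "k \<le> p (Suc L)"
    and cs: "\<And>i. i < k \<Longrightarrow> length (cs i) = length A \<and> (\<forall>a\<in>set (cs i). \<bar>a\<bar> \<le> 1) \<and>
      length (filter (\<lambda>a. a \<noteq> 0) (cs i)) \<le> c"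
  defines "W' \<equiv> W(L := (\<lambda>i j. if i < k \<and> j < length A then cs i ! j else 0))"
  shows "\<And>l i j. \<bar>W' l i j\<bar> \<le> 1" "finite (params W')"
    "card (params W') \<le> card (params W) + k * c"
    "\<And>x i v'. i < k \<Longrightarrow> (\<And>l j. l \<le> L \<Longrightarrow> v' l j = v l j) \<Longrightarrow>
      network p W' v' L x i = (\<Sum>(a, h)\<leftarrow>zip (cs i) A. a * h x)"
proof -
  show "\<bar>W' l i j\<bar> \<le> 1" for l i j
    using R cs by (auto simp: W'_def realizes_def)
  define N where "N = (\<lambda>i. (\<lambda>j. (L, i, j)) ` {j. j < length (cs i) \<and> cs i ! j \<noteq> 0})"
  have sub: "params W' \<subseteq> params W \<union> (\<Union>i<k. N i)"
    using cs by (auto simp: params_def W'_def N_def image_iff split: if_splits)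
  have fin: "finite (params W)" "finite (\<Union>i<k. N i)"
    using R by (auto simp: realizes_def N_def)
  show "finite (params W')"
    using sub fin by (meson finite_UnI finite_subset)
  have "card (N i) \<le> c" if "i < k" for i
  proof -
    have "card (N i) \<le> card {j. j < length (cs i) \<and> cs i ! j \<noteq> 0}"
      unfolding N_def by (rule card_image_le) auto
    also have "\<dots> \<le> c"
      using cs[OF that] length_filter_conv_card[of "\<lambda>a. a \<noteq> 0" "cs i"] by linarith
    finally show ?thesis .
  qed
  then have "card (\<Union>i<k. N i) \<le> k * c"
    using card_UN_le[of "{..<k}" N] sum_bounded_above[of "{..<k}" "\<lambda>i. card (N i)" c] by auto
  then show "card (params W') \<le> card (params W) + k * c"
    using card_mono[OF _ sub] fin card_Un_le[of "params W" "\<Union>i<k. N i"]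
    by (metis (no_types, lifting) add_left_mono finite_UnI order.trans)
  show "network p W' v' L x i = (\<Sum>(a, h)\<leftarrow>zip (cs i) A. a * h x)"
    if i: "i < k" and v': "\<And>l j. l \<le> L \<Longrightarrow> v' l j = v l j" for x i v'
  proof -
    have "network p W' v' L x i = (\<Sum>j<p L. W' L i j * hid p W' v' L x j)"
      using i k by (intro network_hid) auto
    also have "hid p W' v' L x = hid p W v L x"
      by (rule hid_cong) (auto simp: W'_def v')
    also have "(\<Sum>j<p L. W' L i j * hid p W v L x j) = (\<Sum>j<length A. W' L i j * hid p W v L x j)"
      using R by (intro sum.mono_neutral_right) (auto simp: W'_def realizes_def)
    also have "\<dots> = (\<Sum>j<length A. cs i ! j * (A ! j) x)"
      using R i by (intro sum.cong) (auto simp: W'_def realizes_def)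
    finally show ?thesis
      using cs[OF i] by (simp add: sum_zip_nth)
  qed
qed

lemma nnet_realizes:
  assumes "nnet r w L S A" "p 0 = r" "\<forall>l\<in>{1..L}. w \<le> p l"
  shows "\<exists>W v. realizes p L S A W v"
  using assms
proof (induction rule: nnet.induct)
  case (nnet_input S)
  have "params (\<lambda>_ _ _. 0) = {}" "shifts (\<lambda>_ _. 0) = {}"
    by (auto simp: params_def shifts_def)
  moreover have "length (map (\<lambda>i x. x i) [0..<r]) \<le> p 0"
    using nnet_input.prems(1) by simp
  ultimately have "realizes p 0 S (map (\<lambda>i x. x i) [0..<r]) (\<lambda>_ _ _. 0) (\<lambda>_ _. 0)"
    unfolding realizes_def by (auto simp: hid_def)
  then show ?case
    by blast
next
  case (nnet_layer L S A B c S')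
  have "\<forall>l\<in>{1..L}. w \<le> p l"
    using nnet_layer.prems by auto
  then obtain W v where R: "realizes p L S A W v"
    using nnet_layer.IH nnet_layer.prems by blast
  have "\<exists>q. length (fst q) = length A \<and> (\<forall>a\<in>set (fst q). \<bar>a\<bar> \<le> 1) \<and>
      length (filter (\<lambda>a. a \<noteq> 0) (fst q)) \<le> c \<and> \<bar>snd q\<bar> \<le> 1 \<and>
      B ! i = (\<lambda>x. relu ((\<Sum>(a, h)\<leftarrow>zip (fst q) A. a * h x) - snd q))" if i: "i < length B" for i
  proof -
    obtain z b where z: "lc A 1 c z" "\<bar>b\<bar> \<le> 1" "B ! i = (\<lambda>x. relu (z x - b))"
      using nnet_layer.hyps(2)[OF nth_mem[OF i]] unfolding neuron_def by blast
    obtain cs where "length cs = length A" "\<forall>a\<in>set cs. \<bar>a\<bar> \<le> 1"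
      "length (filter (\<lambda>a. a \<noteq> 0) cs) \<le> c" "z = (\<lambda>x. \<Sum>(a, h)\<leftarrow>zip cs A. a * h x)"
      using z(1) unfolding lc_def by blast
    with z show ?thesis
      by (intro exI[of _ "(cs, b)"]) simp
  qed
  then have "\<forall>i\<in>{..<length B}. \<exists>q. length (fst q) = length A \<and> (\<forall>a\<in>set (fst q). \<bar>a\<bar> \<le> 1) \<and>
      length (filter (\<lambda>a. a \<noteq> 0) (fst q)) \<le> c \<and> \<bar>snd q\<bar> \<le> 1 \<and>
      B ! i = (\<lambda>x. relu ((\<Sum>(a, h)\<leftarrow>zip (fst q) A. a * h x) - snd q))"
    by blast
  from bchoice[OF this] obtain q where q:
    "\<forall>i\<in>{..<length B}. length (fst (q i)) = length A \<and> (\<forall>a\<in>set (fst (q i)). \<bar>a\<bar> \<le> 1) \<and>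
      length (filter (\<lambda>a. a \<noteq> 0) (fst (q i))) \<le> c \<and> \<bar>snd (q i)\<bar> \<le> 1 \<and>
      B ! i = (\<lambda>x. relu ((\<Sum>(a, h)\<leftarrow>zip (fst (q i)) A. a * h x) - snd (q i)))" ..
  define cs b where "cs = (\<lambda>i. fst (q i))" and "b = (\<lambda>i. snd (q i))"
  have cs: "\<And>i. i < length B \<Longrightarrow> length (cs i) = length A \<and>
      (\<forall>a\<in>set (cs i). \<bar>a\<bar> \<le> 1) \<and> length (filter (\<lambda>a. a \<noteq> 0) (cs i)) \<le> c"
    and b: "\<And>i. i < length B \<Longrightarrow> \<bar>b i\<bar> \<le> 1 \<and>
      B ! i = (\<lambda>x. relu ((\<Sum>(a, h)\<leftarrow>zip (cs i) A. a * h x) - b i))"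
    using q by (simp_all add: cs_def b_def)
  define W' where "W' = W(L := (\<lambda>i j. if i < length B \<and> j < length A then cs i ! j else 0))"
  define v' where "v' = v(Suc L := (\<lambda>i. if i < length B then b i else 0))"
  have "w \<le> p (Suc L)"
    using bspec[OF nnet_layer.prems(2), of "Suc L"] by simp
  then have k: "length B \<le> p (Suc L)"
    using nnet_layer.hyps(3) by simp
  note W' = realizes_add_weights[OF R k, where cs=cs and c=c, OF cs, folded W'_def]
  have sub: "shifts v' \<subseteq> shifts v \<union> (\<lambda>i. (Suc L, i)) ` {..<length B}"
    by (auto simp: shifts_def v'_def image_iff split: if_splits)
  have fin: "finite (shifts v)"
    using R by (auto simp: realizes_def)
  have "card (shifts v') \<le> card (shifts v \<union> (\<lambda>i. (Suc L, i)) ` {..<length B})"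
    by (rule card_mono[OF _ sub]) (use fin in auto)
  also have "\<dots> \<le> card (shifts v) + length B"
    using card_Un_le[of "shifts v" "(\<lambda>i. (Suc L, i)) ` {..<length B}"]
      card_image_le[of "{..<length B}" "\<lambda>i. (Suc L, i)"] by auto
  finally have card: "card (params W') + card (shifts v') \<le> S'"
    using W'(3) R nnet_layer.hyps(4) by (auto simp: realizes_def algebra_simps)
  have "realizes p (Suc L) S' B W' v'"
    unfolding realizes_def
  proof (intro conjI allI impI)
    show "finite (shifts v')"
      using finite_subset[OF sub] fin by auto
    show "\<bar>v' l j\<bar> \<le> 1" for l j
      using R b by (auto simp: v'_def realizes_def)
    show "l < Suc L" if "W' l i j \<noteq> 0" for l i j
    proof (cases "l = L")
      case False
      then have "W l i j \<noteq> 0"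
        using that by (simp add: W'_def)
      then have "l < L"
        using R unfolding realizes_def by blast
      then show ?thesis
        by simp
    qed simp
    show "l \<le> Suc L" if "v' l j \<noteq> 0" for l j
      using that R by (auto simp: v'_def realizes_def le_Suc_eq split: if_splits)
    show "hid p W' v' (Suc L) x j = (B ! j) x" if "j < length B" for x j
      using W'(4)[OF _ that, of v' x] b[OF that] that by (auto simp: hid_def v'_def)
  qed (use W' card k in auto)
  then show ?case
    by blast
qed

text \<open>No activation follows the last matrix, so the output is an arbitrary sparse linear
  combination of the last features and may be negative.\<close>

lemma nnet_critic:
  assumes "nnet r w L S A" "lc A 1 c z" "p 0 = r" "p (Suc L) = 1" "\<forall>l\<in>{1..L}. w \<le> p l"
    and "real (S + c) \<le> s" "\<And>x. x \<in> cube r \<Longrightarrow> \<bar>z x\<bar> \<le> F"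
  shows "z \<in> critics L p s F"
proof -
  obtain W v where R: "realizes p L S A W v"
    using nnet_realizes assms by blast
  obtain cs where cs: "length cs = length A" "\<forall>a\<in>set cs. \<bar>a\<bar> \<le> 1"
      "length (filter (\<lambda>a. a \<noteq> 0) cs) \<le> c" "z = (\<lambda>x. \<Sum>(a, h)\<leftarrow>zip cs A. a * h x)"
    using assms(2) unfolding lc_def by blast
  define W' where "W' = W(L := (\<lambda>i j. if i < (1::nat) \<and> j < length A then cs ! j else 0))"
  note W' = realizes_add_weights[OF R, of 1 "\<lambda>_. cs" c, folded W'_def]
  have net: "network p W' v L x 0 = z x" for x
    using W'(4)[of 0 v x] cs assms(4) by auto
  have "card {(l, i, j). l \<le> L \<and> i < p (Suc l) \<and> j < p l \<and> W' l i j \<noteq> 0} \<le> card (params W')"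
    by (rule card_mono) (use W'(2) cs assms(4) in \<open>auto simp: params_def\<close>)
  moreover have "card {(l, j). l \<in> {1..L} \<and> j < p l \<and> v l j \<noteq> 0} \<le> card (shifts v)"
    by (rule card_mono) (use R in \<open>auto simp: shifts_def realizes_def\<close>)
  moreover have "card (params W') + card (shifts v) \<le> S + c"
    using W'(3) cs assms(4) R by (auto simp: realizes_def)
  ultimately have "real (card {(l, i, j). l \<le> L \<and> i < p (Suc l) \<and> j < p l \<and> W' l i j \<noteq> 0} +
      card {(l, j). l \<in> {1..L} \<and> j < p l \<and> v l j \<noteq> 0}) \<le> s"
    using assms(6) by linarith
  then have "network p W' v L \<in> relu_networks L p s F"
    unfolding relu_networks_def using W'(1) cs assms R net
    by (auto simp: realizes_def intro!: exI[of _ W'] exI[of _ v])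
  then show ?thesis
    unfolding critics_def using net by (intro image_eqI[of _ _ "network p W' v L"]) auto
qed

subsection \<open>Approximate multiplication\<close>

definition tent :: "real \<Rightarrow> real" where
  "tent x = (if x \<le> 1/2 then 2 * x else 2 - 2 * x)"

text \<open>On \<open>[0, 1]\<close> this is the piecewise linear interpolation of the square at the
  multiples of \<open>1 / 2 ^ m\<close>.\<close>

definition approx_sq :: "nat \<Rightarrow> real \<Rightarrow> real" where
  "approx_sq m x = x - (\<Sum>k=1..m. (tent ^^ k) x / 4 ^ k)"

definition bump :: "real \<Rightarrow> real" where
  "bump x = x - x\<^sup>2"

lemma tent_bounds: "0 \<le> x \<Longrightarrow> x \<le> 1 \<Longrightarrow> 0 \<le> tent x \<and> tent x \<le> 1"
  by (auto simp: tent_def)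

lemma tent_pow_bounds: "0 \<le> x \<Longrightarrow> x \<le> 1 \<Longrightarrow> 0 \<le> (tent ^^ k) x \<and> (tent ^^ k) x \<le> 1"
  by (induction k) (auto simp: tent_bounds)

lemma tent_lip: "\<bar>tent x - tent y\<bar> \<le> 2 * \<bar>x - y\<bar>"
  by (simp add: tent_def abs_if)

lemma tent_pow_lip: "\<bar>(tent ^^ k) x - (tent ^^ k) y\<bar> \<le> 2 ^ k * \<bar>x - y\<bar>"
proof (induction k)
  case (Suc k)
  have "\<bar>(tent ^^ Suc k) x - (tent ^^ Suc k) y\<bar> \<le> 2 * \<bar>(tent ^^ k) x - (tent ^^ k) y\<bar>"
    using tent_lip by simp
  then show ?case
    using Suc by simp
qed auto

lemma bump_tent: "bump x = (tent x + bump (tent x)) / 4"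
  by (auto simp: bump_def tent_def power2_eq_square field_simps)

text \<open>The self-similarity \<open>bump_tent\<close> telescopes the sum that defines \<open>approx_sq\<close>.\<close>

lemma approx_sq_eq: "approx_sq m x = x\<^sup>2 + bump ((tent ^^ m) x) / 4 ^ m"
proof (induction m)
  case (Suc m)
  have "approx_sq (Suc m) x = approx_sq m x - tent ((tent ^^ m) x) / 4 ^ Suc m"
    by (simp add: approx_sq_def)
  moreover have "bump ((tent ^^ m) x) / 4 ^ m =
      tent ((tent ^^ m) x) / 4 ^ Suc m + bump (tent ((tent ^^ m) x)) / 4 ^ Suc m"
    by (subst bump_tent) (simp add: add_divide_distrib mult.commute)
  ultimately show ?case
    using Suc by simp
qed (simp add: approx_sq_def bump_def)

lemma bump_bounds: "0 \<le> x \<Longrightarrow> x \<le> 1 \<Longrightarrow> 0 \<le> bump x \<and> bump x \<le> 1"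
  unfolding bump_def power2_eq_square using mult_left_le[of x x] zero_le_square[of x] by linarith

lemma bump_lip:
  assumes "0 \<le> x" "x \<le> 1" "0 \<le> y" "y \<le> 1"
  shows "\<bar>bump x - bump y\<bar> \<le> \<bar>x - y\<bar>"
proof -
  have "bump x - bump y = (x - y) * (1 - (x + y))"
    by (simp add: bump_def power2_eq_square algebra_simps)
  moreover have "\<bar>1 - (x + y)\<bar> \<le> 1"
    using assms by auto
  ultimately show ?thesis
    by (metis abs_ge_zero abs_mult mult.right_neutral mult_left_mono)
qed

definition sq_err :: "nat \<Rightarrow> real \<Rightarrow> real" where
  "sq_err m x = bump ((tent ^^ m) x) / 4 ^ m"

text \<open>The error is even of order \<open>1 / 4 ^ m\<close>. The weaker rate is the one its
  Lipschitz constant has, and a single number for both is what \<open>close\<close> asks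
  for.\<close>

lemma sq_err_bounds:
  assumes "0 \<le> x" "x \<le> 1"
  shows "0 \<le> sq_err m x" "sq_err m x \<le> (1/2) ^ m"
proof -
  have b: "0 \<le> bump ((tent ^^ m) x)" "bump ((tent ^^ m) x) \<le> 1"
    using tent_pow_bounds[OF assms] bump_bounds by auto
  show "0 \<le> sq_err m x"
    using b by (simp add: sq_err_def)
  have "sq_err m x \<le> 1 / 4 ^ m"
    unfolding sq_err_def by (rule divide_right_mono) (use b in auto)
  also have "\<dots> \<le> (1/2) ^ m"
    by (simp add: power_one_over frac_le power_mono)
  finally show "sq_err m x \<le> (1/2) ^ m" .
qed

text \<open>The iterated tent stretches by \<open>2 ^ m\<close>, but the error is divided by
  \<open>4 ^ m\<close>, so half of the exponent survives.\<close>

lemma sq_err_lip: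
  assumes "0 \<le> x" "x \<le> 1" "0 \<le> y" "y \<le> 1"
  shows "\<bar>sq_err m x - sq_err m y\<bar> \<le> (1/2) ^ m * \<bar>x - y\<bar>"
proof -
  have "\<bar>bump ((tent ^^ m) x) - bump ((tent ^^ m) y)\<bar> \<le> 2 ^ m * \<bar>x - y\<bar>"
    using bump_lip tent_pow_bounds assms tent_pow_lip[of m x y] by (meson order.trans)
  then have "\<bar>sq_err m x - sq_err m y\<bar> \<le> (2 ^ m * \<bar>x - y\<bar>) / 4 ^ m"
    unfolding sq_err_def diff_divide_distrib[symmetric] abs_divide by (simp add: divide_right_mono)
  also have "\<dots> = (1/2) ^ m * \<bar>x - y\<bar>"
    proof -
    have "(4::real) ^ m = 2 ^ m * 2 ^ m"
      by (simp flip: power_mult_distrib)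
    then show ?thesis
      by (simp add: power_divide)
  qed
  finally show ?thesis .
qed

lemma approx_sq_bounds:
  assumes "0 \<le> x" "x \<le> 1"
  shows "0 \<le> approx_sq m x" "approx_sq m x \<le> 1"
proof -
  show "0 \<le> approx_sq m x"
    using sq_err_bounds(1)[OF assms, of m] by (simp add: approx_sq_eq sq_err_def)
  have "(\<Sum>k=1..m. (tent ^^ k) x / 4 ^ k) \<ge> 0"
    by (intro sum_nonneg divide_nonneg_nonneg) (use tent_pow_bounds[OF assms] in auto)
  then show "approx_sq m x \<le> 1"
    using assms by (simp add: approx_sq_def)
qed

text \<open>Here the first tent is peeled off instead of the last; this form drives the induction in
  \<open>approx_sq_mono\<close>.\<close>

lemma approx_sq_Suc:
  "approx_sq (Suc m) x = (if x \<le> 1/2 then approx_sq m (2 * x) / 4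
     else 2 * x - 1 + approx_sq m (2 - 2 * x) / 4)"
proof -
  have "(tent ^^ Suc m) x = (tent ^^ m) (tent x)"
    by (metis funpow_swap1 funpow.simps(2) o_apply)
  then show ?thesis
    unfolding approx_sq_eq by (auto simp: tent_def power2_eq_square field_simps)
qed

text \<open>Monotonicity is what makes approximate products nonnegative. On the left half the
  function is a scaled copy of its predecessor. On the right half the copy is reflected and
  decreases, but the linear term \<open>2 * x - 1\<close> outweighs it.\<close>

lemma approx_sq_mono:
  assumes "0 \<le> y" "y \<le> x" "x \<le> 1"
  shows "approx_sq m y \<le> approx_sq m x"
  using assms
proof (induction m arbitrary: x y)
  case (Suc m)
  have low: "approx_sq (Suc m) b \<le> approx_sq (Suc m) a" if "0 \<le> b" "b \<le> a" "a \<le> 1/2" for a b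
    using that Suc.IH[of "2 * b" "2 * a"] by (simp add: approx_sq_Suc)
  have high: "approx_sq (Suc m) b \<le> approx_sq (Suc m) a" if "1/2 \<le> b" "b \<le> a" "a \<le> 1" for a b
  proof -
    let ?a = "2 - 2 * a" and ?b = "2 - 2 * b"
    have "approx_sq m ?b - approx_sq m ?a = (?b\<^sup>2 - ?a\<^sup>2) + (sq_err m ?b - sq_err m ?a)"
      by (simp add: approx_sq_eq sq_err_def)
    also have "sq_err m ?b - sq_err m ?a \<le> (1/2) ^ m * \<bar>?b - ?a\<bar>"
      using sq_err_lip[of ?b ?a m] that by auto
    also have "(1/2) ^ m * \<bar>?b - ?a\<bar> \<le> 1 * \<bar>?b - ?a\<bar>"
      by (intro mult_right_mono power_le_one) auto
    also have "?b\<^sup>2 - ?a\<^sup>2 = (?b - ?a) * (?b + ?a)"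
      by (simp add: power2_eq_square algebra_simps)
    also have "\<dots> \<le> (?b - ?a) * 2"
      using that by (intro mult_left_mono) auto
    \<comment> \<open>The predecessor has slope at most 3, namely 2 from the square and 1 from the
      error. After doubling the argument and dividing by 4 this is 3/2, less than the slope 2 of the
      linear term.\<close>
    finally have le: "approx_sq m ?b - approx_sq m ?a \<le> 3 * (?b - ?a)"
      using that by auto
    \<comment> \<open>At 1/2 the case distinction selects the left branch; the right one agrees
      there because \<open>approx_sq m 1 = 1\<close>.\<close>
    have eq: "approx_sq (Suc m) z = 2 * z - 1 + approx_sq m (2 - 2 * z) / 4" if "1/2 \<le> z" for z
    proof (cases "z = 1/2")
      case True
      have "approx_sq k 1 = 1" for k
      proof -
        have "(tent ^^ j) 1 = 0" if "j \<ge> 1" for j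
          using that by (induction j rule: nat_induct_at_least) (auto simp: tent_def)
        then show ?thesis
          by (simp add: approx_sq_def)
      qed
      from this[of m] show ?thesis
        unfolding True approx_sq_Suc by simp
    qed (use that in \<open>simp add: approx_sq_Suc\<close>)
    have "approx_sq (Suc m) a = 2 * a - 1 + approx_sq m (2 - 2 * a) / 4"
      "approx_sq (Suc m) b = 2 * b - 1 + approx_sq m (2 - 2 * b) / 4"
      using that by (auto intro!: eq)
    then show ?thesis
      using le that by argo
  qed
  show ?case
    using low[of y x] high[of y x] low[of y "1/2"] high[of "1/2" x] Suc.prems
    by (cases "x \<le> 1/2"; cases "y \<le> 1/2") (auto intro: order.trans)
qed (auto simp: approx_sq_def)

text \<open>The polarization identity with approximate squares. Halving and the absolute value keep
  both arguments in \<open>[0, 1]\<close> when the factors are.\<close>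

definition approx_mult :: "nat \<Rightarrow> real \<Rightarrow> real \<Rightarrow> real" where
  "approx_mult m x y = approx_sq m ((x + y) / 2) - approx_sq m (\<bar>x - y\<bar> / 2)"

text \<open>Both squares are then taken at the same point \<open>y / 2\<close>, so their errors
  cancel exactly.\<close>

lemma approx_mult_0: "approx_mult m 0 y = 0" if "0 \<le> y"
  using that by (simp add: approx_mult_def)

lemma approx_mult_bounds:
  assumes "0 \<le> x" "x \<le> 1" "0 \<le> y" "y \<le> 1"
  shows "0 \<le> approx_mult m x y" "approx_mult m x y \<le> 1"
proof -
  show "0 \<le> approx_mult m x y"
    unfolding approx_mult_def using assms approx_sq_mono[of "\<bar>x - y\<bar> / 2" "(x + y) / 2" m] by auto
  show "approx_mult m x y \<le> 1"
    unfolding approx_mult_def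
  proof -
    have "\<bar>x - y\<bar> / 2 \<le> 1"
      using assms by (auto simp: abs_if)
    then show "approx_sq m ((x + y) / 2) - approx_sq m (\<bar>x - y\<bar> / 2) \<le> 1"
      using assms approx_sq_bounds(1)[of "\<bar>x - y\<bar> / 2" m] approx_sq_bounds(2)[of "(x + y) / 2" m]
      by auto
  qed
qed

lemma approx_mult_err:
  "approx_mult m x y = x * y + (sq_err m ((x + y) / 2) - sq_err m (\<bar>x - y\<bar> / 2))"
  by (simp add: approx_mult_def approx_sq_eq sq_err_def power2_eq_square field_simps)

text \<open>\<open>t\<close> holds \<open>tent\<^sup>k z / 4\<^sup>k\<close>, \<open>e\<close> its excess over the kink of the next tent and \<open>S\<close> the partial sum.\<close>

definition sq_state :: "nat \<Rightarrow> ('a \<Rightarrow> real) \<Rightarrow> ('a \<Rightarrow> real) list" where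
  "sq_state k z = [\<lambda>x. (tent ^^ k) (z x) / 4 ^ k,
     \<lambda>x. relu ((tent ^^ k) (z x) / 4 ^ k - 1 / 2 / 4 ^ k),
     \<lambda>x. approx_sq k (z x)]"

lemma length_sq_state [simp]: "length (sq_state k z) = 3"
  by (simp add: sq_state_def)

text \<open>The tent is \<open>2 * y - 4 * relu (y - 1 / 2)\<close>. Storing the iterates divided by
  \<open>4 ^ k\<close> turns these coefficients into 1/2 and 1, which the weight bound
  admits.\<close>

lemma tent_scaled: "tent y / 4 ^ Suc k = y / 4 ^ k / 2 - relu (y / 4 ^ k - 1 / 2 / 4 ^ k)"
proof (cases "y \<le> 1/2")
  case True
  then have "y / 4 ^ k \<le> 1 / 2 / 4 ^ k"
    by (intro divide_right_mono) auto
  then show ?thesis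
    using True by (simp add: tent_def relu_def)
next
  case False
  then have "y / 4 ^ k \<ge> 1 / 2 / 4 ^ k"
    by (intro divide_right_mono) auto
  then show ?thesis
    using False by (simp add: tent_def relu_def field_simps)
qed

lemma sq_step:
  assumes "\<And>x. 0 \<le> z x \<and> z x \<le> 1" "g \<in> set (sq_state (Suc k) z)"
  shows "neuron (sq_state k z) 3 g"
proof -
  let ?t = "\<lambda>x. (tent ^^ k) (z x) / 4 ^ k" and ?s = "\<lambda>x. approx_sq k (z x)"
  let ?e = "\<lambda>x. relu ((tent ^^ k) (z x) / 4 ^ k - 1 / 2 / 4 ^ k)"
  have t: "(tent ^^ Suc k) (z x) / 4 ^ Suc k = ?t x / 2 - ?e x" for x
    using tent_scaled[of "(tent ^^ k) (z x)" k] by simp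
  have t0: "(tent ^^ Suc k) (z x) / 4 ^ Suc k \<ge> 0" for x
    by (intro divide_nonneg_nonneg) (use tent_pow_bounds[of "z x" "Suc k"] assms(1) in auto)
  have S: "approx_sq (Suc k) (z x) = ?s x - ?t x / 2 + ?e x" for x
    using t[of x] by (simp add: approx_sq_def)
  have S0: "approx_sq (Suc k) (z x) \<ge> 0" for x
    using approx_sq_bounds assms(1) by blast
  have "lc (sq_state k z) 1 3 (\<lambda>x. ?t x / 2 - ?e x)"
    by (rule lc_explicit[of "[1/2, -1, 0]"]) (auto simp: sq_state_def)
  then have lt: "lc (sq_state k z) 1 3 (\<lambda>x. (tent ^^ Suc k) (z x) / 4 ^ Suc k)"
    unfolding t .
  have "lc (sq_state k z) 1 3 (\<lambda>x. ?s x - ?t x / 2 + ?e x)"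
    by (rule lc_explicit[of "[-1/2, 1, 1]"]) (auto simp: sq_state_def)
  then have lS: "lc (sq_state k z) 1 3 (\<lambda>x. approx_sq (Suc k) (z x))"
    unfolding S .
  have c: "\<bar>1 / 2 / 4 ^ Suc k\<bar> \<le> (1::real)"
    using one_le_power[of "4::real" "Suc k"] by (simp add: field_simps)
  from assms(2) consider "g = (\<lambda>x. (tent ^^ Suc k) (z x) / 4 ^ Suc k)"
    | "g = (\<lambda>x. relu ((tent ^^ Suc k) (z x) / 4 ^ Suc k - 1 / 2 / 4 ^ Suc k))"
    | "g = (\<lambda>x. approx_sq (Suc k) (z x))"
    unfolding sq_state_def by auto
  then show ?thesis
  proof cases
    case 1
    show ?thesis
      by (rule neuronI0[OF lt]) (use t0 in \<open>auto simp: 1 relu_def max_absorb1 simp del: funpow.simps power_Suc\<close>)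
  next
    case 2
    show ?thesis
      by (rule neuronI[OF lt c]) (simp add: 2)
  next
    case 3
    show ?thesis
      by (rule neuronI0[OF lS]) (use S0 in \<open>auto simp: 3 relu_def max_absorb1\<close>)
  qed
qed

lemma sq_chain:
  assumes "\<And>x. 0 \<le> z x \<and> z x \<le> 1"
  shows "cchain A 3 3 m (sq_state k z) (sq_state (k + m) z)"
proof (induction m arbitrary: k)
  case (Suc m)
  have "\<forall>g\<in>set (sq_state (Suc k) z). neuron (A @ sq_state k z) 3 g"
    using sq_step[of z, OF assms] by (auto intro: neuron_append2)
  moreover have "cchain A 3 3 m (sq_state (Suc k) z) (sq_state (k + Suc m) z)"
    using Suc[of "Suc k"] by simp
  ultimately show ?case
    by auto
qed auto

text \<open>The \<open>m + 3\<close> layers are one for the half sum and the positive and negative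
  part of the half difference, one for the initial states of the two squares, \<open>m\<close> tent
  steps, and one for the difference of the squares. The width 6 is that of two states. The factors
  enter as linear combinations, so forming them costs no layer, and the first layer combines both,
  which gives the fan-in \<open>2 * c\<close>. With \<open>3 \<le> c\<close> this also covers the
  six features read by the last layer.\<close>

lemma mult_chain:
  fixes u v :: "'a \<Rightarrow> real"
  assumes u: "lc (A @ B) 1 c u" "\<And>x. 0 \<le> u x \<and> u x \<le> 1"
    and v: "lc (A @ B) 1 c v" "\<And>x. 0 \<le> v x \<and> v x \<le> 1"
    and "length B \<le> 6" "3 \<le> c"
  shows "cchain A (2 * c) 6 (m + 3) B [\<lambda>x. approx_mult m (u x) (v x)]"
proof -
  define s where "s = (\<lambda>x. (u x + v x) / 2)"
  define d where "d = (\<lambda>x. \<bar>u x - v x\<bar> / 2)"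
  have s: "0 \<le> s x \<and> s x \<le> 1" and d: "0 \<le> d x \<and> d x \<le> 1" for x
    using u(2)[of x] v(2)[of x] by (auto simp: s_def d_def)
  define D1 where "D1 = [s, \<lambda>x. relu (u x / 2 - v x / 2), \<lambda>x. relu (v x / 2 - u x / 2)]"
  have half: "lc (A @ B) 1 (c + c) (\<lambda>x. (a / 2) * u x + (b / 2) * v x)"
    if "\<bar>a\<bar> = 1" "\<bar>b\<bar> = 1" for a b
  proof -
    have "lc (A @ B) (1/2 + 1/2) (c + c) (\<lambda>x. (a / 2) * u x + (b / 2) * v x)"
      by (intro lc_add lc_scale[OF u(1)] lc_scale[OF v(1)]) (use that in auto)
    then show ?thesis
      by simp
  qed
  have 1: "neuron (A @ B) (2 * c) g" if "g \<in> set D1" for g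
  proof -
    from that consider "g = s" | "g = (\<lambda>x. relu (u x / 2 - v x / 2))"
      | "g = (\<lambda>x. relu (v x / 2 - u x / 2))"
      unfolding D1_def by auto
    then show ?thesis
    proof cases
      case 1
      show ?thesis
        by (rule neuronI0[where z="\<lambda>x. (1 / 2) * u x + (1 / 2) * v x"])
          (use half[of 1 1] s in \<open>auto simp: 1 relu_def max_absorb1 s_def mult_2 add_divide_distrib\<close>)
    next
      case 2
      show ?thesis
        by (rule neuronI0[where z="\<lambda>x. (1 / 2) * u x + (- 1 / 2) * v x"])
          (use half[of 1 "-1"] in \<open>auto simp: 2 mult_2\<close>)
    next
      case 3
      show ?thesis
        by (rule neuronI0[where z="\<lambda>x. (- 1 / 2) * u x + (1 / 2) * v x"])
          (use half[of "-1" 1] in \<open>auto simp: 3 mult_2\<close>)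
    qed
  qed
  have ls: "lc D1 1 3 s"
    by (rule lc_explicit[of "[1, 0, 0]"]) (auto simp: D1_def)
  have ld: "lc D1 1 3 d"
    by (rule lc_explicit[of "[0, 1, 1]"]) (auto simp: D1_def d_def relu_def fun_eq_iff max_def)
  have start: "neuron D1 3 g" if "lc D1 1 3 z" "\<And>x. 0 \<le> z x \<and> z x \<le> 1" "g \<in> set (sq_state 0 z)" for g z
  proof -
    from that(3) consider "g = z" | "g = (\<lambda>x. relu (z x - 1/2))"
      unfolding sq_state_def approx_sq_def by auto
    then show ?thesis
    proof cases
      case 1
      show ?thesis
        by (rule neuronI0[OF that(1)]) (use that(2) in \<open>auto simp: 1 relu_def max_absorb1\<close>)
    next
      case 2
      show ?thesis
        by (rule neuronI[OF that(1), of "1/2"]) (auto simp: 2)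
    qed
  qed
  have 2: "neuron (A @ D1) (2 * c) g" if "g \<in> set (sq_state 0 s @ sq_state 0 d)" for g
  proof -
    have "neuron D1 3 g"
      using that start[OF ls s] start[OF ld d] by auto
    then show ?thesis
      using assms(6) neuron_append2 neuron_mono[of _ 3 _ "2 * c"] by fastforce
  qed
  have 3: "cchain A (2 * c) 6 m (sq_state 0 s @ sq_state 0 d) (sq_state m s @ sq_state m d)"
    using cchain_mono[OF cchain_parallel[OF sq_chain[OF s, of A m 0] sq_chain[OF d, of A m 0]], of "2 * c" 6]
      assms(6) by simp
  have 4: "neuron (A @ sq_state m s @ sq_state m d) (2 * c) (\<lambda>x. approx_mult m (u x) (v x))"
  proof -
    have "lc (sq_state m s @ sq_state m d) 1 6 (\<lambda>x. approx_mult m (u x) (v x))"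
      by (rule lc_explicit[of "[0, 0, 1, 0, 0, -1]"])
        (auto simp: sq_state_def approx_mult_def s_def d_def)
    then have "neuron (sq_state m s @ sq_state m d) 6 (\<lambda>x. approx_mult m (u x) (v x))"
      by (rule neuronI0) (use approx_mult_bounds(1) u(2) v(2) in \<open>auto simp: relu_def max_absorb1\<close>)
    then show ?thesis
      using assms(6) neuron_append2 neuron_mono[of _ 6 _ "2 * c"] by fastforce
  qed
  have last: "cchain A (2 * c) 6 1 (sq_state m s @ sq_state m d) [\<lambda>x. approx_mult m (u x) (v x)]"
    using 4 by auto
  have "cchain A (2 * c) 6 (m + 1) (sq_state 0 s @ sq_state 0 d) [\<lambda>x. approx_mult m (u x) (v x)]"
    by (rule cchain_trans[OF 3 last])
  then have "cchain A (2 * c) 6 (Suc (m + 1)) D1 [\<lambda>x. approx_mult m (u x) (v x)]"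
    unfolding cchain.simps using 2
    by (intro conjI exI[of _ "sq_state 0 s @ sq_state 0 d"]) (auto simp: D1_def)
  then have "cchain A (2 * c) 6 (Suc (Suc (m + 1))) B [\<lambda>x. approx_mult m (u x) (v x)]"
    unfolding cchain.simps(2)[of _ _ _ "Suc (m + 1)"] using 1 assms(5) by blast
  then show ?thesis
    by (simp add: numeral_3_eq_3)
qed

subsection \<open>Taylor polynomials of Hoelder functions\<close>

lemma dist_sup_ge: "i < r \<Longrightarrow> \<bar>x i - y i\<bar> \<le> dist_sup r x y"
  unfolding dist_sup_def by (rule Max_ge) auto

lemma dist_sup_le: "1 \<le> r \<Longrightarrow> (\<And>i. i < r \<Longrightarrow> \<bar>x i - y i\<bar> \<le> c) \<Longrightarrow> dist_sup r x y \<le> c"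
  unfolding dist_sup_def by (subst Max_le_iff) (auto simp: lessThan_empty_iff)

lemma dist_sup_nonneg: "1 \<le> r \<Longrightarrow> 0 \<le> dist_sup r x y"
  using dist_sup_ge[of 0 r x y] by (auto intro: order.trans[OF abs_ge_zero])

lemma dist_sup_triangle: "1 \<le> r \<Longrightarrow> dist_sup r x z \<le> dist_sup r x y + dist_sup r y z"
proof (rule dist_sup_le)
  fix i assume "i < r"
  then show "\<bar>x i - z i\<bar> \<le> dist_sup r x y + dist_sup r y z"
    using dist_sup_ge[of i r x y] dist_sup_ge[of i r y z] by linarith
qed

lemma dist_sup_le_1:
  assumes "1 \<le> r" "x \<in> cube r" "y \<in> cube r"
  shows "dist_sup r x y \<le> 1"
proof (rule dist_sup_le[OF assms(1)])
  fix i assume "i < r"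
  then have "x i \<in> {0..1}" "y i \<in> {0..1}"
    using assms by (auto simp: cube_def PiE_def Pi_def)
  then show "\<bar>x i - y i\<bar> \<le> 1"
    by auto
qed

lemma dist_sup_pos:
  assumes "1 \<le> r" "x \<in> extensional {..<r}" "y \<in> extensional {..<r}" "x \<noteq> y"
  shows "0 < dist_sup r x y"
proof -
  obtain i where "i < r" "x i \<noteq> y i"
    using assms by (metis extensionalityI lessThan_iff)
  then show ?thesis
    using dist_sup_ge[of i r x y] by linarith
qed

lemma dist_sup_le_eucl:
  assumes "1 \<le> r"
  shows "dist_sup r x y \<le> dist_eucl r x y"
proof (rule dist_sup_le[OF assms])
  fix i assume "i < r"
  then show "\<bar>x i - y i\<bar> \<le> dist_eucl r x y"
    unfolding dist_eucl_def using member_le_L2_set[of "{..<r}" i "\<lambda>i. \<bar>x i - y i\<bar>"]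
    by (simp add: L2_set_def)
qed

lemma finite_multi_indices: "finite {\<alpha> \<in> multi_indices r. mi_size r \<alpha> \<le> k}"
proof (rule finite_subset)
  show "{\<alpha> \<in> multi_indices r. mi_size r \<alpha> \<le> k} \<subseteq>
      {\<alpha>. \<forall>i. (i \<in> {..<r} \<longrightarrow> \<alpha> i \<in> {..k}) \<and> (i \<notin> {..<r} \<longrightarrow> \<alpha> i = 0)}"
  proof (intro subsetI CollectI allI conjI impI)
    fix \<alpha> i assume a: "\<alpha> \<in> {\<alpha> \<in> multi_indices r. mi_size r \<alpha> \<le> k}"
    show "\<alpha> i = 0" if "i \<notin> {..<r}"
      using a that by (auto simp: multi_indices_def)
    show "\<alpha> i \<in> {..k}" if "i \<in> {..<r}"
      using member_le_sum[of i "{..<r}" \<alpha>] a that by (auto simp: mi_size_def)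
  qed
  show "finite {\<alpha>. \<forall>i. (i \<in> {..<r} \<longrightarrow> \<alpha> i \<in> {..k}) \<and> (i \<notin> {..<r} \<longrightarrow> \<alpha> i = (0::nat))}"
    by (rule finite_set_of_finite_funs) auto
qed

lemma strict_floor_bounds:
  assumes "\<gamma> \<ge> 1"
  shows "real (strict_floor \<gamma>) < \<gamma>" "\<gamma> \<le> real (strict_floor \<gamma>) + 1"
    "real k < \<gamma> \<longleftrightarrow> k \<le> strict_floor \<gamma>"
proof -
  have "\<lceil>\<gamma>\<rceil> \<ge> 1"
    using assms by linarith
  then have eq: "real (strict_floor \<gamma>) = real_of_int (\<lceil>\<gamma>\<rceil> - 1)"
    by (simp add: strict_floor_def)
  show *: "real (strict_floor \<gamma>) < \<gamma>" "\<gamma> \<le> real (strict_floor \<gamma>) + 1"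
    using eq by linarith+
  show "real k < \<gamma> \<longleftrightarrow> k \<le> strict_floor \<gamma>"
    using * by linarith
qed

lemma hoelder_class_derivatives:
  assumes f: "f \<in> hoelder_class r \<gamma> (cube r) K" and "K \<ge> 0" "\<gamma> \<ge> 1" "r \<ge> 1"
  obtains D where
    "\<And>x. x \<in> cube r \<Longrightarrow> D (\<lambda>_. 0) x = f x"
    "\<And>\<alpha> i. \<alpha> \<in> multi_indices r \<Longrightarrow> i < r \<Longrightarrow> mi_size r \<alpha> < strict_floor \<gamma> \<Longrightarrow>
       has_partial_on (cube r) i (D \<alpha>) (D (\<alpha>(i := \<alpha> i + 1)))"
    "\<And>\<alpha> x. \<alpha> \<in> multi_indices r \<Longrightarrow> mi_size r \<alpha> \<le> strict_floor \<gamma> \<Longrightarrow> x \<in> cube r \<Longrightarrow> \<bar>D \<alpha> x\<bar> \<le> K"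
    "\<And>\<alpha> x y. \<alpha> \<in> multi_indices r \<Longrightarrow> mi_size r \<alpha> = strict_floor \<gamma> \<Longrightarrow> x \<in> cube r \<Longrightarrow> y \<in> cube r \<Longrightarrow>
       \<bar>D \<alpha> x - D \<alpha> y\<bar> \<le> K * dist_sup r x y powr (\<gamma> - real (strict_floor \<gamma>))"
proof -
  let ?q = "strict_floor \<gamma>"
  let ?S = "{\<alpha> \<in> multi_indices r. real (mi_size r \<alpha>) < \<gamma>}"
  let ?T = "{\<alpha> \<in> multi_indices r. mi_size r \<alpha> = ?q}"
  obtain D where D0: "\<forall>x\<in>cube r. D (\<lambda>_. 0) x = f x"
    and Dp: "\<forall>\<alpha>\<in>multi_indices r. \<forall>i<r. real (mi_size r \<alpha> + 1) < \<gamma> \<longrightarrow>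
      has_partial_on (cube r) i (D \<alpha>) (D (\<alpha>(i := \<alpha> i + 1)))"
    and Ds: "(\<Sum>\<alpha>\<in>?S. sup_norm_on (cube r) (D \<alpha>)) +
      (\<Sum>\<alpha>\<in>?T. (SUP (x, y)\<in>{(x, y). x \<in> cube r \<and> y \<in> cube r \<and> x \<noteq> y}.
        ennreal (\<bar>D \<alpha> x - D \<alpha> y\<bar> / dist_sup r x y powr (\<gamma> - real ?q)))) \<le> ennreal K"
    (is "?A + ?B \<le> _")
    using f unfolding hoelder_class_def by blast
  have "finite ?S"
    unfolding strict_floor_bounds(3)[OF assms(3)] by (rule finite_multi_indices)
  moreover have "finite ?T"
    by (rule finite_subset[OF _ finite_multi_indices[of r ?q]]) auto
  ultimately have fin: "finite ?S" "finite ?T" .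
  have AB: "?A \<le> ennreal K" "?B \<le> ennreal K"
    by (rule order.trans[OF _ Ds], rule add_increasing2[OF zero_le order_refl],
        rule order.trans[OF _ Ds], rule add_increasing[OF zero_le order_refl])
  show thesis
  proof (rule that[of D])
    show "D (\<lambda>_. 0) x = f x" if "x \<in> cube r" for x
      using D0 that by blast
    show "has_partial_on (cube r) i (D \<alpha>) (D (\<alpha>(i := \<alpha> i + 1)))"
      if "\<alpha> \<in> multi_indices r" "i < r" "mi_size r \<alpha> < ?q" for \<alpha> i
      using Dp that strict_floor_bounds(3)[OF assms(3), of "mi_size r \<alpha> + 1"] by auto
    show "\<bar>D \<alpha> x\<bar> \<le> K" if \<alpha>: "\<alpha> \<in> multi_indices r" "mi_size r \<alpha> \<le> ?q" and x: "x \<in> cube r" for \<alpha> x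
    proof -
      have "ennreal \<bar>D \<alpha> x\<bar> \<le> sup_norm_on (cube r) (D \<alpha>)"
        unfolding sup_norm_on_def using x by (rule SUP_upper)
      also have "\<dots> \<le> ?A"
        using \<alpha> strict_floor_bounds(3)[OF assms(3)] fin by (intro member_le_sum) auto
      also have "\<dots> \<le> ennreal K"
        by (rule AB)
      finally show ?thesis
        using assms(2) by (simp add: ennreal_le_iff)
    qed
    show "\<bar>D \<alpha> x - D \<alpha> y\<bar> \<le> K * dist_sup r x y powr (\<gamma> - real ?q)"
      if \<alpha>: "\<alpha> \<in> multi_indices r" "mi_size r \<alpha> = ?q" and x: "x \<in> cube r" and y: "y \<in> cube r" for \<alpha> x y
    proof (cases "x = y")
      case False
      have pos: "0 < dist_sup r x y"
        using x y False assms(4) by (intro dist_sup_pos) (auto simp: cube_def PiE_def)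
      have "ennreal (\<bar>D \<alpha> x - D \<alpha> y\<bar> / dist_sup r x y powr (\<gamma> - real ?q)) \<le>
          (SUP (x, y)\<in>{(x, y). x \<in> cube r \<and> y \<in> cube r \<and> x \<noteq> y}.
            ennreal (\<bar>D \<alpha> x - D \<alpha> y\<bar> / dist_sup r x y powr (\<gamma> - real ?q)))"
        by (rule SUP_upper2[of "(x, y)"]) (use x y False in auto)
      also have "\<dots> \<le> ?B"
        using \<alpha> fin
        by (intro member_le_sum[of \<alpha> ?T "\<lambda>\<alpha>. SUP (x, y)\<in>{(x, y). x \<in> cube r \<and> y \<in> cube r \<and> x \<noteq> y}.
            ennreal (\<bar>D \<alpha> x - D \<alpha> y\<bar> / dist_sup r x y powr (\<gamma> - real ?q))"]) auto
      also have "\<dots> \<le> ennreal K"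
        by (rule AB)
      finally have "\<bar>D \<alpha> x - D \<alpha> y\<bar> / dist_sup r x y powr (\<gamma> - real ?q) \<le> K"
        using assms(2) by (simp add: ennreal_le_iff)
      then show ?thesis
        using pos by (simp add: pos_divide_le_eq)
    qed (use assms(2) in auto)
  qed
qed

text \<open>
  \<open>dpoly D r \<xi> k \<beta> x / fact k\<close> is the homogeneous part of degree \<open>k\<close> of the Taylor polynomial of
  \<open>D \<beta>\<close> at \<open>\<xi>\<close>, written as a sum over sequences of coordinates instead of multi-indices.
\<close>

primrec dpoly ::
  "((nat \<Rightarrow> nat) \<Rightarrow> (nat \<Rightarrow> real) \<Rightarrow> real) \<Rightarrow> nat \<Rightarrow> (nat \<Rightarrow> real) \<Rightarrow> nat \<Rightarrow> (nat \<Rightarrow> nat) \<Rightarrow>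
    (nat \<Rightarrow> real) \<Rightarrow> real" where
  "dpoly D r \<xi> 0 \<beta> x = D \<beta> \<xi>"
| "dpoly D r \<xi> (Suc k) \<beta> x = (\<Sum>i<r. (x i - \<xi> i) * dpoly D r \<xi> k (\<beta>(i := \<beta> i + 1)) x)"

lemma fun_upd_Suc_commute:
  "(\<beta>(i := \<beta> i + 1))(j := (\<beta>(i := \<beta> i + 1)) j + 1) = (\<beta>(j := \<beta> j + 1))(i := (\<beta>(j := \<beta> j + 1)) i + (1::nat))"
  by (auto simp: fun_eq_iff)

text \<open>In a sum over coordinate sequences of length \<open>k\<close> each position contributes
  the same derivative, because increments of a multi-index commute. For \<open>k = 0\<close> the
  truncated \<open>k - 1\<close> is harmless, its factor being 0.\<close>

lemma dpoly_deriv: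
  assumes "i < r"
  shows "((\<lambda>t. dpoly D r \<xi> k \<beta> (x(i := t))) has_real_derivative
    real k * dpoly D r \<xi> (k - 1) (\<beta>(i := \<beta> i + 1)) (x(i := t))) (at t within S)"
proof (induction k arbitrary: \<beta>)
  case (Suc k)
  let ?x = "x(i := t)"
  let ?G = "\<lambda>j. dpoly D r \<xi> (k - 1) ((\<beta>(i := \<beta> i + 1))(j := (\<beta>(i := \<beta> i + 1)) j + 1)) ?x"
  have G: "dpoly D r \<xi> (k - 1) ((\<beta>(j := \<beta> j + 1))(i := (\<beta>(j := \<beta> j + 1)) i + 1)) ?x = ?G j" for j
    by (rule arg_cong[OF fun_upd_Suc_commute[of \<beta> j i], of "\<lambda>\<beta>. dpoly D r \<xi> (k - 1) \<beta> ?x"])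
  have coord: "((\<lambda>t. (x(i := t)) j - \<xi> j) has_real_derivative (if j = i then 1 else 0)) (at t within S)" for j
  proof (cases "j = i")
    case True
    then show ?thesis
      using DERIV_diff[OF DERIV_ident DERIV_const[of "\<xi> i"], of t S] by simp
  qed simp
  have "((\<lambda>t. dpoly D r \<xi> (Suc k) \<beta> (x(i := t))) has_real_derivative
      (\<Sum>j<r. (?x j - \<xi> j) * (real k * dpoly D r \<xi> (k - 1) ((\<beta>(j := \<beta> j + 1))(i := (\<beta>(j := \<beta> j + 1)) i + 1)) ?x) +
        (if j = i then 1 else 0) * dpoly D r \<xi> k (\<beta>(j := \<beta> j + 1)) ?x)) (at t within S)"
    unfolding dpoly.simps by (rule DERIV_sum, rule DERIV_mult'[OF coord Suc.IH])
  also have "(\<Sum>j<r. (?x j - \<xi> j) * (real k * dpoly D r \<xi> (k - 1) ((\<beta>(j := \<beta> j + 1))(i := (\<beta>(j := \<beta> j + 1)) i + 1)) ?x) +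
        (if j = i then 1 else 0) * dpoly D r \<xi> k (\<beta>(j := \<beta> j + 1)) ?x) =
      real k * (\<Sum>j<r. (?x j - \<xi> j) * ?G j) +
      (\<Sum>j<r. (if j = i then 1 else 0) * dpoly D r \<xi> k (\<beta>(j := \<beta> j + 1)) ?x)"
    unfolding sum.distrib sum_distrib_left[of "real k"] G mult.left_commute[of _ "real k"] ..
  also have "(\<Sum>j<r. (if j = i then 1 else 0) * dpoly D r \<xi> k (\<beta>(j := \<beta> j + 1)) ?x) =
      (\<Sum>j<r. if j = i then dpoly D r \<xi> k (\<beta>(i := \<beta> i + 1)) ?x else 0)"
    by (intro sum.cong refl) simp
  also have "\<dots> = dpoly D r \<xi> k (\<beta>(i := \<beta> i + 1)) ?x"
    using assms by (simp only: sum.delta finite_lessThan lessThan_iff if_True)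
  also have "real k * (\<Sum>j<r. (?x j - \<xi> j) * ?G j) = real k * dpoly D r \<xi> k (\<beta>(i := \<beta> i + 1)) ?x"
  proof (cases k)
    case (Suc k')
    show ?thesis
      unfolding Suc diff_Suc_1 dpoly.simps(2) ..
  qed simp
  also have "real k * dpoly D r \<xi> k (\<beta>(i := \<beta> i + 1)) ?x + dpoly D r \<xi> k (\<beta>(i := \<beta> i + 1)) ?x =
      real (Suc k) * dpoly D r \<xi> (Suc k - 1) (\<beta>(i := \<beta> i + 1)) ?x"
    unfolding diff_Suc_1 of_nat_Suc distrib_right mult_1_left by (rule add.commute)
  finally show ?case .
qed auto

definition taylor where
  "taylor D r \<xi> q \<beta> x = (\<Sum>k\<le>q. dpoly D r \<xi> k \<beta> x / fact k)"

text \<open>Differentiation lowers the degree and raises the multi-index, so the derivative of a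
  Taylor remainder is again a Taylor remainder. This is the induction step of
  \<open>taylor_bound\<close>.\<close>

lemma taylor_deriv:
  assumes "i < r"
  shows "((\<lambda>t. taylor D r \<xi> (Suc q) \<beta> (x(i := t))) has_real_derivative
    taylor D r \<xi> q (\<beta>(i := \<beta> i + 1)) (x(i := t))) (at t within S)"
proof -
  have "((\<lambda>t. taylor D r \<xi> (Suc q) \<beta> (x(i := t))) has_real_derivative
      (\<Sum>k\<le>Suc q. real k * dpoly D r \<xi> (k - 1) (\<beta>(i := \<beta> i + 1)) (x(i := t)) / fact k)) (at t within S)"
    unfolding taylor_def by (intro DERIV_sum DERIV_cdivide dpoly_deriv assms)
  also have "(\<Sum>k\<le>Suc q. real k * dpoly D r \<xi> (k - 1) (\<beta>(i := \<beta> i + 1)) (x(i := t)) / fact k) =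
      (\<Sum>k\<le>q. real (Suc k) * dpoly D r \<xi> k (\<beta>(i := \<beta> i + 1)) (x(i := t)) / fact (Suc k))"
    by (subst sum.atMost_Suc_shift) simp
  also have "\<dots> = taylor D r \<xi> q (\<beta>(i := \<beta> i + 1)) (x(i := t))"
    unfolding taylor_def by (intro sum.cong refl) (simp add: divide_simps del: of_nat_Suc)
  finally show ?thesis .
qed

lemma taylor_center: "taylor D r \<xi> q \<beta> \<xi> = D \<beta> \<xi>"
proof -
  have "taylor D r \<xi> q \<beta> \<xi> = (\<Sum>k\<in>{0}. dpoly D r \<xi> k \<beta> \<xi> / fact k)"
    unfolding taylor_def
  proof (rule sum.mono_neutral_right)
    show "\<forall>k\<in>{..q} - {0}. dpoly D r \<xi> k \<beta> \<xi> / fact k = 0"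
    proof
      fix k assume "k \<in> {..q} - {0}"
      then show "dpoly D r \<xi> k \<beta> \<xi> / fact k = 0"
        by (cases k) auto
    qed
  qed auto
  then show ?thesis
    by simp
qed

lemma mi_size_upd: "i < r \<Longrightarrow> mi_size r (\<alpha>(i := \<alpha> i + 1)) = mi_size r \<alpha> + 1"
proof -
  assume i: "i < r"
  have "(\<Sum>j\<in>{..<r} - {i}. (\<alpha>(i := \<alpha> i + 1)) j) = (\<Sum>j\<in>{..<r} - {i}. \<alpha> j)"
    by (rule sum.cong) auto
  then show ?thesis
    using i by (simp add: mi_size_def sum.remove[of "{..<r}" i])
qed

lemma multi_indices_upd: "i < r \<Longrightarrow> \<alpha> \<in> multi_indices r \<Longrightarrow> \<alpha>(i := \<alpha> i + 1) \<in> multi_indices r"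
  by (auto simp: multi_indices_def)

text \<open>
  Only coordinatewise derivatives are available, so the remainder is integrated along a path that
  changes one coordinate at a time.
\<close>

lemma taylor_bound:
  assumes r: "r \<ge> 1" and K: "K \<ge> 0" and \<gamma>: "real q \<le> \<gamma>"
    and Dp: "\<And>\<alpha> i. \<alpha> \<in> multi_indices r \<Longrightarrow> i < r \<Longrightarrow> mi_size r \<alpha> < q \<Longrightarrow>
       has_partial_on (cube r) i (D \<alpha>) (D (\<alpha>(i := \<alpha> i + 1)))"
    and Dh: "\<And>\<alpha> x y. \<alpha> \<in> multi_indices r \<Longrightarrow> mi_size r \<alpha> = q \<Longrightarrow> x \<in> cube r \<Longrightarrow> y \<in> cube r \<Longrightarrow>
       \<bar>D \<alpha> x - D \<alpha> y\<bar> \<le> K * dist_sup r x y powr (\<gamma> - real q)"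
    and \<xi>: "\<xi> \<in> cube r"
  shows "\<beta> \<in> multi_indices r \<Longrightarrow> mi_size r \<beta> + j = q \<Longrightarrow> x \<in> cube r \<Longrightarrow>
    \<bar>D \<beta> x - taylor D r \<xi> j \<beta> x\<bar> \<le> K * real r ^ j * dist_sup r x \<xi> powr (\<gamma> - real q + real j)"
\<comment> \<open>\<open>j\<close> is the number of derivatives still available. For
  \<open>j = 0\<close> the Taylor polynomial is the constant \<open>D \<beta> \<xi>\<close> and the
  claim is the Hoelder condition on the top derivatives.\<close>
proof (induction j arbitrary: \<beta> x)
  case 0
  then show ?case
    using Dh[of \<beta> x \<xi>] \<xi> by (simp add: taylor_def)
next
  case (Suc j)
  define R where "R = (\<lambda>y. D \<beta> y - taylor D r \<xi> (Suc j) \<beta> y)"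
  \<comment> \<open>The corners of the path from \<open>\<xi>\<close> to \<open>x\<close>, on which
    the first \<open>m\<close> coordinates have already been moved. The path stays in the cube
    because the cube is a product.\<close>
  define z where "z = (\<lambda>m i. if i < m then x i else \<xi> i)"
  define B where "B = K * real r ^ j * dist_sup r x \<xi> powr (\<gamma> - real q + real j)"
  have ext: "x i = undefined" "\<xi> i = undefined" if "i \<ge> r" for i
    using Suc.prems(3) \<xi> that by (auto simp: cube_def PiE_def extensional_def)
  have unit: "0 \<le> x i \<and> x i \<le> 1" "0 \<le> \<xi> i \<and> \<xi> i \<le> 1" if "i < r" for i
    using Suc.prems(3) \<xi> that by (auto simp: cube_def PiE_def Pi_def)
  have step: "\<bar>R (z (Suc m)) - R (z m)\<bar> \<le> B * \<bar>x m - \<xi> m\<bar>" if m: "m < r" for m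
  proof -
    let ?S = "closed_segment (\<xi> m) (x m)"
    let ?R' = "\<lambda>y. D (\<beta>(m := \<beta> m + 1)) y - taylor D r \<xi> j (\<beta>(m := \<beta> m + 1)) y"
    have inS: "0 \<le> t \<and> t \<le> 1 \<and> \<bar>t - \<xi> m\<bar> \<le> \<bar>x m - \<xi> m\<bar>" if "t \<in> ?S" for t
      using that unit[OF m] by (auto simp: closed_segment_eq_real_ivl split: if_splits)
    have zc: "(z m)(m := t) \<in> cube r" if "0 \<le> t \<and> t \<le> 1" for t
      using that unit ext m by (auto simp: z_def cube_def PiE_def Pi_def extensional_def)
    have "norm (R ((z m)(m := x m)) - R ((z m)(m := \<xi> m))) \<le> B * norm (x m - \<xi> m)"
    proof (rule field_differentiable_bound[of ?S _ "\<lambda>t. ?R' ((z m)(m := t))"])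
      fix t assume t: "t \<in> ?S"
      have "has_partial_on (cube r) m (D \<beta>) (D (\<beta>(m := \<beta> m + 1)))"
        using Dp Suc.prems m by simp
      then have "((\<lambda>s. D \<beta> (((z m)(m := t))(m := s))) has_real_derivative D (\<beta>(m := \<beta> m + 1)) ((z m)(m := t)))
          (at (((z m)(m := t)) m) within {s. ((z m)(m := t))(m := s) \<in> cube r})"
        unfolding has_partial_on_def using zc inS[OF t] by blast
      then have "((\<lambda>s. D \<beta> ((z m)(m := s))) has_real_derivative D (\<beta>(m := \<beta> m + 1)) ((z m)(m := t)))
          (at t within {s. (z m)(m := s) \<in> cube r})"
        by simp
      then have "((\<lambda>s. D \<beta> ((z m)(m := s))) has_real_derivative D (\<beta>(m := \<beta> m + 1)) ((z m)(m := t))) (at t within ?S)"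
        by (rule DERIV_subset) (use zc inS in blast)
      then show "((\<lambda>s. R ((z m)(m := s))) has_field_derivative ?R' ((z m)(m := t))) (at t within ?S)"
        unfolding R_def by (intro DERIV_diff taylor_deriv m)
      \<comment> \<open>No coordinate of a path point is farther from \<open>\<xi>\<close> than that
        of \<open>x\<close>, so the induction hypothesis gives one bound along the whole
        path.\<close>
      have "dist_sup r ((z m)(m := t)) \<xi> \<le> dist_sup r x \<xi>"
      proof (rule dist_sup_le[OF r])
        fix i assume i: "i < r"
        have "\<bar>((z m)(m := t)) i - \<xi> i\<bar> \<le> \<bar>x i - \<xi> i\<bar>"
          using inS[OF t] by (auto simp: z_def)
        then show "\<bar>((z m)(m := t)) i - \<xi> i\<bar> \<le> dist_sup r x \<xi>"
          using dist_sup_ge[OF i, of x \<xi>] by linarith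
      qed
      then have "dist_sup r ((z m)(m := t)) \<xi> powr (\<gamma> - real q + real j) \<le>
          dist_sup r x \<xi> powr (\<gamma> - real q + real j)"
        using dist_sup_nonneg[OF r] \<gamma> by (intro powr_mono2) auto
      then have "K * real r ^ j * dist_sup r ((z m)(m := t)) \<xi> powr (\<gamma> - real q + real j) \<le> B"
        unfolding B_def using K by (intro mult_left_mono) auto
      moreover have "\<bar>?R' ((z m)(m := t))\<bar> \<le>
          K * real r ^ j * dist_sup r ((z m)(m := t)) \<xi> powr (\<gamma> - real q + real j)"
      proof (rule Suc.IH)
        show "mi_size r (\<beta>(m := \<beta> m + 1)) + j = q"
          unfolding mi_size_upd[OF m] using Suc.prems(2) by simp
      qed (use Suc.prems(1) m zc inS[OF t] multi_indices_upd in blast)+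
      ultimately show "norm (?R' ((z m)(m := t))) \<le> B"
        by simp
    qed auto
    moreover have "(z m)(m := x m) = z (Suc m)" "(z m)(m := \<xi> m) = z m"
      by (auto simp: z_def fun_eq_iff)
    ultimately show ?thesis
      by simp
  qed
  have "z r = x" "z 0 = \<xi>"
    using ext by (auto simp: z_def fun_eq_iff)
  then have "R x - R \<xi> = (\<Sum>m<r. R (z (Suc m)) - R (z m))"
    using sum_lessThan_telescope[of "\<lambda>m. R (z m)" r] by simp
  then have "\<bar>R x - R \<xi>\<bar> \<le> (\<Sum>m<r. \<bar>R (z (Suc m)) - R (z m)\<bar>)"
    by simp
  also have "\<dots> \<le> (\<Sum>m<r. B * dist_sup r x \<xi>)"
  proof (rule sum_mono)
    fix m assume "m \<in> {..<r}"
    then have "B * \<bar>x m - \<xi> m\<bar> \<le> B * dist_sup r x \<xi>" "\<bar>R (z (Suc m)) - R (z m)\<bar> \<le> B * \<bar>x m - \<xi> m\<bar>"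
      using step dist_sup_ge[of m r x \<xi>] K by (auto simp: B_def intro!: mult_left_mono)
    then show "\<bar>R (z (Suc m)) - R (z m)\<bar> \<le> B * dist_sup r x \<xi>"
      by simp
  qed
  also have "\<dots> = K * real r ^ Suc j * (dist_sup r x \<xi> * dist_sup r x \<xi> powr (\<gamma> - real q + real j))"
    by (simp add: B_def)
  also have "dist_sup r x \<xi> * dist_sup r x \<xi> powr (\<gamma> - real q + real j) =
      dist_sup r x \<xi> powr (\<gamma> - real q + real (Suc j))"
    using powr_mult_base[OF dist_sup_nonneg[OF r]] by (simp add: algebra_simps)
  finally show ?case
    by (simp add: R_def taylor_center)
qed

section \<open>Polynomials as combinations of words\<close>

definition clip_coord :: "nat \<Rightarrow> nat \<Rightarrow> (nat \<Rightarrow> real) \<Rightarrow> real" where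
  "clip_coord r i x = (if i < r then max 0 (min 1 (x i)) else 1)"

text \<open>Words take the place of multi-indices because a word of length \<open>2 ^ Suc k\<close>
  splits into two halves of length \<open>2 ^ k\<close>, which is how the product tree evaluates it.
  Different words may stand for the same monomial.\<close>

definition words :: "nat \<Rightarrow> nat \<Rightarrow> nat list set" where
  "words r Q = {l. set l \<subseteq> {..r} \<and> length l = Q}"

definition monomial :: "nat \<Rightarrow> nat list \<Rightarrow> (nat \<Rightarrow> real) \<Rightarrow> real" where
  "monomial r l x = (\<Prod>i\<leftarrow>l. clip_coord r i x)"

text \<open>
  Polynomials of degree at most \<open>Q\<close> on the cube, homogenized by the coordinate \<open>r\<close>, which is
  constantly 1; \<open>B\<close> bounds the sum of the absolute values of the coefficients.
\<close>

definition poly_rep :: "nat \<Rightarrow> nat \<Rightarrow> real \<Rightarrow> ((nat \<Rightarrow> real) \<Rightarrow> real) \<Rightarrow> bool" where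
  "poly_rep r Q B p \<longleftrightarrow> (\<exists>b. (\<Sum>l\<in>words r Q. \<bar>b l\<bar>) \<le> B \<and>
     (\<forall>x\<in>cube r. p x = (\<Sum>l\<in>words r Q. b l * monomial r l x)))"

lemma finite_words: "finite (words r Q)"
  unfolding words_def by (rule finite_lists_length_eq) auto

lemma words_0: "words r 0 = {[]}"
  by (auto simp: words_def)

lemma words_Suc: "words r (Suc Q) = (\<lambda>(i, l). i # l) ` ({..r} \<times> words r Q)"
  by (auto simp: words_def image_iff length_Suc_conv)

lemma sum_words_Suc: "(\<Sum>l\<in>words r (Suc Q). g l) = (\<Sum>i\<le>r. \<Sum>l\<in>words r Q. g (i # l))"
  unfolding words_Suc sum.cartesian_product by (subst sum.reindex) (auto simp: inj_on_def split_beta)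

lemma poly_rep_const: "\<bar>c\<bar> \<le> B \<Longrightarrow> poly_rep r 0 B (\<lambda>_. c)"
  unfolding poly_rep_def by (intro exI[of _ "\<lambda>_. c"]) (auto simp: words_0 monomial_def)

lemma poly_rep_mono: "poly_rep r Q B p \<Longrightarrow> B \<le> B' \<Longrightarrow> poly_rep r Q B' p"
  unfolding poly_rep_def by (meson order.trans)

lemma poly_rep_cong: "poly_rep r Q B p \<Longrightarrow> (\<And>x. x \<in> cube r \<Longrightarrow> p' x = p x) \<Longrightarrow> poly_rep r Q B p'"
  unfolding poly_rep_def by simp

lemma poly_rep_mult_coord:
  assumes "poly_rep r Q B p" "i \<le> r"
  shows "poly_rep r (Suc Q) B (\<lambda>x. clip_coord r i x * p x)"
proof -
  obtain b where b: "(\<Sum>l\<in>words r Q. \<bar>b l\<bar>) \<le> B"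
    "\<forall>x\<in>cube r. p x = (\<Sum>l\<in>words r Q. b l * monomial r l x)"
    using assms(1) unfolding poly_rep_def by blast
  let ?b = "\<lambda>l. if hd l = i then b (tl l) else 0"
  have "(\<Sum>l\<in>words r (Suc Q). \<bar>?b l\<bar>) = (\<Sum>j\<le>r. if j = i then \<Sum>l\<in>words r Q. \<bar>b l\<bar> else 0)"
    unfolding sum_words_Suc by (intro sum.cong) auto
  also have "\<dots> \<le> B"
    using assms(2) b(1) by simp
  finally have 1: "(\<Sum>l\<in>words r (Suc Q). \<bar>?b l\<bar>) \<le> B" .
  have 2: "clip_coord r i x * p x = (\<Sum>l\<in>words r (Suc Q). ?b l * monomial r l x)" if "x \<in> cube r" for x
  proof -
    have "(\<Sum>l\<in>words r (Suc Q). ?b l * monomial r l x) =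
        (\<Sum>j\<le>r. if j = i then \<Sum>l\<in>words r Q. b l * monomial r (i # l) x else 0)"
      unfolding sum_words_Suc by (intro sum.cong) auto
    also have "\<dots> = (\<Sum>l\<in>words r Q. b l * monomial r (i # l) x)"
      using assms(2) by simp
    also have "\<dots> = clip_coord r i x * p x"
      using b(2) that by (simp add: monomial_def sum_distrib_left algebra_simps)
    finally show ?thesis ..
  qed
  show ?thesis
    unfolding poly_rep_def using 1 2 by (intro exI[of _ ?b]) blast
qed

lemma poly_rep_add:
  assumes "poly_rep r Q B p" "poly_rep r Q B' p'"
  shows "poly_rep r Q (B + B') (\<lambda>x. p x + p' x)"
proof -
  obtain b b' where b: "(\<Sum>l\<in>words r Q. \<bar>b l\<bar>) \<le> B"
    "\<forall>x\<in>cube r. p x = (\<Sum>l\<in>words r Q. b l * monomial r l x)"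
    and b': "(\<Sum>l\<in>words r Q. \<bar>b' l\<bar>) \<le> B'"
    "\<forall>x\<in>cube r. p' x = (\<Sum>l\<in>words r Q. b' l * monomial r l x)"
    using assms unfolding poly_rep_def by blast
  have "(\<Sum>l\<in>words r Q. \<bar>b l + b' l\<bar>) \<le> (\<Sum>l\<in>words r Q. \<bar>b l\<bar> + \<bar>b' l\<bar>)"
    by (intro sum_mono abs_triangle_ineq)
  then have "(\<Sum>l\<in>words r Q. \<bar>b l + b' l\<bar>) \<le> B + B'"
    using b(1) b'(1) by (simp add: sum.distrib)
  then show ?thesis
    unfolding poly_rep_def using b(2) b'(2)
    by (intro exI[of _ "\<lambda>l. b l + b' l"]) (simp add: sum.distrib algebra_simps)
qed

lemma poly_rep_scale:
  assumes "poly_rep r Q B p"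
  shows "poly_rep r Q (\<bar>a\<bar> * B) (\<lambda>x. a * p x)"
proof -
  obtain b where b: "(\<Sum>l\<in>words r Q. \<bar>b l\<bar>) \<le> B"
    "\<forall>x\<in>cube r. p x = (\<Sum>l\<in>words r Q. b l * monomial r l x)"
    using assms unfolding poly_rep_def by blast
  have "(\<Sum>l\<in>words r Q. \<bar>a * b l\<bar>) \<le> \<bar>a\<bar> * B"
    using b(1) by (simp add: abs_mult mult_left_mono flip: sum_distrib_left)
  then show ?thesis
    unfolding poly_rep_def using b(2)
    by (intro exI[of _ "\<lambda>l. a * b l"]) (simp add: sum_distrib_left algebra_simps)
qed

lemma poly_rep_zero: "poly_rep r Q 0 (\<lambda>_. 0)"
  unfolding poly_rep_def by (intro exI[of _ "\<lambda>_. 0"]) auto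

lemma poly_rep_sum:
  assumes "\<And>i. i \<in> I \<Longrightarrow> poly_rep r Q (B i) (p i)" "finite I"
  shows "poly_rep r Q (\<Sum>i\<in>I. B i) (\<lambda>x. \<Sum>i\<in>I. p i x)"
  using assms(2,1) by induction (auto intro: poly_rep_zero poly_rep_add)

text \<open>Padding words with the coordinate that is constantly 1 raises the degree and leaves the
  coefficients alone.\<close>

lemma poly_rep_degree_mono:
  assumes "poly_rep r Q B p" "Q \<le> Q'"
  shows "poly_rep r Q' B p"
  using assms(2)
proof (induction rule: dec_induct)
  case (step n)
  show ?case
    by (rule poly_rep_cong[OF poly_rep_mult_coord[OF step.IH, of r]]) (auto simp: clip_coord_def)
qed (rule assms(1))

lemma clip_coord_cube: "x \<in> cube r \<Longrightarrow> i < r \<Longrightarrow> clip_coord r i x = x i"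
  by (auto simp: clip_coord_def cube_def PiE_def Pi_def)

text \<open>A factor \<open>x i - \<xi> i\<close> is a coordinate plus a constant of absolute value
  at most 1, hence the 2; summing over the coordinates gives the \<open>r\<close>.\<close>

lemma poly_rep_dpoly:
  assumes "\<And>\<alpha>. \<alpha> \<in> multi_indices r \<Longrightarrow> mi_size r \<alpha> \<le> q \<Longrightarrow> \<bar>D \<alpha> \<xi>\<bar> \<le> K" "\<xi> \<in> cube r" "K \<ge> 0"
  shows "\<beta> \<in> multi_indices r \<Longrightarrow> mi_size r \<beta> + k \<le> q \<Longrightarrow> poly_rep r k ((2 * real r) ^ k * K) (dpoly D r \<xi> k \<beta>)"
proof (induction k arbitrary: \<beta>)
  case 0
  then show ?case
    using poly_rep_const[of "D \<beta> \<xi>" K r] assms(1)[of \<beta>] by (simp add: dpoly.simps(1)[abs_def])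
next
  case (Suc k)
  let ?d = "\<lambda>i. dpoly D r \<xi> k (\<beta>(i := \<beta> i + 1))" and ?B = "(2 * real r) ^ k * K"
  have "poly_rep r (Suc k) (2 * ?B) (\<lambda>x. (x i - \<xi> i) * ?d i x)" if i: "i < r" for i
  proof -
    have d: "poly_rep r k ?B (?d i)"
    proof (rule Suc.IH)
      show "mi_size r (\<beta>(i := \<beta> i + 1)) + k \<le> q"
        unfolding mi_size_upd[OF i] using Suc.prems(2) by simp
    qed (use Suc.prems(1) i multi_indices_upd in blast)
    have "\<bar>- \<xi> i\<bar> \<le> 1"
      using assms(2) i by (auto simp: cube_def PiE_def Pi_def)
    then have "\<bar>- \<xi> i\<bar> * ?B \<le> 1 * ?B"
      using assms(3) by (intro mult_right_mono) auto
    then have "poly_rep r (Suc k) ?B (\<lambda>x. - \<xi> i * (clip_coord r r x * ?d i x))"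
      using poly_rep_mono[OF poly_rep_scale[OF poly_rep_mult_coord[OF d, of r], of "- \<xi> i"]] by simp
    from poly_rep_add[OF poly_rep_mult_coord[OF d, of i] this] i
    have "poly_rep r (Suc k) (?B + ?B) (\<lambda>x. clip_coord r i x * ?d i x + - \<xi> i * (clip_coord r r x * ?d i x))"
      by simp
    then have "poly_rep r (Suc k) (?B + ?B) (\<lambda>x. (x i - \<xi> i) * ?d i x)"
      by (rule poly_rep_cong) (use i in \<open>auto simp: clip_coord_cube clip_coord_def[of r r] algebra_simps\<close>)
    then show ?thesis
      by (simp only: mult_2[of ?B])
  qed
  from poly_rep_sum[of "{..<r}", OF this]
  have "poly_rep r (Suc k) (\<Sum>i<r. 2 * ?B) (\<lambda>x. \<Sum>i<r. (x i - \<xi> i) * ?d i x)"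
    by simp
  then show ?case
    by (simp add: algebra_simps)
qed

text \<open>The degree \<open>Q\<close> stays free because the product tree wants a power of
  2.\<close>

lemma hoelder_taylor:
  assumes f: "f \<in> hoelder_class r \<gamma> (cube r) K" and K: "K \<ge> 0" and \<gamma>: "\<gamma> \<ge> 1" and r: "r \<ge> 1"
    and Q: "strict_floor \<gamma> \<le> Q" and \<xi>: "\<xi> \<in> cube r"
  obtains P where "poly_rep r Q (K * (\<Sum>k\<le>strict_floor \<gamma>. (2 * real r) ^ k)) P" "P \<xi> = f \<xi>"
    "\<And>x. x \<in> cube r \<Longrightarrow> \<bar>f x - P x\<bar> \<le> K * real r ^ strict_floor \<gamma> * dist_sup r x \<xi> powr \<gamma>"
proof -
  let ?q = "strict_floor \<gamma>"
  obtain D where D0: "\<And>x. x \<in> cube r \<Longrightarrow> D (\<lambda>_. 0) x = f x"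
    and Dp: "\<And>\<alpha> i. \<alpha> \<in> multi_indices r \<Longrightarrow> i < r \<Longrightarrow> mi_size r \<alpha> < ?q \<Longrightarrow>
       has_partial_on (cube r) i (D \<alpha>) (D (\<alpha>(i := \<alpha> i + 1)))"
    and Db: "\<And>\<alpha> x. \<alpha> \<in> multi_indices r \<Longrightarrow> mi_size r \<alpha> \<le> ?q \<Longrightarrow> x \<in> cube r \<Longrightarrow> \<bar>D \<alpha> x\<bar> \<le> K"
    and Dh: "\<And>\<alpha> x y. \<alpha> \<in> multi_indices r \<Longrightarrow> mi_size r \<alpha> = ?q \<Longrightarrow> x \<in> cube r \<Longrightarrow> y \<in> cube r \<Longrightarrow>
       \<bar>D \<alpha> x - D \<alpha> y\<bar> \<le> K * dist_sup r x y powr (\<gamma> - real ?q)"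
    using hoelder_class_derivatives[OF f K \<gamma> r] by blast
  have z: "(\<lambda>_. 0) \<in> multi_indices r" "mi_size r (\<lambda>_. 0) = 0"
    by (auto simp: multi_indices_def mi_size_def)
  show thesis
  proof (rule that[of "taylor D r \<xi> ?q (\<lambda>_. 0)"])
    have "poly_rep r Q (((2 * real r) ^ k * K)) (\<lambda>x. dpoly D r \<xi> k (\<lambda>_. 0) x / fact k)" if "k \<le> ?q" for k
    proof -
      have 1: "poly_rep r k ((2 * real r) ^ k * K) (dpoly D r \<xi> k (\<lambda>_. 0))"
        using z that Db \<xi> K by (intro poly_rep_dpoly[where q="?q"]) auto
      have "\<bar>1 / fact k\<bar> * ((2 * real r) ^ k * K) \<le> 1 * ((2 * real r) ^ k * K)"
        using K by (intro mult_right_mono) (auto simp: fact_ge_1)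
      then have "poly_rep r k ((2 * real r) ^ k * K) (\<lambda>x. 1 / fact k * dpoly D r \<xi> k (\<lambda>_. 0) x)"
        using poly_rep_mono[OF poly_rep_scale[OF 1, of "1 / fact k"]] by simp
      then show ?thesis
        using poly_rep_degree_mono[of r k _ _ Q] that Q by simp
    qed
    from poly_rep_sum[of "{..?q}", OF this]
    have "poly_rep r Q (\<Sum>k\<le>?q. (2 * real r) ^ k * K) (taylor D r \<xi> ?q (\<lambda>_. 0))"
      by (simp add: taylor_def[abs_def])
    then show "poly_rep r Q (K * (\<Sum>k\<le>?q. (2 * real r) ^ k)) (taylor D r \<xi> ?q (\<lambda>_. 0))"
      by (simp add: sum_distrib_left mult.commute)
    show "taylor D r \<xi> ?q (\<lambda>_. 0) \<xi> = f \<xi>"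
      using D0[OF \<xi>] by (simp add: taylor_center)
    show "\<bar>f x - taylor D r \<xi> ?q (\<lambda>_. 0) x\<bar> \<le> K * real r ^ ?q * dist_sup r x \<xi> powr \<gamma>" if x: "x \<in> cube r" for x
    proof -
      have "\<bar>D (\<lambda>_. 0) x - taylor D r \<xi> ?q (\<lambda>_. 0) x\<bar> \<le>
          K * real r ^ ?q * dist_sup r x \<xi> powr (\<gamma> - real ?q + real ?q)"
      proof (rule taylor_bound[where D=D, OF r K _ _ _ \<xi> z(1) _ x])
        show "real ?q \<le> \<gamma>"
          using strict_floor_bounds(1)[OF \<gamma>] by simp
        show "mi_size r (\<lambda>_. 0) + ?q = ?q"
          by (simp add: z(2))
      qed (fact Dp Dh)+
      then show ?thesis
        using D0[OF x] by simp
    qed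
  qed
qed

subsection \<open>Hat functions and quasi-interpolation\<close>

lemma clip_coord_bounds: "0 \<le> clip_coord r i x" "clip_coord r i x \<le> 1"
  by (auto simp: clip_coord_def)

lemma clip_coord_lip: "1 \<le> r \<Longrightarrow> \<bar>clip_coord r i x - clip_coord r i y\<bar> \<le> dist_sup r x y"
  using dist_sup_ge[of i r x y] dist_sup_nonneg[of r x y] by (auto simp: clip_coord_def)

lemma monomial_bounds: "0 \<le> monomial r l x \<and> monomial r l x \<le> 1"
proof (induction l)
  case (Cons i l)
  then show ?case
    using clip_coord_bounds[of r i x] by (auto simp: monomial_def mult_le_one)
qed (simp add: monomial_def)

lemma prod_diff_bound:
  fixes a b c d :: real
  assumes "\<bar>a - c\<bar> \<le> e" "\<bar>b - d\<bar> \<le> e'" "\<bar>b\<bar> \<le> 1" "\<bar>c\<bar> \<le> 1"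
  shows "\<bar>a * b - c * d\<bar> \<le> e + e'"
proof -
  have "a * b - c * d = (a - c) * b + c * (b - d)"
    by (simp add: algebra_simps)
  then have "\<bar>a * b - c * d\<bar> \<le> \<bar>a - c\<bar> * \<bar>b\<bar> + \<bar>c\<bar> * \<bar>b - d\<bar>"
    by (metis abs_mult abs_triangle_ineq)
  also have "\<dots> \<le> e * 1 + 1 * e'"
    using assms by (intro add_mono mult_mono) auto
  finally show ?thesis
    by simp
qed

lemma monomial_lip:
  assumes "1 \<le> r"
  shows "\<bar>monomial r l x - monomial r l y\<bar> \<le> real (length l) * dist_sup r x y"
proof (induction l)
  case (Cons i l)
  have "\<bar>clip_coord r i x * monomial r l x - clip_coord r i y * monomial r l y\<bar> \<le>
      dist_sup r x y + real (length l) * dist_sup r x y"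
    using clip_coord_bounds[of r i y] monomial_bounds[of r l x]
    by (intro prod_diff_bound clip_coord_lip assms Cons.IH) auto
  then show ?case
    by (simp add: monomial_def algebra_simps)
qed (simp add: monomial_def)

lemma poly_rep_bound:
  assumes "poly_rep r Q B p" "x \<in> cube r"
  shows "\<bar>p x\<bar> \<le> B"
proof -
  obtain b where b: "(\<Sum>l\<in>words r Q. \<bar>b l\<bar>) \<le> B"
    "\<forall>x\<in>cube r. p x = (\<Sum>l\<in>words r Q. b l * monomial r l x)"
    using assms(1) unfolding poly_rep_def by blast
  have "\<bar>p x\<bar> \<le> (\<Sum>l\<in>words r Q. \<bar>b l * monomial r l x\<bar>)"
    using b(2) assms(2) by simp
  also have "\<dots> \<le> (\<Sum>l\<in>words r Q. \<bar>b l\<bar> * 1)"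
    unfolding abs_mult using monomial_bounds by (intro sum_mono mult_left_mono) auto
  finally show ?thesis
    using b(1) by simp
qed

lemma poly_rep_lip:
  assumes "poly_rep r Q B p" "x \<in> cube r" "y \<in> cube r" "1 \<le> r"
  shows "\<bar>p x - p y\<bar> \<le> B * real Q * dist_sup r x y"
proof -
  obtain b where b: "(\<Sum>l\<in>words r Q. \<bar>b l\<bar>) \<le> B"
    "\<forall>x\<in>cube r. p x = (\<Sum>l\<in>words r Q. b l * monomial r l x)"
    using assms(1) unfolding poly_rep_def by blast
  have "p x - p y = (\<Sum>l\<in>words r Q. b l * (monomial r l x - monomial r l y))"
    using b(2) assms(2,3) by (simp add: right_diff_distrib sum_subtractf)
  then have "\<bar>p x - p y\<bar> \<le> (\<Sum>l\<in>words r Q. \<bar>b l * (monomial r l x - monomial r l y)\<bar>)"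
    by simp
  also have "\<dots> \<le> (\<Sum>l\<in>words r Q. \<bar>b l\<bar> * (real Q * dist_sup r x y))"
    unfolding abs_mult
  proof (intro sum_mono mult_left_mono)
    fix l assume "l \<in> words r Q"
    then show "\<bar>monomial r l x - monomial r l y\<bar> \<le> real Q * dist_sup r x y"
      using monomial_lip[OF assms(4), of l x y] by (simp add: words_def)
  qed auto
  also have "\<dots> = (\<Sum>l\<in>words r Q. \<bar>b l\<bar>) * (real Q * dist_sup r x y)"
    by (simp add: sum_distrib_right)
  also have "\<dots> \<le> B * (real Q * dist_sup r x y)"
    using b(1) dist_sup_nonneg[OF assms(4)] by (intro mult_right_mono) auto
  finally show ?thesis
    by simp
qed

section \<open>Nodal functions of the Kuhn triangulation\<close>

text \<open>The recursion follows the way in which \<open>hat_chain\<close> updates a running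
  maximum, one coordinate at a time.\<close>

primrec pos_max :: "(nat \<Rightarrow> real) \<Rightarrow> nat \<Rightarrow> real" where
  "pos_max v 0 = 0"
| "pos_max v (Suc k) = max (pos_max v k) (v k)"

lemma pos_max_nonneg: "0 \<le> pos_max v k"
  by (induction k) (auto simp: max_def)

lemma pos_max_le_iff: "pos_max v k \<le> c \<longleftrightarrow> 0 \<le> c \<and> (\<forall>i<k. v i \<le> c)"
  by (induction k) (auto simp: less_Suc_eq)

lemma pos_max_less_iff: "pos_max v k < c \<longleftrightarrow> 0 < c \<and> (\<forall>i<k. v i < c)"
  by (induction k) (auto simp: less_Suc_eq)

lemma pos_max_lip:
  assumes "\<And>i. i < k \<Longrightarrow> \<bar>v i - w i\<bar> \<le> d" "0 \<le> d"
  shows "\<bar>pos_max v k - pos_max w k\<bar> \<le> d"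
  using assms
proof (induction k)
  case (Suc k)
  have "\<bar>pos_max v k - pos_max w k\<bar> \<le> d" "\<bar>v k - w k\<bar> \<le> d"
    using Suc by auto
  then show ?case
    by (auto simp: max_def)
qed auto

lemma pos_max_scale: "0 \<le> c \<Longrightarrow> pos_max (\<lambda>i. c * v i) k = c * pos_max v k"
  by (induction k) (auto simp: max_mult_distrib_left)

definition grid :: "nat \<Rightarrow> nat \<Rightarrow> (nat \<Rightarrow> nat) set" where
  "grid M r = PiE {..<r} (\<lambda>_. {..M})"

definition grid_point :: "nat \<Rightarrow> nat \<Rightarrow> (nat \<Rightarrow> nat) \<Rightarrow> nat \<Rightarrow> real" where
  "grid_point M r j = (\<lambda>i\<in>{..<r}. real (j i) / real M)"

text \<open>
  \<open>M * hat M r j\<close> is the nodal function at the grid point \<open>j / M\<close> of the Kuhn triangulation of the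
  cube. It is an exact ReLU expression, and the missing factor keeps all weights at most 1.
\<close>

definition hat :: "nat \<Rightarrow> nat \<Rightarrow> (nat \<Rightarrow> nat) \<Rightarrow> (nat \<Rightarrow> real) \<Rightarrow> real" where
  "hat M r j x = relu (1 / real M - pos_max (\<lambda>i. real (j i) / real M - clip_coord r i x) r
     - pos_max (\<lambda>i. clip_coord r i x - real (j i) / real M) r)"

lemma finite_grid: "finite (grid M r)"
  unfolding grid_def by (rule finite_PiE) auto

lemma card_grid: "card (grid M r) = (M + 1) ^ r"
  unfolding grid_def by (simp add: card_PiE)

lemma grid_point_cube: "j \<in> grid M r \<Longrightarrow> 1 \<le> M \<Longrightarrow> grid_point M r j \<in> cube r"
  by (auto simp: grid_def grid_point_def cube_def PiE_def Pi_def extensional_def divide_simps)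

lemma hat_nonneg: "0 \<le> hat M r j x"
  by (simp add: hat_def relu_def)

lemma hat_le: "hat M r j x \<le> 1 / real M"
proof -
  have "1 / real M - pos_max (\<lambda>i. real (j i) / real M - clip_coord r i x) r
     - pos_max (\<lambda>i. clip_coord r i x - real (j i) / real M) r \<le> 1 / real M"
    using pos_max_nonneg[of "\<lambda>i. real (j i) / real M - clip_coord r i x" r]
      pos_max_nonneg[of "\<lambda>i. clip_coord r i x - real (j i) / real M" r] by linarith
  then show ?thesis
    by (simp add: hat_def relu_def)
qed

lemma hat_lip:
  assumes "1 \<le> r"
  shows "\<bar>hat M r j x - hat M r j y\<bar> \<le> 2 * dist_sup r x y"
proof -
  have *: "\<bar>pos_max (\<lambda>i. real (j i) / real M - clip_coord r i x) r -
      pos_max (\<lambda>i. real (j i) / real M - clip_coord r i y) r\<bar> \<le> dist_sup r x y"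
    "\<bar>pos_max (\<lambda>i. clip_coord r i x - real (j i) / real M) r -
      pos_max (\<lambda>i. clip_coord r i y - real (j i) / real M) r\<bar> \<le> dist_sup r x y"
    using clip_coord_lip[OF assms, of _ x y]
    by (auto intro!: pos_max_lip dist_sup_nonneg assms simp: abs_minus_commute)
  show ?thesis
    unfolding hat_def relu_def using * by (auto simp: max_def abs_if split: if_splits)
qed

lemma hat_support:
  assumes "hat M r j x \<noteq> 0" "i < r"
  shows "\<bar>clip_coord r i x - real (j i) / real M\<bar> < 1 / real M"
proof -
  let ?a = "pos_max (\<lambda>i. real (j i) / real M - clip_coord r i x) r"
  let ?b = "pos_max (\<lambda>i. clip_coord r i x - real (j i) / real M) r"
  have "?a + ?b < 1 / real M"
    using assms(1) by (auto simp: hat_def relu_def max_def split: if_splits)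
  then have "?a < 1 / real M" "?b < 1 / real M"
    using pos_max_nonneg[of "\<lambda>i. real (j i) / real M - clip_coord r i x" r]
      pos_max_nonneg[of "\<lambda>i. clip_coord r i x - real (j i) / real M" r] by linarith+
  then show ?thesis
    using assms(2) unfolding pos_max_less_iff by (auto simp: abs_less_iff)
qed

lemma hat_support_dist:
  assumes "hat M r j x \<noteq> 0" "x \<in> cube r" "1 \<le> r"
  shows "dist_sup r x (grid_point M r j) \<le> 1 / real M"
proof (rule dist_sup_le[OF assms(3)])
  fix i assume "i < r"
  then show "\<bar>x i - grid_point M r j i\<bar> \<le> 1 / real M"
    using hat_support[OF assms(1), of i] assms(2) by (simp add: clip_coord_cube grid_point_def)
qed

text \<open>In each coordinate an active index lies at distance less than 1 from \<open>M\<close>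
  times the clipped coordinate, which leaves only the floor and its successor.\<close>

lemma card_active:
  assumes "1 \<le> M"
  shows "card {j \<in> grid M r. hat M r j x \<noteq> 0} \<le> 2 ^ r"
proof -
  define u where "u = (\<lambda>i. real M * clip_coord r i x)"
  let ?N = "\<lambda>i. {nat \<lfloor>u i\<rfloor>, nat \<lfloor>u i\<rfloor> + 1}"
  have "{j \<in> grid M r. hat M r j x \<noteq> 0} \<subseteq> PiE {..<r} ?N"
  proof
    fix j assume j: "j \<in> {j \<in> grid M r. hat M r j x \<noteq> 0}"
    have "j i \<in> ?N i" if i: "i < r" for i
    proof -
      have "\<bar>u i - real (j i)\<bar> = real M * \<bar>clip_coord r i x - real (j i) / real M\<bar>"
      proof -
        have "u i - real (j i) = real M * (clip_coord r i x - real (j i) / real M)"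
          using assms by (simp add: u_def right_diff_distrib)
        then show ?thesis
          by (simp add: abs_mult)
      qed
      also have "\<dots> < real M * (1 / real M)"
        using hat_support[of M r j x i] j i assms by (intro mult_strict_left_mono) auto
      finally have "\<bar>u i - real (j i)\<bar> < 1"
        using assms by simp
      moreover have "0 \<le> u i"
        using clip_coord_bounds by (simp add: u_def)
      ultimately have "int (j i) = \<lfloor>u i\<rfloor> \<or> int (j i) = \<lfloor>u i\<rfloor> + 1"
        by linarith
      then show ?thesis
        using \<open>0 \<le> u i\<close> by auto
    qed
    then show "j \<in> PiE {..<r} ?N"
      using j by (auto simp: grid_def PiE_def)
  qed
  then have "card {j \<in> grid M r. hat M r j x \<noteq> 0} \<le> card (PiE {..<r} ?N)"
    by (intro card_mono finite_PiE) auto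
  also have "\<dots> = 2 ^ r"
    by (simp add: card_PiE numeral_2_eq_2)
  finally show ?thesis .
qed

text \<open>
  \<open>M * hat M r j x\<close> is the length of the interval of those \<open>t\<close> in \<open>[0, 1)\<close> for which rounding down
  \<open>M x\<^sub>i + t\<close> in each coordinate gives \<open>j\<close>. These intervals partition \<open>[0, 1)\<close>.
\<close>

lemma hat_sum:
  assumes "1 \<le> M"
  shows "(\<Sum>j\<in>grid M r. real M * hat M r j x) = 1"
proof -
  define u where "u = (\<lambda>i. real M * clip_coord r i x)"
  have u: "0 \<le> u i" "u i \<le> real M" for i
    using clip_coord_bounds[of r i x] assms by (auto simp: u_def mult_left_le)
  define a where "a = (\<lambda>j::nat \<Rightarrow> nat. pos_max (\<lambda>i. real (j i) - u i) r)"
  define b where "b = (\<lambda>j::nat \<Rightarrow> nat. 1 - pos_max (\<lambda>i. u i - real (j i)) r)"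
  have mem: "t \<in> {a j..<b j} \<longleftrightarrow> 0 \<le> t \<and> t < 1 \<and> (\<forall>i<r. \<lfloor>u i + t\<rfloor> = int (j i))" for t j
  proof -
    have "a j \<le> t \<longleftrightarrow> 0 \<le> t \<and> (\<forall>i<r. real (j i) \<le> u i + t)"
      unfolding a_def pos_max_le_iff by (auto simp: algebra_simps)
    moreover have "t < b j \<longleftrightarrow> pos_max (\<lambda>i. u i - real (j i)) r < 1 - t"
      unfolding b_def by auto
    moreover have "\<dots> \<longleftrightarrow> t < 1 \<and> (\<forall>i<r. u i + t < real (j i) + 1)"
      unfolding pos_max_less_iff by (auto simp: algebra_simps)
    ultimately show ?thesis
      by (auto simp: floor_eq_iff)
  qed
  have scale: "real M * hat M r j x = measure lborel {a j..<b j}" for j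
  proof -
    have a: "a j = real M * pos_max (\<lambda>i. real (j i) / real M - clip_coord r i x) r"
      unfolding a_def using assms by (subst pos_max_scale[symmetric]) (auto simp: u_def right_diff_distrib)
    have b: "1 - b j = real M * pos_max (\<lambda>i. clip_coord r i x - real (j i) / real M) r"
      unfolding b_def using assms by (subst pos_max_scale[symmetric]) (auto simp: u_def right_diff_distrib)
    have "real M * hat M r j x = max (real M * (1 / real M) -
        real M * pos_max (\<lambda>i. real (j i) / real M - clip_coord r i x) r -
        real M * pos_max (\<lambda>i. clip_coord r i x - real (j i) / real M) r) 0"
      by (simp add: hat_def relu_def max_mult_distrib_left right_diff_distrib)
    also have "\<dots> = max (b j - a j) 0"
      unfolding a[symmetric] b[symmetric] using assms by simp
    also have "\<dots> = measure lborel {a j..<b j}"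
      by (cases "a j \<le> b j") auto
    finally show ?thesis .
  qed
  have "(\<Union>j\<in>grid M r. {a j..<b j}) = {0..<1}"
  proof (intro equalityI subsetI)
    fix t assume t: "t \<in> {0..<1::real}"
    define j where "j = (\<lambda>i\<in>{..<r}. nat \<lfloor>u i + t\<rfloor>)"
    \<comment> \<open>At the far face \<open>u i = real M\<close> rounding down does not leave the
      grid, because \<open>t < 1\<close>.\<close>
    have "\<lfloor>u i + t\<rfloor> \<le> int M" for i
      using u(2)[of i] t by (simp add: floor_le_iff)
    then have "nat \<lfloor>u i + t\<rfloor> \<le> M" for i
      by (metis nat_int nat_mono)
    then have "j \<in> grid M r"
      by (auto simp: j_def grid_def)
    moreover have "\<lfloor>u i + t\<rfloor> = int (j i)" if "i < r" for i
      using u(1)[of i] t that by (simp add: j_def)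
    then have "t \<in> {a j..<b j}"
      unfolding mem using t by auto
    ultimately show "t \<in> (\<Union>j\<in>grid M r. {a j..<b j})"
      by blast
  next
    fix t assume "t \<in> (\<Union>j\<in>grid M r. {a j..<b j})"
    then show "t \<in> {0..<1}"
      unfolding UN_iff mem by auto
  qed
  moreover have "disjoint_family_on (\<lambda>j. {a j..<b j}) (grid M r)"
    unfolding disjoint_family_on_def
  proof (intro ballI impI)
    fix j j' assume j: "j \<in> grid M r" "j' \<in> grid M r" "j \<noteq> j'"
    then obtain i where i: "i < r" "j i \<noteq> j' i"
      unfolding grid_def by (metis PiE_ext lessThan_iff)
    show "{a j..<b j} \<inter> {a j'..<b j'} = {}"
    proof (rule ccontr)
      assume "\<not> ?thesis"
      then obtain t where "t \<in> {a j..<b j}" "t \<in> {a j'..<b j'}"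
        by blast
      then have "int (j i) = int (j' i)"
        unfolding mem using i(1) by metis
      then show False
        using i(2) by simp
    qed
  qed
  moreover have "(\<lambda>j. {a j..<b j}) ` grid M r \<subseteq> sets lborel"
    by auto
  moreover have "emeasure lborel {a j..<b j} \<noteq> \<infinity>" for j
    by (cases "a j \<le> b j") auto
  ultimately have "measure lborel {0..<1::real} = (\<Sum>j\<in>grid M r. measure lborel {a j..<b j})"
    using measure_finite_Union[OF finite_grid[of M r], where A="\<lambda>j. {a j..<b j}" and M=lborel]
    by auto
  then show ?thesis
    unfolding scale by simp
qed

section \<open>Accuracy and Lipschitz constant of the quasi-interpolant\<close>

definition quasi_interp ::
  "nat \<Rightarrow> nat \<Rightarrow> ((nat \<Rightarrow> nat) \<Rightarrow> (nat \<Rightarrow> real) \<Rightarrow> real) \<Rightarrow> (nat \<Rightarrow> real) \<Rightarrow> real" where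
  "quasi_interp M r P x = (\<Sum>j\<in>grid M r. real M * hat M r j x * P j x)"

lemma quasi_interp_diff:
  assumes "1 \<le> M"
  shows "quasi_interp M r P x - c = (\<Sum>j\<in>grid M r. real M * hat M r j x * (P j x - c))"
proof -
  have "c = (\<Sum>j\<in>grid M r. real M * hat M r j x * c)"
    using hat_sum[OF assms, of r x] by (simp flip: sum_distrib_right)
  then show ?thesis
    unfolding quasi_interp_def right_diff_distrib sum_subtractf by simp
qed

text \<open>The weights are nonnegative with sum 1, so the error is an average of Taylor errors,
  taken only at grid points within distance \<open>1 / M\<close>.\<close>

lemma quasi_interp_error:
  assumes M: "1 \<le> M" and r: "1 \<le> r" and \<gamma>: "0 \<le> \<gamma>" and c: "0 \<le> c" and x: "x \<in> cube r"
    and P: "\<And>j. j \<in> grid M r \<Longrightarrow> \<bar>f x - P j x\<bar> \<le> c * dist_sup r x (grid_point M r j) powr \<gamma>"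
  shows "\<bar>quasi_interp M r P x - f x\<bar> \<le> c * (1 / real M) powr \<gamma>"
proof -
  have "\<bar>quasi_interp M r P x - f x\<bar> \<le> (\<Sum>j\<in>grid M r. \<bar>real M * hat M r j x * (P j x - f x)\<bar>)"
    unfolding quasi_interp_diff[OF M] by (rule sum_abs)
  also have "\<dots> \<le> (\<Sum>j\<in>grid M r. real M * hat M r j x * (c * (1 / real M) powr \<gamma>))"
  proof (rule sum_mono)
    fix j assume j: "j \<in> grid M r"
    show "\<bar>real M * hat M r j x * (P j x - f x)\<bar> \<le> real M * hat M r j x * (c * (1 / real M) powr \<gamma>)"
    proof (cases "hat M r j x = 0")
      case False
      have "\<bar>P j x - f x\<bar> \<le> c * dist_sup r x (grid_point M r j) powr \<gamma>"
        using P[OF j] by (simp add: abs_minus_commute)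
      also have "\<dots> \<le> c * (1 / real M) powr \<gamma>"
        using hat_support_dist[OF False x r] dist_sup_nonneg[OF r] c \<gamma>
        by (intro mult_left_mono powr_mono2) auto
      finally show ?thesis
        unfolding abs_mult using hat_nonneg[of M r j x] by (simp add: mult_left_mono)
    qed simp
  qed
  also have "\<dots> = c * (1 / real M) powr \<gamma>"
    using hat_sum[OF M, of r x] by (simp flip: sum_distrib_right)
  finally show ?thesis .
qed

text \<open>Two points activate at most \<open>2 ^ r + 2 ^ r\<close> cells, so sums over the grid
  have bounds that do not grow with \<open>M\<close>.\<close>

lemma sum_active_bound:
  fixes e :: "(nat \<Rightarrow> nat) \<Rightarrow> real"
  assumes "1 \<le> M" "0 \<le> b"
    and "\<And>j. j \<in> grid M r \<Longrightarrow> hat M r j x \<noteq> 0 \<or> hat M r j y \<noteq> 0 \<Longrightarrow> \<bar>e j\<bar> \<le> b"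
    and "\<And>j. j \<in> grid M r \<Longrightarrow> hat M r j x = 0 \<Longrightarrow> hat M r j y = 0 \<Longrightarrow> e j = 0"
  shows "\<bar>\<Sum>j\<in>grid M r. e j\<bar> \<le> 2 ^ (r + 1) * b"
proof -
  let ?A = "\<lambda>x. {j \<in> grid M r. hat M r j x \<noteq> 0}"
  have 1: "(\<Sum>j\<in>grid M r. e j) = (\<Sum>j\<in>?A x \<union> ?A y. e j)"
  proof (rule sum.mono_neutral_right[OF finite_grid])
    show "?A x \<union> ?A y \<subseteq> grid M r"
      by auto
    show "\<forall>j\<in>grid M r - (?A x \<union> ?A y). e j = 0"
    proof
      fix j assume "j \<in> grid M r - (?A x \<union> ?A y)"
      then have "j \<in> grid M r" "hat M r j x = 0" "hat M r j y = 0"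
        by auto
      then show "e j = 0"
        by (rule assms(4))
    qed
  qed
  have 2: "(\<Sum>j\<in>?A x \<union> ?A y. \<bar>e j\<bar>) \<le> real (card (?A x \<union> ?A y)) * b"
  proof (rule sum_bounded_above)
    fix j assume "j \<in> ?A x \<union> ?A y"
    then have "j \<in> grid M r" "hat M r j x \<noteq> 0 \<or> hat M r j y \<noteq> 0"
      by auto
    then show "\<bar>e j\<bar> \<le> b"
      by (rule assms(3))
  qed
  have "card (?A x \<union> ?A y) \<le> card (?A x) + card (?A y)"
    by (rule card_Un_le)
  also have "\<dots> \<le> 2 ^ r + 2 ^ r"
    by (intro add_mono card_active assms(1))
  also have "\<dots> = 2 ^ (r + 1)"
    by simp
  finally have "real (card (?A x \<union> ?A y)) \<le> real (2 ^ (r + 1))"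
    by (rule of_nat_mono)
  then have 3: "real (card (?A x \<union> ?A y)) * b \<le> 2 ^ (r + 1) * b"
    using assms(2) by (intro mult_right_mono) simp_all
  show ?thesis
    using sum_abs[of e "?A x \<union> ?A y"] 2 3 unfolding 1 by linarith
qed

text \<open>For points closer than the mesh, the weights have slope of order \<open>M\<close>, but
  they multiply Taylor errors of order \<open>M powr - \<gamma>\<close>, and the product is bounded
  because \<open>1 \<le> \<gamma>\<close>. For points farther apart the uniform error is itself
  smaller than their distance, and the Lipschitz constant of \<open>f\<close> takes over.\<close>

lemma quasi_interp_lip:
  assumes M: "1 \<le> M" and r: "1 \<le> r" and \<gamma>: "1 \<le> \<gamma>" and c: "0 \<le> c1" "0 \<le> c2" "0 \<le> c3"
    and x: "x \<in> cube r" and y: "y \<in> cube r"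
    and P: "\<And>j x. j \<in> grid M r \<Longrightarrow> x \<in> cube r \<Longrightarrow> \<bar>f x - P j x\<bar> \<le> c1 * dist_sup r x (grid_point M r j) powr \<gamma>"
    and PL: "\<And>j. j \<in> grid M r \<Longrightarrow> \<bar>P j x - P j y\<bar> \<le> c2 * dist_sup r x y"
    and fL: "\<bar>f x - f y\<bar> \<le> c3 * dist_sup r x y"
  shows "\<bar>quasi_interp M r P x - quasi_interp M r P y\<bar> \<le>
    (c2 + c3 + 2 ^ (r + 2) * 2 powr \<gamma> * c1) * dist_sup r x y"
proof -
  let ?\<delta> = "dist_sup r x y" and ?h = "1 / real M"
  have \<delta>: "0 \<le> ?\<delta>"
    by (rule dist_sup_nonneg[OF r])
  have h: "0 < ?h" "?h \<le> 1"
    using M by auto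
  have hp: "?h powr \<gamma> \<le> ?h"
    using powr_mono'[OF \<gamma>, of ?h] h by simp
  have two: "2 \<le> 2 ^ (r + 2) * 2 powr \<gamma>"
  proof -
    have "(1::real) * 2 powr 1 \<le> 2 ^ (r + 2) * 2 powr \<gamma>"
      using \<gamma> by (intro mult_mono powr_mono one_le_power) auto
    then show ?thesis
      by simp
  qed
  show ?thesis
  proof (cases "?\<delta> \<le> ?h")
    case True
    \<comment> \<open>Both families of weights sum to 1, so \<open>f x\<close> can be subtracted
      from every Taylor polynomial. This leaves differences of weights times Taylor errors at
      \<open>x\<close>, plus an average of increments of the polynomials.\<close>
    have "quasi_interp M r P x - quasi_interp M r P y =
        (quasi_interp M r P x - f x) - (\<Sum>j\<in>grid M r. real M * hat M r j y * (P j x - f x)) +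
        (\<Sum>j\<in>grid M r. real M * hat M r j y * (P j x - P j y))"
    proof -
      have "(\<Sum>j\<in>grid M r. real M * hat M r j y * (P j x - P j y)) =
          (\<Sum>j\<in>grid M r. real M * hat M r j y * (P j x - f x)) - (quasi_interp M r P y - f x)"
        unfolding quasi_interp_diff[OF M] by (simp add: algebra_simps flip: sum_subtractf)
      then show ?thesis
        by simp
    qed
    also have "(quasi_interp M r P x - f x) - (\<Sum>j\<in>grid M r. real M * hat M r j y * (P j x - f x)) =
        (\<Sum>j\<in>grid M r. real M * (hat M r j x - hat M r j y) * (P j x - f x))"
      unfolding quasi_interp_diff[OF M] by (simp add: algebra_simps flip: sum_subtractf)
    finally have split: "quasi_interp M r P x - quasi_interp M r P y =
        (\<Sum>j\<in>grid M r. real M * (hat M r j x - hat M r j y) * (P j x - f x)) +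
        (\<Sum>j\<in>grid M r. real M * hat M r j y * (P j x - P j y))" .
    have near: "\<bar>real M * (hat M r j x - hat M r j y) * (P j x - f x)\<bar> \<le>
        real M * (2 * ?\<delta>) * (c1 * (2 * ?h) powr \<gamma>)"
      if j: "j \<in> grid M r" and act: "hat M r j x \<noteq> 0 \<or> hat M r j y \<noteq> 0" for j
    proof -
      \<comment> \<open>A cell that is active only at \<open>y\<close> is still within two mesh
        widths of \<open>x\<close>; this is the origin of \<open>2 powr \<gamma>\<close>.\<close>
      have "dist_sup r x (grid_point M r j) \<le> 2 * ?h"
        using act
      proof
        assume "hat M r j x \<noteq> 0"
        then have "dist_sup r x (grid_point M r j) \<le> ?h"
          by (rule hat_support_dist[OF _ x r])
        then show ?thesis
          using h by linarith
      next
        assume "hat M r j y \<noteq> 0"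
        then have "dist_sup r y (grid_point M r j) \<le> ?h"
          by (rule hat_support_dist[OF _ y r])
        then show ?thesis
          using dist_sup_triangle[OF r, of x "grid_point M r j" y] True by linarith
      qed
      then have "c1 * dist_sup r x (grid_point M r j) powr \<gamma> \<le> c1 * (2 * ?h) powr \<gamma>"
        using c \<gamma> dist_sup_nonneg[OF r] by (intro mult_left_mono powr_mono2) auto
      then have "\<bar>P j x - f x\<bar> \<le> c1 * (2 * ?h) powr \<gamma>"
        using P[OF j x] by (simp add: abs_minus_commute)
      then show ?thesis
        unfolding abs_mult using hat_lip[OF r, of M j x y] by (intro mult_mono) auto
    qed
    have "real M * (2 * ?h) powr \<gamma> \<le> 2 powr \<gamma>"
    proof -
      have "real M * (2 * ?h) powr \<gamma> = real M * (2 powr \<gamma> * ?h powr \<gamma>)"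
        using powr_mult[of 2 ?h \<gamma>] h by simp
      also have "\<dots> \<le> real M * (2 powr \<gamma> * ?h)"
        using hp by (intro mult_left_mono) auto
      also have "\<dots> = 2 powr \<gamma>"
        using M by simp
      finally show ?thesis .
    qed
    then have "2 * ?\<delta> * c1 * (real M * (2 * ?h) powr \<gamma>) \<le> 2 * ?\<delta> * c1 * 2 powr \<gamma>"
      using \<delta> c by (intro mult_left_mono) auto
    then have b: "real M * (2 * ?\<delta>) * (c1 * (2 * ?h) powr \<gamma>) \<le> 2 * ?\<delta> * c1 * 2 powr \<gamma>"
      by (simp add: mult_ac)
    have 1: "\<bar>\<Sum>j\<in>grid M r. real M * (hat M r j x - hat M r j y) * (P j x - f x)\<bar> \<le>
        2 ^ (r + 1) * (2 * ?\<delta> * c1 * 2 powr \<gamma>)"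
    proof (rule sum_active_bound[OF M, of _ r x y])
      show "\<bar>real M * (hat M r j x - hat M r j y) * (P j x - f x)\<bar> \<le> 2 * ?\<delta> * c1 * 2 powr \<gamma>"
        if "j \<in> grid M r" "hat M r j x \<noteq> 0 \<or> hat M r j y \<noteq> 0" for j
        using near[OF that] b by linarith
    qed (use \<delta> c in auto)
    have "\<bar>\<Sum>j\<in>grid M r. real M * hat M r j y * (P j x - P j y)\<bar> \<le>
        (\<Sum>j\<in>grid M r. \<bar>real M * hat M r j y * (P j x - P j y)\<bar>)"
      by (rule sum_abs)
    also have "\<dots> \<le> (\<Sum>j\<in>grid M r. real M * hat M r j y * (c2 * ?\<delta>))"
      unfolding abs_mult using PL hat_nonneg by (intro sum_mono mult_mono) auto
    also have "\<dots> = c2 * ?\<delta>"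
      using hat_sum[OF M, of r y] by (simp flip: sum_distrib_right)
    finally have 2: "\<bar>\<Sum>j\<in>grid M r. real M * hat M r j y * (P j x - P j y)\<bar> \<le> c2 * ?\<delta>" .
    have "\<bar>quasi_interp M r P x - quasi_interp M r P y\<bar> \<le>
        2 ^ (r + 1) * (2 * ?\<delta> * c1 * 2 powr \<gamma>) + c2 * ?\<delta>"
      unfolding split using 1 2 by linarith
    also have "\<dots> \<le> (c2 + c3 + 2 ^ (r + 2) * 2 powr \<gamma> * c1) * ?\<delta>"
      using \<delta> c by (simp add: algebra_simps)
    finally show ?thesis .
  next
    case False
    have e: "\<bar>quasi_interp M r P z - f z\<bar> \<le> c1 * ?h powr \<gamma>" if "z \<in> cube r" for z
      by (rule quasi_interp_error[OF M r _ c(1) that]) (use \<gamma> P that in auto)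
    have "c1 * ?h powr \<gamma> \<le> c1 * ?\<delta>"
      using hp False c by (intro mult_left_mono) auto
    then have "\<bar>quasi_interp M r P x - quasi_interp M r P y\<bar> \<le> 2 * (c1 * ?\<delta>) + c3 * ?\<delta>"
      using e[OF x] e[OF y] fL by linarith
    also have "2 * (c1 * ?\<delta>) \<le> (2 ^ (r + 2) * 2 powr \<gamma>) * (c1 * ?\<delta>)"
      using two c \<delta> by (intro mult_right_mono) auto
    finally show ?thesis
      using c \<delta> by (simp add: algebra_simps add_increasing)
  qed
qed

subsection \<open>The approximating network\<close>

text \<open>A balanced tree of products, so the number of successive multiplications is the
  logarithm of the degree. The bound on \<open>L\<close> allows no more than that.\<close>

primrec mtree :: "nat \<Rightarrow> nat \<Rightarrow> nat \<Rightarrow> nat list \<Rightarrow> (nat \<Rightarrow> real) \<Rightarrow> real" where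
  "mtree r m 0 l = clip_coord r (hd l)"
| "mtree r m (Suc k) l =
    (\<lambda>x. approx_mult m (mtree r m k (take (2 ^ k) l) x) (mtree r m k (drop (2 ^ k) l) x))"

lemma mtree_bounds: "0 \<le> mtree r m k l x \<and> mtree r m k l x \<le> 1"
  by (induction k arbitrary: l) (simp_all add: clip_coord_bounds approx_mult_bounds)

definition word_list :: "nat \<Rightarrow> nat \<Rightarrow> nat list list" where
  "word_list r Q = List.n_lists Q [0..<Suc r]"

lemma set_word_list: "set (word_list r Q) = words r Q"
  by (auto simp: word_list_def words_def set_n_lists simp del: upt_Suc)

lemma distinct_word_list: "distinct (word_list r Q)"
  unfolding word_list_def by (intro distinct_n_lists) simp

lemma length_word_list: "length (word_list r Q) = (r + 1) ^ Q"
  by (simp add: word_list_def length_n_lists del: upt_Suc)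

definition level :: "nat \<Rightarrow> nat \<Rightarrow> nat \<Rightarrow> ((nat \<Rightarrow> real) \<Rightarrow> real) list" where
  "level r m k = map (mtree r m k) (word_list r (2 ^ k))"

text \<open>A chain never drops its context, so all lower levels stay present. Level 0 is used again
  by the hat functions and provides the constant 1.\<close>

primrec levels :: "nat \<Rightarrow> nat \<Rightarrow> nat \<Rightarrow> ((nat \<Rightarrow> real) \<Rightarrow> real) list" where
  "levels r m 0 = level r m 0"
| "levels r m (Suc k) = levels r m k @ level r m (Suc k)"

lemma length_levels: "length (levels r m k) = (\<Sum>i\<le>k. (r + 1) ^ 2 ^ i)"
  by (induction k) (simp_all add: level_def length_word_list)

lemma level_subset: "set (level r m k) \<subseteq> set (levels r m k)"
  by (cases k) auto

lemma levels_nonneg: "h \<in> set (levels r m k) \<Longrightarrow> 0 \<le> h x"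
  by (induction k) (auto simp: level_def mtree_bounds simp del: mtree.simps)

lemma clip_coord_in_levels:
  assumes "i \<le> r"
  shows "clip_coord r i \<in> set (levels r m k)"
proof (induction k)
  case 0
  have "[i] \<in> words r (2 ^ 0)"
    using assms by (simp add: words_def)
  then have "mtree r m 0 [i] \<in> set (level r m 0)"
    unfolding level_def set_map set_word_list by (rule imageI)
  then show ?case
    by simp
qed simp

lemma lc_ctx:
  assumes "h \<in> set A" "\<bar>a\<bar> \<le> 1" "1 \<le> c"
  shows "lc (A @ B) 1 c (\<lambda>x. a * h x)"
  using lc_mono[OF lc_append1[OF lc_single[OF assms(1,2)], of B], of 1 c] assms(3) by simp

text \<open>Clipping is \<open>relu t - relu (t - 1)\<close>, and the constant 1 is a neuron without
  weights and with shift -1. The \<open>2 * r\<close> neurons of the first layer cost 2 parameters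
  each and the \<open>r + 1\<close> of the second cost 3.\<close>

lemma nnet_clip:
  assumes "2 * r + 1 \<le> w"
  shows "nnet r w 2 (7 * r + 3) (level r m 0)"
proof -
  define B1 where "B1 = map (\<lambda>i (x::nat \<Rightarrow> real). relu (x i)) [0..<r]"
  define B2 where "B2 = map (\<lambda>i (x::nat \<Rightarrow> real). relu (x i - 1)) [0..<r]"
  have "nnet r w 1 (4 * r) (B1 @ B2)"
    unfolding One_nat_def
  proof (rule nnet_layer[OF nnet_input[of r w 0], of _ 1])
    fix g assume "g \<in> set (B1 @ B2)"
    then consider i where "i < r" "g = (\<lambda>x. relu (x i - 0))"
      | i where "i < r" "g = (\<lambda>x. relu (x i - 1))"
      unfolding B1_def B2_def by auto
    then obtain i b where i: "i < r" "\<bar>b\<bar> \<le> 1" "g = (\<lambda>x. relu (x i - b))"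
    proof cases
      case (1 i)
      then show ?thesis
        by (intro that[of i 0]) auto
    next
      case (2 i)
      then show ?thesis
        by (intro that[of i 1]) auto
    qed
    show "neuron (map (\<lambda>i x. x i) [0..<r]) 1 g"
      by (rule neuronI[OF lc_single[of "\<lambda>x. x i" _ 1] i(2)]) (use i in auto)
  qed (use assms in \<open>auto simp: B1_def B2_def\<close>)
  then have "nnet r w (Suc 1) (7 * r + 3) (level r m 0)"
  proof (rule nnet_layer[where c=2])
    fix g assume "g \<in> set (level r m 0)"
    then obtain l where l: "l \<in> words r 1" "g = clip_coord r (hd l)"
      unfolding level_def set_map set_word_list by auto
    then obtain i where i: "i \<le> r" "g = clip_coord r i"
      by (cases l) (auto simp: words_def)
    show "neuron (B1 @ B2) 2 g"
    proof (cases "i < r")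
      case True
      have "lc B1 1 1 (\<lambda>x. 1 * relu (x i))"
        by (rule lc_single) (use True in \<open>auto simp: B1_def\<close>)
      moreover have "lc B2 1 1 (\<lambda>x. - 1 * relu (x i - 1))"
        by (rule lc_single) (use True in \<open>auto simp: B2_def\<close>)
      ultimately have lc: "lc (B1 @ B2) 1 (1 + 1) (\<lambda>x. 1 * relu (x i) + - 1 * relu (x i - 1))"
        by (rule lc_append)
      have "neuron (B1 @ B2) (1 + 1) g"
      proof (rule neuronI0[OF lc])
        show "g = (\<lambda>x. relu (1 * relu (x i) + - 1 * relu (x i - 1)))"
          using True by (auto simp: i(2) clip_coord_def relu_def fun_eq_iff max_def min_def)
      qed
      then show ?thesis
        by (simp only: nat_1_add_1)
    next
      case False
      show ?thesis
        by (rule neuronI[OF lc_zero[of 1], where b="- 1"])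
          (use False in \<open>auto simp: i(2) clip_coord_def relu_def fun_eq_iff\<close>)
    qed
  qed (use assms in \<open>auto simp: level_def length_word_list\<close>)
  then show ?thesis
    by (simp add: numeral_2_eq_2)
qed

lemma level_chain: "cchain (levels r m k) 6 (6 * (r + 1) ^ 2 ^ Suc k) (m + 3) [] (level r m (Suc k))"
proof -
  have "cchain (levels r m k) (2 * 3) 6 (m + 3) [] [mtree r m (Suc k) l]"
    if l: "l \<in> set (word_list r (2 ^ Suc k))" for l
  proof -
    have "length l = 2 ^ k + 2 ^ k" "set l \<subseteq> {..r}"
      using l unfolding set_word_list words_def by auto
    then have "take (2 ^ k) l \<in> words r (2 ^ k)" "drop (2 ^ k) l \<in> words r (2 ^ k)"
      by (auto simp: words_def dest: in_set_takeD in_set_dropD)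
    then have "mtree r m k (take (2 ^ k) l) \<in> set (levels r m k)"
      "mtree r m k (drop (2 ^ k) l) \<in> set (levels r m k)"
      using level_subset[of r m k] unfolding level_def set_map set_word_list by blast+
    from lc_ctx[OF this(1), of 1 3 "[]"] lc_ctx[OF this(2), of 1 3 "[]"]
    show ?thesis
      unfolding mtree.simps using mtree_bounds by (intro mult_chain) auto
  qed
  from cchain_concat[OF this]
  have "cchain (levels r m k) 6 (6 * length (word_list r (2 ^ Suc k))) (m + 3)
      (concat (map (\<lambda>_. []) (word_list r (2 ^ Suc k))))
      (concat (map (\<lambda>l. [mtree r m (Suc k) l]) (word_list r (2 ^ Suc k))))"
    by simp
  moreover have "concat (map (\<lambda>_. []) (word_list r (2 ^ Suc k))) = ([] :: ((nat \<Rightarrow> real) \<Rightarrow> real) list)"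
    by simp
  ultimately show ?thesis
    unfolding level_def length_word_list by (simp del: mtree.simps power_Suc add: concat_map_singleton)
qed

text \<open>The stored levels together with six working features for each word of the last
  level.\<close>

definition levels_width :: "nat \<Rightarrow> nat \<Rightarrow> nat" where
  "levels_width r k = (\<Sum>i\<le>k. (r + 1) ^ 2 ^ i) + 6 * (r + 1) ^ 2 ^ k"

lemma levels_width_mono: "k \<le> k' \<Longrightarrow> levels_width r k \<le> levels_width r k'"
  unfolding levels_width_def
  by (intro add_mono mult_left_mono sum_mono2 power_increasing) auto

text \<open>Two layers for clipping and \<open>m + 3\<close> for each level of the tree. The factor
  7 is the fan-in 6 plus one shift.\<close>

lemma nnet_levels:
  assumes "2 * r + 1 \<le> w" "levels_width r k \<le> w"
  shows "nnet r w (2 + k * (m + 3)) (7 * r + 3 + k * (m + 3) * (7 * levels_width r k)) (levels r m k)"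
  using assms(2)
proof (induction k)
  case 0
  show ?case
    using nnet_clip[OF assms(1)] by simp
next
  case (Suc k)
  let ?W = "levels_width r (Suc k)"
  have W: "levels_width r k \<le> ?W"
    by (rule levels_width_mono) simp
  have len: "length (levels r m k) + 6 * (r + 1) ^ 2 ^ Suc k \<le> ?W"
    by (simp add: length_levels levels_width_def)
  have "nnet r w (2 + k * (m + 3)) (7 * r + 3 + k * (m + 3) * (7 * levels_width r k)) (levels r m k @ [])"
    using Suc.IH Suc.prems W by simp
  from nnet_cchain[OF level_chain this]
  have "nnet r w (2 + k * (m + 3) + (m + 3)) (7 * r + 3 + k * (m + 3) * (7 * levels_width r k) +
      (m + 3) * ((6 + 1) * (length (levels r m k) + 6 * (r + 1) ^ 2 ^ Suc k))) (levels r m k @ level r m (Suc k))"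
    using levels_nonneg len Suc.prems by (meson le_trans one_le_numeral)
  then have "nnet r w (2 + Suc k * (m + 3)) (7 * r + 3 + k * (m + 3) * (7 * levels_width r k) +
      (m + 3) * ((6 + 1) * (length (levels r m k) + 6 * (r + 1) ^ 2 ^ Suc k))) (levels r m (Suc k))"
    by (simp add: algebra_simps)
  moreover have "k * (m + 3) * (7 * levels_width r k) +
      (m + 3) * ((6 + 1) * (length (levels r m k) + 6 * (r + 1) ^ 2 ^ Suc k)) \<le>
      k * (m + 3) * (7 * ?W) + (m + 3) * (7 * ?W)"
    using W len by (intro add_mono mult_left_mono) auto
  moreover have "k * (m + 3) * (7 * ?W) + (m + 3) * (7 * ?W) = Suc k * (m + 3) * (7 * ?W)"
    by (simp add: algebra_simps)
  ultimately show ?case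
    by (elim nnet_mono) linarith
qed

section \<open>Hat functions and cells as chains of layers\<close>

lemma relu_max: "0 \<le> a \<Longrightarrow> relu (a + relu (d - a)) = max a d"
  by (auto simp: relu_def max_def)

text \<open>One layer creates the zeros at which the two running maxima start, two layers per
  coordinate update them by \<open>max a d = a + relu (d - a)\<close>, and one layer combines them.
  The grid point enters only through shifts, which are at most 1 because
  \<open>j i \<le> M\<close>.\<close>

lemma hat_chain:
  assumes j: "j \<in> grid M r" and M: "1 \<le> M"
    and A: "\<And>i. i < r \<Longrightarrow> clip_coord r i \<in> set A"
  shows "cchain A 2 4 (2 * r + 2) [] [hat M r j]"
proof -
  define \<xi> where "\<xi> = (\<lambda>i. real (j i) / real M)"
  have \<xi>: "\<bar>\<xi> i\<bar> \<le> 1" if "i < r" for i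
    using j M that by (auto simp: \<xi>_def grid_def PiE_def Pi_def divide_simps)
  define pv where "pv = (\<lambda>k x. pos_max (\<lambda>i. \<xi> i - clip_coord r i x) k)"
  define pw where "pw = (\<lambda>k x. pos_max (\<lambda>i. clip_coord r i x - \<xi> i) k)"
  have nonneg: "0 \<le> pv k x" "0 \<le> pw k x" for k x
    by (simp_all add: pv_def pw_def pos_max_nonneg)
  define H where "H = (\<lambda>k. [pv k, pw k])"
  have step: "cchain A 2 4 2 (H k) (H (Suc k))" if k: "k < r" for k
  proof -
    define C where "C = [pv k, \<lambda>x. relu (\<xi> k - clip_coord r k x - pv k x),
      pw k, \<lambda>x. relu (clip_coord r k x - \<xi> k - pw k x)]"
    have 1: "neuron (A @ H k) 2 g" if "g \<in> set C" for g
    proof -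
      from that consider "g = pv k" | "g = pw k" | "g = (\<lambda>x. relu (\<xi> k - clip_coord r k x - pv k x))"
        | "g = (\<lambda>x. relu (clip_coord r k x - \<xi> k - pw k x))"
        unfolding C_def by auto
      then show ?thesis
      proof cases
        case 1
        show ?thesis
          by (rule neuron_carry) (auto simp: 1 H_def nonneg)
      next
        case 2
        show ?thesis
          by (rule neuron_carry) (auto simp: 2 H_def nonneg)
      next
        case 3
        have "lc A 1 1 (\<lambda>x. - 1 * clip_coord r k x)"
          by (rule lc_single[OF A[OF k]]) simp
        moreover have "lc (H k) 1 1 (\<lambda>x. - 1 * pv k x)"
          by (rule lc_single) (auto simp: H_def)
        ultimately have lc: "lc (A @ H k) 1 (1 + 1) (\<lambda>x. - 1 * clip_coord r k x + - 1 * pv k x)"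
          by (rule lc_append)
        show ?thesis
          by (rule neuronI[where z="\<lambda>x. - 1 * clip_coord r k x + - 1 * pv k x" and b="- \<xi> k"])
            (use lc \<xi>[OF k] in \<open>auto simp: 3 fun_eq_iff algebra_simps numeral_2_eq_2\<close>)
      next
        case 4
        have "lc A 1 1 (\<lambda>x. 1 * clip_coord r k x)"
          by (rule lc_single[OF A[OF k]]) simp
        moreover have "lc (H k) 1 1 (\<lambda>x. - 1 * pw k x)"
          by (rule lc_single) (auto simp: H_def)
        ultimately have lc: "lc (A @ H k) 1 (1 + 1) (\<lambda>x. 1 * clip_coord r k x + - 1 * pw k x)"
          by (rule lc_append)
        show ?thesis
          by (rule neuronI[where z="\<lambda>x. 1 * clip_coord r k x + - 1 * pw k x" and b="\<xi> k"])
            (use lc \<xi>[OF k] in \<open>auto simp: 4 fun_eq_iff algebra_simps numeral_2_eq_2\<close>)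
      qed
    qed
    have pv: "pv (Suc k) = (\<lambda>x. relu (1 * pv k x + 1 * relu (\<xi> k - clip_coord r k x - pv k x)))"
      using relu_max[OF nonneg(1)[of k]] by (simp add: fun_eq_iff pv_def)
    have pw: "pw (Suc k) = (\<lambda>x. relu (1 * pw k x + 1 * relu (clip_coord r k x - \<xi> k - pw k x)))"
      using relu_max[OF nonneg(2)[of k]] by (simp add: fun_eq_iff pw_def)
    have split: "C = [pv k, \<lambda>x. relu (\<xi> k - clip_coord r k x - pv k x)] @
        [pw k, \<lambda>x. relu (clip_coord r k x - \<xi> k - pw k x)]"
      by (simp add: C_def)
    have "neuron C 2 (pv (Suc k))"
      unfolding split
      by (rule neuron_append1, rule neuronI0[OF lc_explicit[of "[1, 1]"]]) (auto simp: pv)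
    moreover have "neuron C 2 (pw (Suc k))"
      unfolding split
      by (rule neuron_append2, rule neuronI0[OF lc_explicit[of "[1, 1]"]]) (auto simp: pw)
    ultimately have 2: "neuron (A @ C) 2 g" if "g \<in> set (H (Suc k))" for g
      using that neuron_append2 by (auto simp: H_def)
    have len: "length (H k) \<le> 4" "length (H (Suc k)) \<le> 4" "length C \<le> 4"
      by (simp_all add: H_def C_def)
    have "cchain A 2 4 (Suc 0) C (H (Suc k))"
      using 2 len by auto
    then have "cchain A 2 4 (Suc (Suc 0)) (H k) (H (Suc k))"
      unfolding cchain.simps(2)[of _ _ _ "Suc 0"] using 1 len by blast
    then show ?thesis
      by (simp only: numeral_2_eq_2)
  qed
  have "neuron (A @ []) 2 (\<lambda>x. 0)"
    by (rule neuronI0[OF lc_zero]) (auto simp: relu_def)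
  then have start: "cchain A 2 4 1 [] (H 0)"
    by (auto simp: H_def pv_def pw_def)
  have "cchain A 2 4 (2 * k + 1) [] (H k)" if "k \<le> r" for k
    using that
  proof (induction k)
    case (Suc k)
    then have k: "k < r"
      by simp
    then have "cchain A 2 4 (2 * k + 1) [] (H k)"
      using Suc.IH by simp
    from cchain_trans[OF this step[OF k]] have "cchain A 2 4 (2 * k + 1 + 2) [] (H (Suc k))" .
    then show ?case
      by simp
  qed (use start in simp)
  then have main: "cchain A 2 4 (2 * r + 1) [] (H r)"
    by simp
  have hat: "hat M r j = (\<lambda>x. relu ((- 1 * pv r x + - 1 * pw r x) - - (1 / real M)))"
    by (auto simp: hat_def pv_def pw_def \<xi>_def fun_eq_iff algebra_simps)
  have "lc (H r) 1 2 (\<lambda>x. - 1 * pv r x + - 1 * pw r x)"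
    by (rule lc_explicit[of "[- 1, - 1]"]) (auto simp: H_def)
  then have "neuron (A @ H r) 2 (hat M r j)"
    using M by (intro neuronI[OF lc_append2[of "H r" 1 2] _ hat]) auto
  then have "cchain A 2 4 1 (H r) [hat M r j]"
    by (simp add: H_def)
  from cchain_trans[OF main this] show ?thesis
    by simp
qed

definition cell :: "nat \<Rightarrow> nat \<Rightarrow> nat \<Rightarrow> ((nat \<Rightarrow> nat) \<Rightarrow> (nat \<Rightarrow> real) \<Rightarrow> real) \<Rightarrow> (nat \<Rightarrow> nat) \<Rightarrow> (nat \<Rightarrow> real) \<Rightarrow> real" where
  "cell r m M T j x = approx_mult m (hat M r j x) (T j x)"

text \<open>\<open>T j\<close> is a linear combination of the context, so it needs no features of
  its own while the hat function is built and is formed only in the first layer of the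
  multiplication.\<close>

lemma cell_chain:
  assumes j: "j \<in> grid M r" and M: "1 \<le> M"
    and A: "\<And>i. i < r \<Longrightarrow> clip_coord r i \<in> set A"
    and T: "lc A 1 c (T j)" "\<And>x. 0 \<le> T j x \<and> T j x \<le> 1" and c: "3 \<le> c"
  shows "cchain A (2 * c) 6 (2 * r + m + 5) [] [cell r m M T j]"
proof -
  have 1: "cchain A (2 * c) 6 (2 * r + 2) [] [hat M r j]"
    by (rule cchain_mono[OF hat_chain[OF j M A]]) (use c in auto)
  have h: "0 \<le> hat M r j x \<and> hat M r j x \<le> 1" for x
    using hat_nonneg[of M r j x] hat_le[of M r j x] M by (auto intro: order.trans)
  have "lc [hat M r j] 1 c (\<lambda>x. 1 * hat M r j x)"
    by (rule lc_mono[OF lc_single[of _ _ 1 1]]) (use c in auto)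
  then have "lc (A @ [hat M r j]) 1 c (hat M r j)"
    using lc_append2[of "[hat M r j]" 1 c "hat M r j" A] by simp
  then have "cchain A (2 * c) 6 (m + 3) [hat M r j] [cell r m M T j]"
    unfolding cell_def[abs_def] using lc_append1[OF T(1)] T(2) h c by (intro mult_chain) auto
  from cchain_trans[OF 1 this] show ?thesis
    by (simp add: algebra_simps)
qed

lemma cell_nonneg:
  assumes "1 \<le> M" "\<And>x. 0 \<le> T j x \<and> T j x \<le> 1"
  shows "0 \<le> cell r m M T j x"
proof -
  have "hat M r j x \<le> 1"
    using hat_le[of M r j x] assms(1) by (auto intro: order.trans)
  then show ?thesis
    unfolding cell_def using hat_nonneg assms(2) by (intro approx_mult_bounds) auto
qed

lemma lc_sum: "lc (map f js) 1 (length js) (\<lambda>x. \<Sum>j\<leftarrow>js. f j x)"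
proof (rule lc_explicit[of "replicate (length js) 1"])
  have "(\<Sum>(a, h)\<leftarrow>zip (replicate (length js) 1) (map f js). a * h x) = (\<Sum>j\<leftarrow>js. f j x)" for x
    by (induction js) auto
  then show "(\<lambda>x. \<Sum>j\<leftarrow>js. f j x) = (\<lambda>x. \<Sum>(a, h)\<leftarrow>zip (replicate (length js) 1) (map f js). a * h x)"
    by simp
qed auto

section \<open>Rescaling, padding and assembly\<close>

text \<open>The value is kept twice so that doubling is a sum with weights 1. The constant 1 is
  carried along because the output layer has no shift with which to subtract 1/2. Three neurons of
  fan-in 2 cost 9 parameters per layer.\<close>

lemma nnet_double:
  assumes "nnet r w L S [y, y, \<lambda>_. 1]" "\<And>x. 0 \<le> y x" "3 \<le> w"
  shows "nnet r w (L + k) (S + 9 * k) [\<lambda>x. 2 ^ k * y x, \<lambda>x. 2 ^ k * y x, \<lambda>_. 1]"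
proof (induction k)
  case 0
  show ?case
    using assms(1) by simp
next
  case (Suc k)
  let ?y = "\<lambda>x. 2 ^ k * y x" and ?z = "\<lambda>x. 2 ^ Suc k * y x"
  have z: "neuron [?y, ?y, \<lambda>_. 1] 2 ?z"
    unfolding append_Cons[of _ "[?y]", simplified append_Nil, symmetric] append.simps(2)[of ?y "[]", symmetric]
  proof -
    have "neuron ([?y, ?y] @ [\<lambda>_. 1]) 2 ?z"
      by (rule neuron_append1, rule neuronI0[OF lc_explicit[of "[1, 1]"]])
        (use assms(2) in \<open>auto simp: relu_def max_absorb1\<close>)
    then show "neuron [?y, ?y, \<lambda>_. 1] 2 ?z"
      by simp
  qed
  have one: "neuron [?y, ?y, \<lambda>_. 1] 2 (\<lambda>_. 1)"
    by (rule neuron_carry) auto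
  have "nnet r w (Suc (L + k)) (S + 9 * Suc k) [?z, ?z, \<lambda>_. 1]"
    by (rule nnet_layer[OF Suc.IH, of _ 2]) (use z one assms(3) in auto)
  then show ?case
    by simp
qed

text \<open>The class consists of networks with exactly \<open>L\<close> hidden layers, so the
  result is copied through the surplus layers. Their cost of 9 parameters each is what the
  hypothesis that \<open>s\<close> dominates a multiple of \<open>L\<close> pays for.\<close>

lemma nnet_pad:
  assumes "nnet r w L S [y, y, \<lambda>_. 1]" "\<And>x. 0 \<le> y x" "3 \<le> w"
  shows "nnet r w (L + k) (S + 9 * k) [y, y, \<lambda>_. 1]"
proof (induction k)
  case (Suc k)
  have "nnet r w (Suc (L + k)) (S + 9 * Suc k) [y, y, \<lambda>_. 1]"
  proof (rule nnet_layer[OF Suc.IH, of _ 2])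
    show "neuron [y, y, \<lambda>_. 1] 2 g" if "g \<in> set [y, y, \<lambda>_. 1]" for g
      using that assms(2) by (intro neuron_carry) auto
  qed (use assms(3) in auto)
  then show ?case
    by simp
qed (use assms(1) in simp)

text \<open>
  \<open>T j\<close> will be close to \<open>1 / 2\<close> plus the Taylor polynomial at the grid point \<open>j\<close>: the shift keeps all
  features nonnegative and is undone at the end. The factor \<open>M\<close>, a power of 2, is realized by
  doubling layers.
\<close>

definition approximant :: "nat \<Rightarrow> nat \<Rightarrow> nat \<Rightarrow> ((nat \<Rightarrow> nat) \<Rightarrow> (nat \<Rightarrow> real) \<Rightarrow> real) \<Rightarrow> (nat \<Rightarrow> real) \<Rightarrow> real" where
  "approximant r m M T x = real M * (\<Sum>j\<in>grid M r. cell r m M T j x) - 1 / 2"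

text \<open>The depth \<open>D\<close> consists of the clipping, the product tree, the cells, one
  summation layer and \<open>k\<close> doublings. All cells are computed in parallel, so the width
  is of the order of the number \<open>N\<close> of grid points, and the parameters are essentially
  depth times width.\<close>

lemma approximant_critic:
  fixes r m k \<kappa> c L :: nat
  defines "M \<equiv> 2 ^ k"
  defines "N \<equiv> (M + 1) ^ r"
  defines "D \<equiv> 2 + \<kappa> * (m + 3) + (2 * r + m + 5) + 1 + k"
  defines "w \<equiv> levels_width r \<kappa> + 6 * N + 2 * r + 3"
  assumes T: "\<And>j. j \<in> grid M r \<Longrightarrow> lc (levels r m \<kappa>) 1 c (T j)"
      "\<And>j x. 0 \<le> T j x \<and> T j x \<le> 1" and c: "3 \<le> c"
    and p: "p 0 = r" "p (Suc L) = 1" "\<forall>l\<in>{1..L}. w \<le> p l" and L: "D \<le> L"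
    and s: "real (D * ((2 * c + 8) * w) + 9 * L + 3 * (N + 1) + 7 * r + 6) \<le> s"
    and F: "\<And>x. x \<in> cube r \<Longrightarrow> \<bar>approximant r m M T x\<bar> \<le> F"
  shows "approximant r m M T \<in> critics L p s F"
proof -
  let ?A = "levels r m \<kappa>" and ?W = "levels_width r \<kappa>"
  have M: "1 \<le> M"
    by (simp add: M_def)
  obtain js where js: "set js = grid M r" "distinct js"
    using finite_distinct_list[OF finite_grid] by blast
  have len_js: "length js = N"
    using distinct_card[OF js(2)] card_grid[of M r] by (simp add: js(1) N_def)
  have lenA: "length ?A \<le> ?W"
    by (simp add: length_levels levels_width_def)
  define S1 where "S1 = 7 * r + 3 + \<kappa> * (m + 3) * (7 * ?W)"
  have n1: "nnet r w (2 + \<kappa> * (m + 3)) S1 (?A @ [])"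
    unfolding S1_def append_Nil2 by (rule nnet_levels) (auto simp: w_def)
  have "cchain ?A (2 * c) (6 * length js) (2 * r + m + 5) (concat (map (\<lambda>_. []) js)) (concat (map (\<lambda>j. [cell r m M T j]) js))"
  proof (rule cchain_concat)
    fix j assume "j \<in> set js"
    then show "cchain ?A (2 * c) 6 (2 * r + m + 5) [] [cell r m M T j]"
      using M T c clip_coord_in_levels by (intro cell_chain) (auto simp: js(1))
  qed
  moreover have "concat (map (\<lambda>_. []) js) = ([] :: ((nat \<Rightarrow> real) \<Rightarrow> real) list)"
    by simp
  ultimately have ch: "cchain ?A (2 * c) (6 * N) (2 * r + m + 5) [] (map (cell r m M T) js)"
    by (simp add: len_js concat_map_singleton)
  define S2 where "S2 = S1 + (2 * r + m + 5) * ((2 * c + 1) * (length ?A + 6 * N))"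
  have n2: "nnet r w (2 + \<kappa> * (m + 3) + (2 * r + m + 5)) S2 (?A @ map (cell r m M T) js)"
    unfolding S2_def
    by (rule nnet_cchain[OF ch n1]) (use levels_nonneg c lenA in \<open>auto simp: w_def\<close>)
  define y where "y = (\<lambda>x. \<Sum>j\<leftarrow>js. cell r m M T j x)"
  have y0: "0 \<le> y x" for x
    unfolding y_def using cell_nonneg[OF M T(2)] by (intro sum_list_nonneg) auto
  have "lc (?A @ map (cell r m M T) js) 1 N y"
    unfolding y_def len_js[symmetric] by (rule lc_append2[OF lc_sum]) simp
  then have ny: "neuron (?A @ map (cell r m M T) js) N y"
    by (rule neuronI0) (use y0 in \<open>auto simp: relu_def max_absorb1\<close>)
  have n1: "neuron (?A @ map (cell r m M T) js) N (\<lambda>_. 1)"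
    by (rule neuronI[OF lc_zero[of 1], where b="- 1"]) (auto simp: relu_def)
  have n3: "nnet r w (Suc (2 + \<kappa> * (m + 3) + (2 * r + m + 5))) (S2 + (N + 1) * 3) [y, y, \<lambda>_. 1]"
    by (rule nnet_layer[OF n2, of _ N]) (use ny n1 in \<open>auto simp: w_def\<close>)
  let ?Y = "\<lambda>x. 2 ^ k * y x"
  have w3: "3 \<le> w"
    by (simp add: w_def)
  have "nnet r w (D + (L - D)) (S2 + (N + 1) * 3 + 9 * k + 9 * (L - D)) [?Y, ?Y, \<lambda>_. 1]"
  proof (rule nnet_pad[OF _ _ w3])
    show "nnet r w D (S2 + (N + 1) * 3 + 9 * k) [?Y, ?Y, \<lambda>_. 1]"
      using nnet_double[OF n3 y0 w3, of k] by (simp add: D_def)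
  qed (use y0 in simp)
  then have n5: "nnet r w L (S2 + (N + 1) * 3 + 9 * k + 9 * (L - D)) [?Y, ?Y, \<lambda>_. 1]"
    using L by simp
  have eq: "approximant r m M T = (\<lambda>x. 1 * ?Y x + (0 * ?Y x + (- 1 / 2) * 1))"
  proof
    fix x
    have "y x = (\<Sum>j\<in>grid M r. cell r m M T j x)"
      unfolding y_def js(1)[symmetric] by (rule sum_list_distinct_conv_sum_set[OF js(2)])
    then show "approximant r m M T x = 1 * ?Y x + (0 * ?Y x + (- 1 / 2) * 1)"
      by (simp add: approximant_def M_def)
  qed
  have out: "lc [?Y, ?Y, \<lambda>_. 1] 1 3 (approximant r m M T)"
    by (rule lc_explicit[of "[1, 0, - 1 / 2]"]) (auto simp: eq)
  have "S2 + (N + 1) * 3 + 9 * k + 9 * (L - D) + 3 \<le> D * ((2 * c + 8) * w) + 9 * L + 3 * (N + 1) + 7 * r + 6"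
  proof -
    have "S2 = 7 * r + 3 + (\<kappa> * (m + 3) * (7 * ?W) + (2 * r + m + 5) * ((2 * c + 1) * (length ?A + 6 * N)))"
      by (simp add: S2_def S1_def)
    \<comment> \<open>\<open>2 * c + 8\<close> exceeds both costs per neuron, 7 in the product tree
      and \<open>2 * c + 1\<close> in the cells.\<close>
    also have "\<dots> \<le> 7 * r + 3 + (\<kappa> * (m + 3) * ((2 * c + 8) * w) + (2 * r + m + 5) * ((2 * c + 8) * w))"
      using lenA by (intro add_left_mono add_mono mult_left_mono mult_mono) (auto simp: w_def)
    also have "\<dots> = 7 * r + 3 + (\<kappa> * (m + 3) + (2 * r + m + 5)) * ((2 * c + 8) * w)"
      by (simp add: algebra_simps)
    also have "\<dots> \<le> 7 * r + 3 + D * ((2 * c + 8) * w)"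
      by (intro add_left_mono mult_right_mono) (auto simp: D_def)
    finally show ?thesis
      using L by (simp add: D_def)
  qed
  then have "real (S2 + (N + 1) * 3 + 9 * k + 9 * (L - D) + 3) \<le> s"
    using s by linarith
  from nnet_critic[OF n5 out p this F] show ?thesis .
qed

subsection \<open>Error and Lipschitz estimates\<close>

text \<open>Measured in the maximum distance, which suits coordinatewise constructions. It is at
  most the Euclidean distance, so the constant carries over to the norm used for critics.\<close>

definition lip_on :: "nat \<Rightarrow> real \<Rightarrow> ((nat \<Rightarrow> real) \<Rightarrow> real) \<Rightarrow> bool" where
  "lip_on r c g \<longleftrightarrow> (\<forall>x\<in>cube r. \<forall>y\<in>cube r. \<bar>g x - g y\<bar> \<le> c * dist_sup r x y)"

text \<open>One number bounds the difference uniformly and in the Lipschitz sense. Adding the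
  Lipschitz constant of the target then gives that of the network.\<close>

definition close :: "nat \<Rightarrow> real \<Rightarrow> ((nat \<Rightarrow> real) \<Rightarrow> real) \<Rightarrow> ((nat \<Rightarrow> real) \<Rightarrow> real) \<Rightarrow> bool" where
  "close r e g g' \<longleftrightarrow> (\<forall>x\<in>cube r. \<bar>g x - g' x\<bar> \<le> e) \<and> lip_on r e (\<lambda>x. g x - g' x)"

lemma lip_on_mono: "1 \<le> r \<Longrightarrow> lip_on r c g \<Longrightarrow> c \<le> c' \<Longrightarrow> lip_on r c' g"
  unfolding lip_on_def by (meson dist_sup_nonneg mult_right_mono order.trans)

lemma close_mono: "1 \<le> r \<Longrightarrow> close r e g g' \<Longrightarrow> e \<le> e' \<Longrightarrow> close r e' g g'"
  unfolding close_def by (meson lip_on_mono order.trans)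

lemma close_refl: "close r 0 g g"
  by (simp add: close_def lip_on_def)

lemma close_sum:
  assumes "\<And>l. l \<in> I \<Longrightarrow> close r e (g l) (g' l)"
  shows "close r ((\<Sum>l\<in>I. \<bar>b l\<bar>) * e) (\<lambda>x. a + (\<Sum>l\<in>I. b l * g l x)) (\<lambda>x. a + (\<Sum>l\<in>I. b l * g' l x))"
  unfolding close_def lip_on_def
proof (intro conjI ballI)
  have eq: "(a + (\<Sum>l\<in>I. b l * g l x)) - (a + (\<Sum>l\<in>I. b l * g' l x)) = (\<Sum>l\<in>I. b l * (g l x - g' l x))" for x
    by (simp add: right_diff_distrib sum_subtractf)
  fix x assume x: "x \<in> cube r"
  have "\<bar>\<Sum>l\<in>I. b l * (g l x - g' l x)\<bar> \<le> (\<Sum>l\<in>I. \<bar>b l * (g l x - g' l x)\<bar>)"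
    by (rule sum_abs)
  also have "\<dots> \<le> (\<Sum>l\<in>I. \<bar>b l\<bar> * e)"
    unfolding abs_mult
  proof (intro sum_mono mult_left_mono)
    fix l assume "l \<in> I"
    then show "\<bar>g l x - g' l x\<bar> \<le> e"
      using assms x unfolding close_def by blast
  qed simp
  finally show "\<bar>(a + (\<Sum>l\<in>I. b l * g l x)) - (a + (\<Sum>l\<in>I. b l * g' l x))\<bar> \<le> (\<Sum>l\<in>I. \<bar>b l\<bar>) * e"
    unfolding eq by (simp add: sum_distrib_right)
  fix y assume y: "y \<in> cube r"
  have "(\<Sum>l\<in>I. b l * (g l x - g' l x)) - (\<Sum>l\<in>I. b l * (g l y - g' l y)) =
      (\<Sum>l\<in>I. b l * ((g l x - g' l x) - (g l y - g' l y)))"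
    by (simp add: right_diff_distrib sum_subtractf)
  also have "\<bar>\<dots>\<bar> \<le> (\<Sum>l\<in>I. \<bar>b l * ((g l x - g' l x) - (g l y - g' l y))\<bar>)"
    by (rule sum_abs)
  also have "\<dots> \<le> (\<Sum>l\<in>I. \<bar>b l\<bar> * (e * dist_sup r x y))"
    unfolding abs_mult
  proof (intro sum_mono mult_left_mono)
    fix l assume "l \<in> I"
    then show "\<bar>(g l x - g' l x) - (g l y - g' l y)\<bar> \<le> e * dist_sup r x y"
      using assms x y unfolding close_def lip_on_def by blast
  qed simp
  also have "\<dots> = (\<Sum>l\<in>I. \<bar>b l\<bar>) * e * dist_sup r x y"
    by (simp add: sum_distrib_right mult.assoc)
  finally show "\<bar>((a + (\<Sum>l\<in>I. b l * g l x)) - (a + (\<Sum>l\<in>I. b l * g' l x))) -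
      ((a + (\<Sum>l\<in>I. b l * g l y)) - (a + (\<Sum>l\<in>I. b l * g' l y)))\<bar> \<le> (\<Sum>l\<in>I. \<bar>b l\<bar>) * e * dist_sup r x y"
    unfolding eq .
qed

lemma product_diff_le:
  fixes p q :: "'a \<Rightarrow> real"
  assumes "\<bar>p x - p y\<bar> \<le> e * d" "\<bar>q x\<bar> \<le> b" "\<bar>p y\<bar> \<le> a" "\<bar>q x - q y\<bar> \<le> e' * d" "0 \<le> a" "0 \<le> e * d"
  shows "\<bar>p x * q x - p y * q y\<bar> \<le> (e * b + a * e') * d"
proof -
  have "p x * q x - p y * q y = (p x - p y) * q x + p y * (q x - q y)"
    by (simp add: algebra_simps)
  then have "\<bar>p x * q x - p y * q y\<bar> \<le> \<bar>p x - p y\<bar> * \<bar>q x\<bar> + \<bar>p y\<bar> * \<bar>q x - q y\<bar>"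
    by (metis abs_mult abs_triangle_ineq)
  also have "\<dots> \<le> (e * d) * b + a * (e' * d)"
    using assms by (intro add_mono mult_mono) auto
  finally show ?thesis
    by (simp add: algebra_simps)
qed

text \<open>The difference splits into the error of the multiplication and
  \<open>(u' - u) * v' + u * (v' - v)\<close>. The first part inherits the factor
  \<open>(1/2) ^ m\<close> in size and slope from \<open>sq_err\<close>; the rest is the product
  rule.\<close>

lemma close_mult:
  assumes r: "1 \<le> r" and u: "lip_on r a u" "\<And>x. x \<in> cube r \<Longrightarrow> \<bar>u x\<bar> \<le> 1" and v: "lip_on r b v"
    and u': "close r e1 u' u" "\<And>x. 0 \<le> u' x \<and> u' x \<le> 1"
    and v': "close r e2 v' v" "\<And>x. 0 \<le> v' x \<and> v' x \<le> 1"
    and pos: "0 \<le> a" "0 \<le> b" "0 \<le> e1" "0 \<le> e2"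
  shows "close r ((1/2) ^ m * (1 + a + b + e1 + e2) + e1 * (1 + b + e2) + e2 * (1 + a))
    (\<lambda>x. approx_mult m (u' x) (v' x)) (\<lambda>x. u x * v x)"
    (is "close r ?e _ _")
proof -
  define s where "s = (\<lambda>x. (u' x + v' x) / 2)"
  define d where "d = (\<lambda>x. \<bar>u' x - v' x\<bar> / 2)"
  have s: "0 \<le> s x" "s x \<le> 1" and d: "0 \<le> d x" "d x \<le> 1" for x
    using u'(2)[of x] v'(2)[of x] by (auto simp: s_def d_def abs_if)
  define E where "E = (\<lambda>x. sq_err m (s x) - sq_err m (d x))"
  define h :: real where "h = (1/2) ^ m"
  have h: "0 \<le> h"
    by (simp add: h_def)
  have eq: "approx_mult m (u' x) (v' x) - u x * v x = E x + ((u' x - u x) * v' x + u x * (v' x - v x))" for x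
    by (simp add: approx_mult_err E_def s_def d_def algebra_simps)
  have e: "?e = h * (1 + a + b + e1 + e2) + e1 * (1 + b + e2) + e2 * (1 + a)"
    by (simp add: h_def)
  have lip: "\<bar>u x - u y\<bar> \<le> a * dist_sup r x y" "\<bar>v x - v y\<bar> \<le> b * dist_sup r x y"
    "\<bar>(u' x - u x) - (u' y - u y)\<bar> \<le> e1 * dist_sup r x y"
    "\<bar>(v' x - v x) - (v' y - v y)\<bar> \<le> e2 * dist_sup r x y"
    if "x \<in> cube r" "y \<in> cube r" for x y
    using that u v u' v' unfolding lip_on_def close_def by blast+
  have sup: "\<bar>u' x - u x\<bar> \<le> e1" "\<bar>v' x - v x\<bar> \<le> e2" if "x \<in> cube r" for x
    using that u' v' unfolding close_def by blast+
  show ?thesis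
    unfolding close_def lip_on_def
  proof (intro conjI ballI)
    fix x assume x: "x \<in> cube r"
    have "\<bar>E x\<bar> \<le> h"
      unfolding E_def h_def
      using sq_err_bounds[OF s[of x], of m] sq_err_bounds[OF d[of x], of m] by linarith
    moreover have "\<bar>(u' x - u x) * v' x\<bar> \<le> e1 * 1"
      unfolding abs_mult using sup[OF x] v'(2)[of x] pos by (intro mult_mono) auto
    moreover have "\<bar>u x * (v' x - v x)\<bar> \<le> 1 * e2"
      unfolding abs_mult using sup[OF x] u(2)[OF x] pos by (intro mult_mono) auto
    moreover have "h + e1 + e2 \<le> ?e"
    proof -
      have "0 \<le> h * (a + b + e1 + e2)" "0 \<le> e1 * (b + e2)" "0 \<le> e2 * a"
        using h pos by auto
      then show ?thesis
        unfolding e by (simp add: algebra_simps)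
    qed
    ultimately show "\<bar>approx_mult m (u' x) (v' x) - u x * v x\<bar> \<le> ?e"
      unfolding eq by linarith
    fix y assume y: "y \<in> cube r"
    let ?d = "dist_sup r x y"
    have D: "0 \<le> ?d"
      by (rule dist_sup_nonneg[OF r])
    have uv: "\<bar>u' x - u' y\<bar> \<le> (a + e1) * ?d" "\<bar>v' x - v' y\<bar> \<le> (b + e2) * ?d"
      using lip[OF x y] by (simp_all add: algebra_simps abs_le_iff)
    have "\<bar>sq_err m (s x) - sq_err m (s y)\<bar> \<le> h * \<bar>s x - s y\<bar>"
      "\<bar>sq_err m (d x) - sq_err m (d y)\<bar> \<le> h * \<bar>d x - d y\<bar>"
      unfolding h_def using s d by (intro sq_err_lip; simp)+
    then have "\<bar>E x - E y\<bar> \<le> h * (\<bar>s x - s y\<bar> + \<bar>d x - d y\<bar>)"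
      unfolding E_def distrib_left by linarith
    also have "\<dots> \<le> h * ((a + e1) * ?d + (b + e2) * ?d)"
    proof (rule mult_left_mono[OF _ h])
      have "\<bar>s x - s y\<bar> \<le> (\<bar>u' x - u' y\<bar> + \<bar>v' x - v' y\<bar>) / 2"
        by (simp add: s_def abs_if field_simps)
      moreover have "\<bar>d x - d y\<bar> \<le> (\<bar>u' x - u' y\<bar> + \<bar>v' x - v' y\<bar>) / 2"
        by (simp add: d_def abs_if field_simps)
      ultimately have "\<bar>s x - s y\<bar> + \<bar>d x - d y\<bar> \<le> (\<bar>u' x - u' y\<bar> + \<bar>v' x - v' y\<bar>) / 2 + (\<bar>u' x - u' y\<bar> + \<bar>v' x - v' y\<bar>) / 2"
        by (rule add_mono)
      also have "\<dots> = (\<bar>u' x - u' y\<bar> + \<bar>v' x - v' y\<bar>)"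
        by (rule field_sum_of_halves)
      also have "\<dots> \<le> (a + e1) * ?d + (b + e2) * ?d"
        by (intro add_mono uv)
      finally show "\<bar>s x - s y\<bar> + \<bar>d x - d y\<bar> \<le> (a + e1) * ?d + (b + e2) * ?d" .
    qed
    finally have 1: "\<bar>E x - E y\<bar> \<le> h * (a + b + e1 + e2) * ?d"
      by (simp add: algebra_simps)
    have 2: "\<bar>(u' x - u x) * v' x - (u' y - u y) * v' y\<bar> \<le> (e1 * 1 + e1 * (b + e2)) * ?d"
      using product_diff_le[of "\<lambda>x. u' x - u x" x y e1 ?d v' 1 e1 "b + e2"]
        lip(3)[OF x y] v'(2)[of x] sup(1)[OF y] uv(2) pos D by simp
    have 3: "\<bar>u x * (v' x - v x) - u y * (v' y - v y)\<bar> \<le> (a * e2 + 1 * e2) * ?d"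
      using product_diff_le[of u x y a ?d "\<lambda>x. v' x - v x" e2 1 e2]
        lip(1,4)[OF x y] u(2)[OF y] sup(2)[OF x] pos D by simp
    have "\<bar>(E x + ((u' x - u x) * v' x + u x * (v' x - v x))) - (E y + ((u' y - u y) * v' y + u y * (v' y - v y)))\<bar>
        \<le> \<bar>E x - E y\<bar> + \<bar>(u' x - u x) * v' x - (u' y - u y) * v' y\<bar> + \<bar>u x * (v' x - v x) - u y * (v' y - v y)\<bar>"
      by linarith
    also have "\<dots> \<le> h * (a + b + e1 + e2) * ?d + (e1 * 1 + e1 * (b + e2)) * ?d + (a * e2 + 1 * e2) * ?d"
      using 1 2 3 by linarith
    also have "\<dots> = (h * (a + b + e1 + e2) + e1 * (1 + b + e2) + e2 * (1 + a)) * ?d"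
      by (simp add: algebra_simps)
    also have "\<dots> \<le> ?e * ?d"
      unfolding e using h D by (intro mult_right_mono) (auto simp: algebra_simps)
    finally show "\<bar>(approx_mult m (u' x) (v' x) - u x * v x) - (approx_mult m (u' y) (v' y) - u y * v y)\<bar> \<le> ?e * ?d"
      unfolding eq .
  qed
qed

text \<open>\<open>E\<close> is chosen before \<open>m\<close>: it accumulates over the levels of
  the tree, whose number depends only on the degree, while the accuracy still improves geometrically
  in \<open>m\<close>.\<close>

lemma mtree_close:
  assumes r: "1 \<le> r"
  shows "\<exists>E\<ge>0. \<forall>m. \<forall>l\<in>words r (2 ^ k). close r (E * (1/2) ^ m) (mtree r m k l) (monomial r l)"
proof (induction k)
  case 0
  have "close r (0 * (1/2) ^ m) (mtree r m 0 l) (monomial r l)" if l: "l \<in> words r (2 ^ 0)" for m l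
  proof -
    obtain i where "l = [i]"
      using l by (auto simp: words_def length_Suc_conv)
    then have "mtree r m 0 l = monomial r l"
      by (auto simp: monomial_def)
    then show ?thesis
      by (simp add: close_refl)
  qed
  then show ?case
    by blast
next
  case (Suc k)
  then obtain E where E: "E \<ge> 0" "\<And>m l. l \<in> words r (2 ^ k) \<Longrightarrow> close r (E * (1/2) ^ m) (mtree r m k l) (monomial r l)"
    by blast
  \<comment> \<open>A monomial of degree \<open>2 ^ k\<close> has this Lipschitz constant.
    \<open>?E\<close> is the bound from \<open>close_mult\<close> with one factor
    \<open>(1/2) ^ m\<close> taken out and the remaining ones estimated by 1.\<close>
  let ?a = "2 ^ k :: real"
  let ?E = "(1 + ?a + ?a + E + E) + E * (1 + ?a + E) + E * (1 + ?a)"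
  have "close r (?E * (1/2) ^ m) (mtree r m (Suc k) l) (monomial r l)" if l: "l \<in> words r (2 ^ Suc k)" for m l
  proof -
    let ?l1 = "take (2 ^ k) l" and ?l2 = "drop (2 ^ k) l" and ?h = "(1/2) ^ m :: real"
    have "length l = 2 ^ k + 2 ^ k" "set l \<subseteq> {..r}"
      using l by (auto simp: words_def)
    then have w: "?l1 \<in> words r (2 ^ k)" "?l2 \<in> words r (2 ^ k)"
      by (auto simp: words_def dest: in_set_takeD in_set_dropD)
    have lip: "lip_on r ?a (monomial r l')" if "l' \<in> words r (2 ^ k)" for l'
      using monomial_lip[OF r, of l'] that by (simp add: lip_on_def words_def)
    have h: "0 \<le> ?h" "?h \<le> 1"
      by (auto intro: power_le_one)
    have Eh: "E * ?h \<le> E" "0 \<le> E * ?h"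
      using h E(1) by (auto simp: mult_left_le)
    have "close r (?h * (1 + ?a + ?a + E * ?h + E * ?h) + E * ?h * (1 + ?a + E * ?h) + E * ?h * (1 + ?a))
        (\<lambda>x. approx_mult m (mtree r m k ?l1 x) (mtree r m k ?l2 x)) (\<lambda>x. monomial r ?l1 x * monomial r ?l2 x)"
      using monomial_bounds Eh mtree_bounds
      by (intro close_mult r lip w E(2)) auto
    moreover have "(\<lambda>x. monomial r ?l1 x * monomial r ?l2 x) = monomial r l"
    proof
      fix x
      have "monomial r (?l1 @ ?l2) x = monomial r ?l1 x * monomial r ?l2 x"
        unfolding monomial_def map_append prod_list.append ..
      then show "monomial r ?l1 x * monomial r ?l2 x = monomial r l x"
        by simp
    qed
    moreover have "?h * (1 + ?a + ?a + E * ?h + E * ?h) + E * ?h * (1 + ?a + E * ?h) + E * ?h * (1 + ?a) \<le> ?E * ?h"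
    proof -
      have "?h * (1 + ?a + ?a + E * ?h + E * ?h) \<le> ?h * (1 + ?a + ?a + E + E)"
        "E * ?h * (1 + ?a + E * ?h) \<le> E * ?h * (1 + ?a + E)"
        using Eh h by (auto intro!: mult_left_mono)
      then show ?thesis
        by (simp add: algebra_simps)
    qed
    ultimately show ?thesis
      using close_mono[OF r] by simp
  qed
  moreover have "0 \<le> ?E"
    using E(1) by simp
  ultimately show ?case
    by blast
qed

lemma lip_on_affine: "lip_on r c g \<Longrightarrow> lip_on r c (\<lambda>x. a + g x)"
  by (simp add: lip_on_def)

lemma lip_onD: "lip_on r c g \<Longrightarrow> x \<in> cube r \<Longrightarrow> y \<in> cube r \<Longrightarrow> \<bar>g x - g y\<bar> \<le> c * dist_sup r x y"
  unfolding lip_on_def by blast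

lemma cell_close:
  assumes r: "1 \<le> r" and M: "1 \<le> M" and T: "\<And>x. 0 \<le> T j x \<and> T j x \<le> 1" "close r (e * (1/2) ^ m) (T j) P"
    and P: "lip_on r b P" and b: "0 \<le> b" and e: "0 \<le> e"
  shows "close r ((3 + b + 4 * e) * (1/2) ^ m) (cell r m M T j) (\<lambda>x. hat M r j x * P x)"
proof -
  let ?h = "(1/2) ^ m :: real"
  have h: "0 \<le> ?h" "?h \<le> 1"
    by (auto intro: power_le_one)
  have eh: "e * ?h \<le> e" "0 \<le> e * ?h"
    using h e by (auto simp: mult_left_le)
  have hat: "0 \<le> hat M r j x \<and> hat M r j x \<le> 1" for x
    using hat_nonneg[of M r j x] hat_le[of M r j x] M by (auto intro: order.trans)
  have "lip_on r 2 (hat M r j)"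
    using hat_lip[OF r] by (simp add: lip_on_def)
  \<comment> \<open>The hat function is represented exactly and has Lipschitz constant 2, so only
    the error of \<open>T j\<close> and that of the multiplication enter.\<close>
  then have "close r (?h * (1 + 2 + b + 0 + e * ?h) + 0 * (1 + b + e * ?h) + e * ?h * (1 + 2))
      (\<lambda>x. approx_mult m (hat M r j x) (T j x)) (\<lambda>x. hat M r j x * P x)"
    using hat T eh b by (intro close_mult r P close_refl) auto
  moreover have "?h * (1 + 2 + b + 0 + e * ?h) \<le> ?h * (3 + b + e)"
    using h eh by (intro mult_left_mono) auto
  ultimately show ?thesis
    unfolding cell_def[abs_def] by (elim close_mono[OF r]) (simp add: algebra_simps)
qed

text \<open>A cell and its target both vanish where the hat function does, so at most
  \<open>2 ^ (r + 1)\<close> errors contribute at two points. The factor \<open>M\<close> amplifies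
  them; the choice of \<open>m\<close> has to make up for it.\<close>

lemma approximant_close:
  assumes r: "1 \<le> r" and M: "1 \<le> M" and E: "0 \<le> E"
    and T: "\<And>j x. 0 \<le> T j x \<and> T j x \<le> 1"
    and cl: "\<And>j. j \<in> grid M r \<Longrightarrow> close r E (cell r m M T j) (\<lambda>x. hat M r j x * (1/2 + P j x))"
  shows "close r (real M * (2 ^ (r + 1) * E)) (approximant r m M T) (quasi_interp M r P)"
proof -
  define err where "err = (\<lambda>j x. cell r m M T j x - hat M r j x * (1/2 + P j x))"
  have "approximant r m M T x - quasi_interp M r P x = real M * (\<Sum>j\<in>grid M r. err j x)" for x
  proof -
    \<comment> \<open>By the partition of unity the shifts of all cells add up to exactly 1/2, the
      constant subtracted in \<open>approximant\<close>.\<close>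
    have "real M * (\<Sum>j\<in>grid M r. hat M r j x * (1/2 + P j x)) = 1/2 * (\<Sum>j\<in>grid M r. real M * hat M r j x) + quasi_interp M r P x"
      by (simp add: quasi_interp_def sum_distrib_left sum.distrib distrib_left mult_ac)
    then show ?thesis
      unfolding err_def approximant_def sum_subtractf right_diff_distrib hat_sum[OF M] by simp
  qed
  note eq = this
  have zero: "err j x = 0" if "hat M r j x = 0" for j x
    using that T[of j x] by (simp add: err_def cell_def approx_mult_0)
  have clD: "\<bar>err j x\<bar> \<le> E" "\<bar>err j x - err j y\<bar> \<le> E * dist_sup r x y"
    if "j \<in> grid M r" "x \<in> cube r" "y \<in> cube r" for j x y
    using cl[OF that(1)] that unfolding close_def lip_on_def err_def by blast+
  show ?thesis
    unfolding close_def lip_on_def eq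
  proof (intro conjI ballI)
    fix x assume x: "x \<in> cube r"
    have "\<bar>\<Sum>j\<in>grid M r. err j x\<bar> \<le> 2 ^ (r + 1) * E"
      by (rule sum_active_bound[OF M E]) (use clD(1)[OF _ x x] zero in auto)
    then show "\<bar>real M * (\<Sum>j\<in>grid M r. err j x)\<bar> \<le> real M * (2 ^ (r + 1) * E)"
      by (simp add: abs_mult mult_left_mono)
    fix y assume y: "y \<in> cube r"
    have "\<bar>\<Sum>j\<in>grid M r. err j x - err j y\<bar> \<le> 2 ^ (r + 1) * (E * dist_sup r x y)"
    proof (rule sum_active_bound[OF M, of _ r x y])
      show "0 \<le> E * dist_sup r x y"
        using E dist_sup_nonneg[OF r] by simp
    qed (use clD(2)[OF _ x y] zero in auto)
    then have "real M * \<bar>\<Sum>j\<in>grid M r. err j x - err j y\<bar> \<le> real M * (2 ^ (r + 1) * (E * dist_sup r x y))"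
      by (intro mult_left_mono) auto
    moreover have "real M * (\<Sum>j\<in>grid M r. err j x) - real M * (\<Sum>j\<in>grid M r. err j y) =
        real M * (\<Sum>j\<in>grid M r. err j x - err j y)"
      by (simp add: sum_subtractf right_diff_distrib)
    ultimately show "\<bar>real M * (\<Sum>j\<in>grid M r. err j x) - real M * (\<Sum>j\<in>grid M r. err j y)\<bar> \<le>
        real M * (2 ^ (r + 1) * E) * dist_sup r x y"
      by (simp add: abs_mult mult.assoc)
  qed
qed

section \<open>Lipschitz bound on the whole space\<close>

definition clip_vec :: "nat \<Rightarrow> (nat \<Rightarrow> real) \<Rightarrow> nat \<Rightarrow> real" where
  "clip_vec r x = (\<lambda>i\<in>{..<r}. clip_coord r i x)"

lemma clip_vec_cube: "clip_vec r x \<in> cube r"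
  by (auto simp: clip_vec_def cube_def clip_coord_bounds)

lemma clip_coord_clip_vec: "clip_coord r i (clip_vec r x) = clip_coord r i x"
  by (auto simp: clip_vec_def clip_coord_def)

lemma clip_vec_dist: "1 \<le> r \<Longrightarrow> dist_sup r (clip_vec r x) (clip_vec r y) \<le> dist_sup r x y"
  using clip_coord_lip by (intro dist_sup_le) (auto simp: clip_vec_def)

lemma mtree_clip_vec: "mtree r m k l (clip_vec r x) = mtree r m k l x"
  by (induction k arbitrary: l) (simp_all add: clip_coord_clip_vec)

lemma hat_clip_vec: "hat M r j (clip_vec r x) = hat M r j x"
  by (simp add: hat_def clip_coord_clip_vec)

lemma lip_const_le_1:
  assumes r: "1 \<le> r" and z: "\<And>x. z (clip_vec r x) = z x" and l: "lip_on r 1 z"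
  shows "lip_const r (vecs r) z \<le> 1"
  unfolding lip_const_def
proof (rule SUP_least, clarify)
  fix x y :: "nat \<Rightarrow> real"
  assume "x \<noteq> y"
  have "\<bar>z x - z y\<bar> \<le> dist_sup r (clip_vec r x) (clip_vec r y)"
    using lip_onD[OF l clip_vec_cube clip_vec_cube, of x y] by (simp add: z)
  also have "\<dots> \<le> dist_eucl r x y"
    using clip_vec_dist[OF r] dist_sup_le_eucl[OF r] by (rule order.trans)
  finally have "\<bar>z x - z y\<bar> / dist_eucl r x y \<le> 1"
    using L2_set_nonneg[of "\<lambda>i. x i - y i" "{..<r}"] by (auto simp: divide_le_eq_1 dist_eucl_def less_le)
  then show "ennreal (\<bar>z x - z y\<bar> / dist_eucl r x y) \<le> 1"
    by (simp add: ennreal_le_1)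
qed

section \<open>Networks for a given Hoelder function\<close>

text \<open>Coefficients with absolute sum at most 1/2 serve twice: the polynomial part stays in
  \<open>[-1/2, 1/2]\<close>, hence its shift in \<open>[0, 1]\<close>, and every weight is at most
  1/2. The shift is 1/2 times the constant feature, so even on a shared feature the weights add up
  to at most 1. The surplus in the fan-in makes it at least 3, as \<open>cell_chain\<close>
  demands.\<close>

lemma poly_net:
  assumes r: "1 \<le> r" and P: "poly_rep r (2 ^ \<kappa>) B P" and B: "B \<le> 1/2" and E: "0 \<le> E"
    and cl: "\<And>l. l \<in> words r (2 ^ \<kappa>) \<Longrightarrow> close r (E * (1/2) ^ m) (mtree r m \<kappa> l) (monomial r l)"
  obtains T where "lc (levels r m \<kappa>) 1 ((r + 1) ^ 2 ^ \<kappa> + 3) T" "\<And>x. 0 \<le> T x \<and> T x \<le> 1"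
    "close r (E * (1/2) ^ m) T (\<lambda>x. 1/2 + P x)" "\<And>x. T (clip_vec r x) = T x"
proof -
  let ?W = "words r (2 ^ \<kappa>)" and ?wl = "word_list r (2 ^ \<kappa>)"
  obtain b where b: "(\<Sum>l\<in>?W. \<bar>b l\<bar>) \<le> B" "\<And>x. x \<in> cube r \<Longrightarrow> P x = (\<Sum>l\<in>?W. b l * monomial r l x)"
    using P unfolding poly_rep_def by blast
  define S where "S = (\<lambda>x. \<Sum>l\<in>?W. b l * mtree r m \<kappa> l x)"
  have bl: "\<bar>b l\<bar> \<le> 1/2" if "l \<in> ?W" for l
    using member_le_sum[of l ?W "\<lambda>l. \<bar>b l\<bar>"] that finite_words b(1) B by simp
  have S: "\<bar>S x\<bar> \<le> 1/2" for x
  proof -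
    have "\<bar>S x\<bar> \<le> (\<Sum>l\<in>?W. \<bar>b l * mtree r m \<kappa> l x\<bar>)"
      unfolding S_def by (rule sum_abs)
    also have "\<dots> \<le> (\<Sum>l\<in>?W. \<bar>b l\<bar> * 1)"
      unfolding abs_mult using mtree_bounds by (intro sum_mono mult_left_mono) auto
    finally show ?thesis
      using b(1) B by simp
  qed
  have level: "lc (level r m \<kappa>) (1/2) ((r + 1) ^ 2 ^ \<kappa>) S"
  proof (rule lc_explicit[of "map b ?wl"])
    have "(\<Sum>(a, h)\<leftarrow>zip (map b ?wl) (level r m \<kappa>). a * h x) = S x" for x
    proof -
      have "(\<Sum>(a, h)\<leftarrow>zip (map b ws) (map (mtree r m \<kappa>) ws). a * h x) = (\<Sum>l\<leftarrow>ws. b l * mtree r m \<kappa> l x)" for ws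
        by (induction ws) auto
      then show ?thesis
        unfolding level_def S_def set_word_list[symmetric]
        by (simp add: sum_list_distinct_conv_sum_set[OF distinct_word_list])
    qed
    then show "S = (\<lambda>x. \<Sum>(a, h)\<leftarrow>zip (map b ?wl) (level r m \<kappa>). a * h x)"
      by simp
    show "\<bar>a\<bar> \<le> 1/2" if "a \<in> set (map b ?wl)" for a
      using that bl by (auto simp: set_word_list)
  qed (simp_all add: level_def length_word_list)
  have levels: "lc (levels r m \<kappa>) (1/2) ((r + 1) ^ 2 ^ \<kappa>) S"
  proof (cases \<kappa>)
    case 0
    then show ?thesis
      using level by simp
  next
    case (Suc k)
    show ?thesis
      unfolding Suc levels.simps by (rule lc_append2) (use level Suc in simp_all)
  qed
  have one: "lc (levels r m \<kappa>) (1/2) 1 (\<lambda>x. 1/2 * clip_coord r r x)"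
    by (rule lc_single[OF clip_coord_in_levels]) auto
  have T: "lc (levels r m \<kappa>) 1 ((r + 1) ^ 2 ^ \<kappa> + 3) (\<lambda>x. 1/2 + S x)"
    using lc_mono[OF lc_add[OF one levels], of 1 "(r + 1) ^ 2 ^ \<kappa> + 3"] by (simp add: clip_coord_def)
  show thesis
  proof (rule that[OF T])
    show "0 \<le> 1/2 + S x \<and> 1/2 + S x \<le> 1" for x
      using S[of x] by auto
    have c: "close r ((\<Sum>l\<in>?W. \<bar>b l\<bar>) * (E * (1/2) ^ m)) (\<lambda>x. 1/2 + S x)
        (\<lambda>x. 1/2 + (\<Sum>l\<in>?W. b l * monomial r l x))"
      unfolding S_def by (rule close_sum[OF cl])
    have "(\<Sum>l\<in>?W. \<bar>b l\<bar>) * (E * (1/2) ^ m) \<le> 1 * (E * (1/2) ^ m)"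
      using b(1) B E by (intro mult_right_mono) auto
    from close_mono[OF r c this] show "close r (E * (1/2) ^ m) (\<lambda>x. 1/2 + S x) (\<lambda>x. 1/2 + P x)"
      unfolding close_def lip_on_def by (simp add: b(2))
    show "1/2 + S (clip_vec r x) = 1/2 + S x" for x
      by (simp add: S_def mtree_clip_vec)
  qed
qed

definition coeff_const :: "nat \<Rightarrow> real \<Rightarrow> real" where
  "coeff_const r \<gamma> = (\<Sum>k\<le>strict_floor \<gamma>. (2 * real r) ^ k)"

text \<open>After multiplication by \<open>K\<close>, the constant of
  \<open>quasi_interp_lip\<close> for \<open>c1 = K * r ^ q\<close>,
  \<open>c2 = K * coeff_const r \<gamma> * 2 ^ \<kappa>\<close> and \<open>c3 = c1 + c2\<close>,
  where \<open>q = strict_floor \<gamma>\<close>.\<close>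

definition lip_bound :: "nat \<Rightarrow> real \<Rightarrow> nat \<Rightarrow> real" where
  "lip_bound r \<gamma> \<kappa> = 2 * coeff_const r \<gamma> * 2 ^ \<kappa> + real r ^ strict_floor \<gamma> +
     2 ^ (r + 2) * 2 powr \<gamma> * real r ^ strict_floor \<gamma>"

text \<open>Combines the two sources of error. The quasi-interpolant takes 1/2 of the size and of
  the Lipschitz constant, and \<open>e\<close> is the deviation of the network from it in both
  senses.\<close>

lemma hoelder_approximant:
  assumes r: "1 \<le> r" and \<gamma>: "1 \<le> \<gamma>" and \<kappa>: "strict_floor \<gamma> \<le> 2 ^ \<kappa>" and K: "0 \<le> K"
    and KC: "K * coeff_const r \<gamma> \<le> 1/2" "K * lip_bound r \<gamma> \<kappa> \<le> 1/2"
    and f: "f \<in> hoelder_class r \<gamma> (cube r) K" and M: "1 \<le> M" and E: "0 \<le> E"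
    and cl: "\<And>l. l \<in> words r (2 ^ \<kappa>) \<Longrightarrow> close r (E * (1/2) ^ m) (mtree r m \<kappa> l) (monomial r l)"
  defines "e \<equiv> real M * (2 ^ (r + 1) * ((3 + 2 ^ \<kappa> + 4 * E) * (1/2) ^ m))"
  obtains T where "\<And>j. j \<in> grid M r \<Longrightarrow> lc (levels r m \<kappa>) 1 ((r + 1) ^ 2 ^ \<kappa> + 3) (T j)"
    "\<And>j x. 0 \<le> T j x \<and> T j x \<le> 1"
    "\<And>x. x \<in> cube r \<Longrightarrow>
      \<bar>f x - approximant r m M T x\<bar> \<le> K * real r ^ strict_floor \<gamma> * (1 / real M) powr \<gamma> + e"
    "\<And>x. x \<in> cube r \<Longrightarrow> \<bar>approximant r m M T x\<bar> \<le> 1/2 + e"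
    "lip_on r (1/2 + e) (approximant r m M T)"
    "\<And>x. approximant r m M T (clip_vec r x) = approximant r m M T x"
proof -
  let ?c1 = "K * real r ^ strict_floor \<gamma>" and ?B = "K * coeff_const r \<gamma>" and ?Q = "2 ^ \<kappa> :: nat"
  have taylor: "\<exists>P. poly_rep r ?Q ?B P \<and> P \<xi> = f \<xi> \<and> (\<forall>x\<in>cube r. \<bar>f x - P x\<bar> \<le> ?c1 * dist_sup r x \<xi> powr \<gamma>)"
    if \<xi>: "\<xi> \<in> cube r" for \<xi>
  proof (rule hoelder_taylor[OF f K \<gamma> r \<kappa> \<xi>])
    fix P
    assume "poly_rep r ?Q (K * (\<Sum>k\<le>strict_floor \<gamma>. (2 * real r) ^ k)) P" "P \<xi> = f \<xi>"
      "\<And>x. x \<in> cube r \<Longrightarrow> \<bar>f x - P x\<bar> \<le> ?c1 * dist_sup r x \<xi> powr \<gamma>"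
    then show ?thesis
      unfolding coeff_const_def by (intro exI[of _ P] conjI ballI)
  qed
  have B0: "0 \<le> ?B"
    using K by (auto simp: coeff_const_def intro!: mult_nonneg_nonneg sum_nonneg)
  have "\<forall>j\<in>grid M r. \<exists>P. poly_rep r ?Q ?B P \<and>
      (\<forall>x\<in>cube r. \<bar>f x - P x\<bar> \<le> ?c1 * dist_sup r x (grid_point M r j) powr \<gamma>)"
  proof
    fix j assume "j \<in> grid M r"
    from taylor[OF grid_point_cube[OF this M]]
    show "\<exists>P. poly_rep r ?Q ?B P \<and>
        (\<forall>x\<in>cube r. \<bar>f x - P x\<bar> \<le> ?c1 * dist_sup r x (grid_point M r j) powr \<gamma>)"
      by (elim exE conjE) (intro exI conjI)
  qed
  from bchoice[OF this] obtain P where P':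
    "\<forall>j\<in>grid M r. poly_rep r ?Q ?B (P j) \<and>
      (\<forall>x\<in>cube r. \<bar>f x - P j x\<bar> \<le> ?c1 * dist_sup r x (grid_point M r j) powr \<gamma>)" ..
  have P: "poly_rep r ?Q ?B (P j)"
    "x \<in> cube r \<Longrightarrow> \<bar>f x - P j x\<bar> \<le> ?c1 * dist_sup r x (grid_point M r j) powr \<gamma>" if "j \<in> grid M r" for j x
    using that P' by auto
  have "\<forall>j\<in>grid M r. \<exists>T. lc (levels r m \<kappa>) 1 ((r + 1) ^ 2 ^ \<kappa> + 3) T \<and> (\<forall>x. 0 \<le> T x \<and> T x \<le> 1) \<and>
      close r (E * (1/2) ^ m) T (\<lambda>x. 1/2 + P j x) \<and> (\<forall>x. T (clip_vec r x) = T x)"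
  proof
    fix j assume j: "j \<in> grid M r"
    show "\<exists>T. lc (levels r m \<kappa>) 1 ((r + 1) ^ 2 ^ \<kappa> + 3) T \<and> (\<forall>x. 0 \<le> T x \<and> T x \<le> 1) \<and>
      close r (E * (1/2) ^ m) T (\<lambda>x. 1/2 + P j x) \<and> (\<forall>x. T (clip_vec r x) = T x)"
    proof (rule poly_net[OF r P(1)[OF j] KC(1) E cl])
      fix T
      assume "lc (levels r m \<kappa>) 1 ((r + 1) ^ 2 ^ \<kappa> + 3) T" "\<And>x. 0 \<le> T x \<and> T x \<le> 1"
        "close r (E * (1/2) ^ m) T (\<lambda>x. 1/2 + P j x)" "\<And>x. T (clip_vec r x) = T x"
      then show ?thesis
        by (intro exI[of _ T]) simp
    qed
  qed
  from bchoice[OF this] obtain T0 where T0: "\<forall>j\<in>grid M r. lc (levels r m \<kappa>) 1 ((r + 1) ^ 2 ^ \<kappa> + 3) (T0 j) \<and>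
      (\<forall>x. 0 \<le> T0 j x \<and> T0 j x \<le> 1) \<and>
      close r (E * (1/2) ^ m) (T0 j) (\<lambda>x. 1/2 + P j x) \<and> (\<forall>x. T0 j (clip_vec r x) = T0 j x)" ..
  have T0D: "lc (levels r m \<kappa>) 1 ((r + 1) ^ 2 ^ \<kappa> + 3) (T0 j)" "0 \<le> T0 j x" "T0 j x \<le> 1"
    "close r (E * (1/2) ^ m) (T0 j) (\<lambda>x. 1/2 + P j x)" "T0 j (clip_vec r x) = T0 j x"
    if "j \<in> grid M r" for j x
    using bspec[OF T0 that] by simp_all
  \<comment> \<open>The choice says nothing about indices outside the grid. The value 0 there makes
    the bounds and the invariance under clipping hold for every \<open>j\<close>.\<close>
  define T where "T = (\<lambda>j. if j \<in> grid M r then T0 j else (\<lambda>_. 0))"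
  have T: "0 \<le> T j x \<and> T j x \<le> 1" "T j (clip_vec r x) = T j x" for j x
    by (cases "j \<in> grid M r"; simp add: T_def T0D)+
  let ?z = "approximant r m M T" and ?qi = "quasi_interp M r P"
  have lipP: "lip_on r (2 ^ \<kappa>) (\<lambda>x. 1/2 + P j x)" if "j \<in> grid M r" for j
  proof (rule lip_on_affine)
    have "lip_on r (?B * real ?Q) (P j)"
      using poly_rep_lip[OF P(1)[OF that] _ _ r] by (simp add: lip_on_def)
    moreover have "?B * real ?Q \<le> 1 * 2 ^ \<kappa>"
      using KC(1) by (intro mult_mono) auto
    ultimately show "lip_on r (2 ^ \<kappa>) (P j)"
      using lip_on_mono[OF r] by simp
  qed
  have close: "close r e ?z ?qi"
    unfolding e_def
  proof (rule approximant_close[OF r M _ T(1)])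
    fix j assume j: "j \<in> grid M r"
    have "close r (E * (1/2) ^ m) (T j) (\<lambda>x. 1/2 + P j x)"
      using T0D(4)[OF j] j by (simp add: T_def)
    from cell_close[where T=T and j=j, OF r M T(1) this lipP[OF j] _ E]
    show "close r ((3 + 2 ^ \<kappa> + 4 * E) * (1/2) ^ m) (cell r m M T j) (\<lambda>x. hat M r j x * (1/2 + P j x))"
      by simp
  qed (use E in simp)
  have qi_bound: "\<bar>?qi x\<bar> \<le> 1/2" if x: "x \<in> cube r" for x
  proof -
    have "\<bar>?qi x\<bar> \<le> (\<Sum>j\<in>grid M r. \<bar>real M * hat M r j x * P j x\<bar>)"
      unfolding quasi_interp_def by (rule sum_abs)
    also have "\<dots> \<le> (\<Sum>j\<in>grid M r. real M * hat M r j x * (1/2))"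
    proof (rule sum_mono)
      fix j assume "j \<in> grid M r"
      then have "\<bar>P j x\<bar> \<le> 1/2"
        using poly_rep_bound[OF P(1) x] KC(1) by fastforce
      then show "\<bar>real M * hat M r j x * P j x\<bar> \<le> real M * hat M r j x * (1/2)"
        unfolding abs_mult using hat_nonneg[of M r j x] by (intro mult_mono) auto
    qed
    also have "\<dots> = 1/2"
      unfolding sum_distrib_right[symmetric] hat_sum[OF M] by simp
    finally show ?thesis .
  qed
  \<comment> \<open>A Lipschitz constant of \<open>f\<close> that shrinks with \<open>K\<close>,
    obtained by comparing \<open>f\<close> with its Taylor polynomial at \<open>y\<close>. As
    distances in the cube are at most 1, the power \<open>\<gamma>\<close> can be replaced by
    1.\<close>
  have fL: "\<bar>f x - f y\<bar> \<le> (?c1 + ?B * real ?Q) * dist_sup r x y" if x: "x \<in> cube r" and y: "y \<in> cube r" for x y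
  proof -
    obtain p where p: "poly_rep r ?Q ?B p" "p y = f y"
      "\<bar>f x - p x\<bar> \<le> ?c1 * dist_sup r x y powr \<gamma>"
      using taylor[OF y] x by blast
    have "dist_sup r x y powr \<gamma> \<le> dist_sup r x y powr 1"
      using dist_sup_nonneg[OF r] dist_sup_le_1[OF r x y] \<gamma> by (intro powr_mono') auto
    then have "?c1 * dist_sup r x y powr \<gamma> \<le> ?c1 * dist_sup r x y"
      using dist_sup_nonneg[OF r, of x y] K by (intro mult_left_mono) auto
    then show ?thesis
      using p(2,3) poly_rep_lip[OF p(1) x y r] by (simp add: algebra_simps)
  qed
  have qi_lip: "lip_on r (1/2) ?qi"
  proof -
    have "lip_on r (?B * real ?Q + (?c1 + ?B * real ?Q) + 2 ^ (r + 2) * 2 powr \<gamma> * ?c1) ?qi"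
      unfolding lip_on_def
    proof (intro ballI)
      fix x y assume x: "x \<in> cube r" and y: "y \<in> cube r"
      show "\<bar>?qi x - ?qi y\<bar> \<le> (?B * real ?Q + (?c1 + ?B * real ?Q) + 2 ^ (r + 2) * 2 powr \<gamma> * ?c1) * dist_sup r x y"
      proof (rule quasi_interp_lip[OF M r \<gamma> _ _ _ x y P(2)])
        show "\<bar>P j x - P j y\<bar> \<le> ?B * real ?Q * dist_sup r x y" if "j \<in> grid M r" for j
          by (rule poly_rep_lip[OF P(1)[OF that] x y r])
      qed (use fL[OF x y] K B0 in auto)
    qed
    moreover have "?B * real ?Q + (?c1 + ?B * real ?Q) + 2 ^ (r + 2) * 2 powr \<gamma> * ?c1 = K * lip_bound r \<gamma> \<kappa>"
      by (simp add: lip_bound_def algebra_simps)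
    ultimately show ?thesis
      using lip_on_mono[OF r] KC(2) by simp
  qed
  have diff: "\<bar>?z x - ?qi x\<bar> \<le> e" if "x \<in> cube r" for x
    using close that unfolding close_def by blast
  show thesis
  proof (rule that[of T])
    show "lc (levels r m \<kappa>) 1 ((r + 1) ^ 2 ^ \<kappa> + 3) (T j)" if "j \<in> grid M r" for j
      using T0D(1)[OF that] that by (simp add: T_def)
    show "\<bar>f x - ?z x\<bar> \<le> ?c1 * (1 / real M) powr \<gamma> + e" if x: "x \<in> cube r" for x
    proof -
      have "\<bar>?qi x - f x\<bar> \<le> ?c1 * (1 / real M) powr \<gamma>"
      proof (rule quasi_interp_error[OF M r _ _ x])
        show "\<bar>f x - P j x\<bar> \<le> ?c1 * dist_sup r x (grid_point M r j) powr \<gamma>" if "j \<in> grid M r" for j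
          by (rule P(2)[OF that x])
      qed (use \<gamma> K in auto)
      then show ?thesis
        using diff[OF x] by linarith
    qed
    show "\<bar>?z x\<bar> \<le> 1/2 + e" if x: "x \<in> cube r" for x
      using diff[OF x] qi_bound[OF x] by linarith
    show "lip_on r (1/2 + e) ?z"
      unfolding lip_on_def
    proof (intro ballI)
      fix x y assume x: "x \<in> cube r" and y: "y \<in> cube r"
      have "\<bar>(?z x - ?qi x) - (?z y - ?qi y)\<bar> \<le> e * dist_sup r x y"
        using close x y unfolding close_def lip_on_def by blast
      then show "\<bar>?z x - ?z y\<bar> \<le> (1/2 + e) * dist_sup r x y"
        using lip_onD[OF qi_lip x y] unfolding distrib_right by linarith
    qed
    show "?z (clip_vec r x) = ?z x" for x
      by (simp add: approximant_def cell_def hat_clip_vec T(2))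
  qed (rule T(1))
qed

lemma zero_critic:
  assumes "p (Suc L) = 1" "0 < s" "0 \<le> F"
  shows "(\<lambda>_. 0) \<in> critics L p s F"
proof -
  have net: "network p (\<lambda>_ _ _. 0) (\<lambda>_ _. 0) L x 0 = 0" for x
    using assms(1) by (subst network_hid) auto
  have empty: "{(l, i, j). l \<le> L \<and> i < p (Suc l) \<and> j < p l \<and> (0::real) \<noteq> 0} = {}"
    "{(l, j). l \<in> {1..L} \<and> j < p l \<and> (0::real) \<noteq> 0} = {}"
    by auto
  have "network p (\<lambda>_ _ _. 0) (\<lambda>_ _. 0) L \<in> relu_networks L p s F"
    unfolding relu_networks_def
  proof (intro CollectI exI[of _ "\<lambda>_ _ _. 0"] exI[of _ "\<lambda>_ _. 0"] conjI)
    show "real (card {(l, i, j). l \<le> L \<and> i < p (Suc l) \<and> j < p l \<and> (0::real) \<noteq> 0} +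
        card {(l, j). l \<in> {1..L} \<and> j < p l \<and> (0::real) \<noteq> 0}) \<le> s"
      unfolding empty using assms(2) by simp
  qed (use assms net in auto)
  then show ?thesis
    unfolding critics_def using net by (intro image_eqI[of _ _ "network p (\<lambda>_ _ _. 0) (\<lambda>_ _. 0) L"]) auto
qed

text \<open>The number \<open>2 ^ k\<close> of mesh cells per coordinate is
  \<open>n powr \<alpha>\<close> rounded down to a power of 2. In the exponent,
  \<open>\<alpha> - 1/2 \<le> - (\<gamma> * \<alpha>)\<close> amounts to
  \<open>2 * \<alpha> \<le> r * \<alpha>\<close>; so for \<open>2 \<le> r\<close> half of
  \<open>log 2 n\<close> tent steps beat the amplification by \<open>2 ^ k\<close>. The same
  condition gives \<open>\<alpha> \<le> 1/4\<close> and hence few doublings.\<close>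

lemma resolution_bounds:
  fixes \<gamma> :: real and r n :: nat
  assumes r: "2 \<le> r" and \<gamma>: "1 \<le> \<gamma>" and n: "1 \<le> n"
  defines "\<alpha> \<equiv> 1 / (2 * \<gamma> + real r)"
  defines "k \<equiv> nat \<lfloor>log 2 (real n) * \<alpha>\<rfloor>" and "m \<equiv> nat \<lceil>log 2 (real n) / 2\<rceil>"
  shows "real n * rate \<gamma> r n = real n powr (real r * \<alpha>)" "rate \<gamma> r n powr (1/2) = real n powr (- (\<gamma> * \<alpha>))"
    "real (2 ^ k) \<le> real n powr \<alpha>" "(1 / real (2 ^ k)) powr \<gamma> \<le> 2 powr \<gamma> * real n powr (- (\<gamma> * \<alpha>))"
    "real (2 ^ k) * (1/2) ^ m \<le> real n powr (- (\<gamma> * \<alpha>))"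
    "real m \<le> log 2 (real n) / 2 + 1" "real k \<le> log 2 (real n) / 4"
proof -
  let ?l = "log 2 (real n)"
  have l: "0 \<le> ?l"
    using n by simp
  have den: "4 \<le> 2 * \<gamma> + real r"
    using r \<gamma> by linarith
  have \<alpha>: "0 < \<alpha>" "\<alpha> \<le> 1/4"
    unfolding \<alpha>_def using den by (auto simp: divide_simps)
  have sum: "2 * \<gamma> * \<alpha> + real r * \<alpha> = 1"
    unfolding distrib_right[symmetric] \<alpha>_def using den by simp
  have n2: "real n powr a = 2 powr (?l * a)" for a
    using n by (simp add: powr_powr[symmetric])
  have "real n * real n powr (- (2 * \<gamma> / (2 * \<gamma> + real r))) = real n powr (1 + - (2 * \<gamma> / (2 * \<gamma> + real r)))"
    unfolding powr_add using n by simp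
  also have "1 + - (2 * \<gamma> / (2 * \<gamma> + real r)) = real r * \<alpha>"
    using sum by (simp add: \<alpha>_def)
  finally show "real n * rate \<gamma> r n = real n powr (real r * \<alpha>)"
    by (simp add: rate_def)
  show "rate \<gamma> r n powr (1/2) = real n powr (- (\<gamma> * \<alpha>))"
  proof -
    have "- (2 * \<gamma> / S) * (1/2) = - (\<gamma> * (1 / S))" for S :: real
      by simp
    then show ?thesis
      unfolding rate_def powr_powr \<alpha>_def by (rule arg_cong[where f="(powr) (real n)"])
  qed
  have k0: "0 \<le> ?l * \<alpha>"
    using l \<alpha> by simp
  have kk: "real k = of_int \<lfloor>?l * \<alpha>\<rfloor>"
    using k0 by (simp add: k_def)
  then have k: "real k \<le> ?l * \<alpha>" "?l * \<alpha> \<le> real k + 1"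
    by linarith+
  have pk: "real (2 ^ k) = 2 powr (real k)"
    by (simp add: powr_realpow)
  show 1: "real (2 ^ k) \<le> real n powr \<alpha>"
    unfolding pk n2 using k by simp
  have "1 / real (2 ^ k) = 2 powr (- real k)"
    unfolding pk by (simp add: powr_minus_divide)
  then have "(1 / real (2 ^ k)) powr \<gamma> = 2 powr (- real k * \<gamma>)"
    by (simp add: powr_powr)
  also have "\<dots> \<le> 2 powr (\<gamma> + ?l * (- (\<gamma> * \<alpha>)))"
  proof -
    have "(?l * \<alpha>) * \<gamma> \<le> (real k + 1) * \<gamma>"
      using k \<gamma> by (intro mult_right_mono) auto
    then show ?thesis
      by (simp add: algebra_simps)
  qed
  finally show "(1 / real (2 ^ k)) powr \<gamma> \<le> 2 powr \<gamma> * real n powr (- (\<gamma> * \<alpha>))"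
    unfolding n2 powr_add .
  have m: "?l / 2 \<le> real m" "real m \<le> ?l / 2 + 1"
    using l unfolding m_def by linarith+
  then show "real m \<le> ?l / 2 + 1"
    by simp
  have "real (2 ^ k) * (1/2) ^ m = 2 powr (real k - real m)"
    unfolding pk powr_diff by (simp add: powr_realpow power_one_over)
  also have "\<dots> \<le> 2 powr (?l * (- (\<gamma> * \<alpha>)))"
  proof -
    have "real k - real m \<le> ?l * (\<alpha> - 1/2)"
      using k m by (simp add: algebra_simps)
    also have "\<dots> \<le> ?l * (- (\<gamma> * \<alpha>))"
    proof (rule mult_left_mono[OF _ l])
      have "2 * \<alpha> \<le> real r * \<alpha>"
        using r \<alpha> by (intro mult_right_mono) auto
      then show "\<alpha> - 1/2 \<le> - (\<gamma> * \<alpha>)"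
        using sum by simp
    qed
    finally show ?thesis
      by simp
  qed
  finally show "real (2 ^ k) * (1/2) ^ m \<le> real n powr (- (\<gamma> * \<alpha>))"
    unfolding n2 .
  have "?l * \<alpha> \<le> ?l * (1/4)"
    using l \<alpha> by (intro mult_left_mono) auto
  then show "real k \<le> ?l / 4"
    using k by linarith
qed

subsection \<open>Choice of parameters\<close>

lemma eventually_params:
  fixes C a c :: real
  assumes "0 < a"
  shows "\<exists>n0\<ge>1. \<forall>n\<ge>n0. c \<le> log 2 (real n) \<and> C * real n powr (- a) \<le> 1/2"
proof -
  have "(\<lambda>n. real n powr (- a)) \<longlonglongrightarrow> 0"
    using assms by (intro tendsto_neg_powr filterlim_real_sequentially) simp
  then have "(\<lambda>n. C * real n powr (- a)) \<longlonglongrightarrow> 0"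
    by (rule tendsto_mult_right_zero)
  then have "eventually (\<lambda>n. C * real n powr (- a) < 1/2) sequentially"
    by (rule order_tendstoD) simp
  then obtain n1 where n1: "\<And>n. n \<ge> n1 \<Longrightarrow> C * real n powr (- a) < 1/2"
    unfolding eventually_sequentially by blast
  define n2 :: nat where "n2 = 2 ^ nat \<lceil>c\<rceil>"
  have log: "c \<le> log 2 (real n)" if "n \<ge> n2" for n :: nat
  proof -
    have "(2::real) powr real (nat \<lceil>c\<rceil>) = real n2"
      by (simp add: n2_def powr_realpow)
    also have "\<dots> \<le> real n"
      using that by simp
    finally have le: "2 powr real (nat \<lceil>c\<rceil>) \<le> real n" .
    have "0 < n2"
      by (simp add: n2_def)
    then have "real (nat \<lceil>c\<rceil>) \<le> log 2 (real n)"
      using le that by (subst le_log_iff) simp_all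
    then show ?thesis
      by linarith
  qed
  have "\<forall>n\<ge>max n1 n2. c \<le> log 2 (real n) \<and> C * real n powr (- a) \<le> 1/2"
  proof (intro allI impI conjI)
    fix n assume n: "max n1 n2 \<le> n"
    show "c \<le> log 2 (real n)"
      using log n by simp
    show "C * real n powr (- a) \<le> 1/2"
      using n1[of n] n by simp
  qed
  moreover have "1 \<le> max n1 n2"
    by (simp add: n2_def max.coboundedI2)
  ultimately show ?thesis
    by blast
qed

text \<open>All constants are chosen before \<open>F\<close>: the network is bounded by 1/2 plus an
  error of at most 1/2, so it respects every bound \<open>F \<ge> 1\<close>.\<close>

lemma network_approximation:
  fixes r :: nat and \<gamma> :: real
  assumes r: "2 \<le> r" and \<gamma>: "1 \<le> \<gamma>"
  shows "\<exists>cp>0. \<exists>cs>0. \<exists>cL>0. \<exists>C>0. \<exists>K. 0 < K \<and> K < 1 \<and>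
    (\<forall>F\<ge>1. \<forall>(n::nat) (L::nat) (p :: nat \<Rightarrow> nat) (s::real).
       n \<ge> 1 \<longrightarrow> s > 0 \<longrightarrow> p 0 = r \<longrightarrow> p (Suc L) = 1 \<longrightarrow>
       real L \<ge> log 2 (real n) * log 2 (max (4 * real r) (4 * \<gamma>)) \<longrightarrow>
       (\<forall>i\<in>{1..L}. real (p i) \<ge> cp * (real n * rate \<gamma> r n)) \<longrightarrow>
       s \<ge> cs * (ln (real n) * (real n * rate \<gamma> r n)) \<longrightarrow> s \<ge> cL * real L \<longrightarrow>
       (\<forall>f\<in>hoelder_class r \<gamma> (cube r) K. \<exists>z\<in>critics_lip L p s F. \<forall>x\<in>cube r.
          \<bar>f x - z x\<bar> \<le> C * rate \<gamma> r n powr (1/2)))"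
proof -
  have r1: "1 \<le> r"
    using r by simp
  define q where "q = strict_floor \<gamma>"
  \<comment> \<open>The tree has degree \<open>2 ^ \<kappa> \<ge> \<gamma>\<close>, enough for
    Taylor polynomials of degree \<open>q\<close>. Since
    \<open>log 2 (4 * \<gamma>) = 2 + log 2 \<gamma>\<close>, the depth factor \<open>B\<close> is
    at least \<open>\<kappa> + 1\<close>: one for each level of the tree and one for the final
    multiplication.\<close>
  define \<kappa> where "\<kappa> = nat \<lceil>log 2 \<gamma>\<rceil>"
  define B where "B = log 2 (max (4 * real r) (4 * \<gamma>))"
  define \<alpha> where "\<alpha> = 1 / (2 * \<gamma> + real r)"
  have lg: "0 \<le> log 2 \<gamma>"
    using \<gamma> by simp
  have \<kappa>: "log 2 \<gamma> \<le> real \<kappa>" "real \<kappa> \<le> log 2 \<gamma> + 1"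
    using lg unfolding \<kappa>_def by linarith+
  have "\<gamma> = 2 powr (log 2 \<gamma>)"
    using \<gamma> by simp
  also have "\<dots> \<le> 2 powr (real \<kappa>)"
    using \<kappa> by simp
  finally have "\<gamma> \<le> real (2 ^ \<kappa>)"
    by (simp add: powr_realpow)
  then have "real q < real (2 ^ \<kappa>)"
    using strict_floor_bounds(1)[OF \<gamma>] unfolding q_def by linarith
  then have q\<kappa>: "q \<le> 2 ^ \<kappa>"
    by linarith
  have "log 2 (4 * \<gamma>) = log 2 (2 powr 2) + log 2 \<gamma>"
    using \<gamma> log_mult[of 2 4 \<gamma>] by simp
  then have "log 2 (4 * \<gamma>) = 2 + log 2 \<gamma>"
    by (simp only: log_powr_cancel)
  moreover have "log 2 (4 * \<gamma>) \<le> B"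
    unfolding B_def using \<gamma> by (intro log_mono) auto
  ultimately have B: "real \<kappa> + 1 \<le> B"
    using \<kappa> by linarith
  then have B1: "1 \<le> B"
    by linarith
  define CC where "CC = coeff_const r \<gamma>"
  define \<Lambda> where "\<Lambda> = lip_bound r \<gamma> \<kappa>"
  have CC: "1 \<le> CC"
  proof -
    have "(\<Sum>k\<in>{0}. (2 * real r) ^ k) \<le> (\<Sum>k\<le>q. (2 * real r) ^ k)"
      by (rule sum_mono2) auto
    then show ?thesis
      by (simp add: CC_def coeff_const_def q_def)
  qed
  have \<Lambda>: "0 \<le> \<Lambda>"
    unfolding \<Lambda>_def lip_bound_def using CC unfolding CC_def by (intro add_nonneg_nonneg mult_nonneg_nonneg) auto
  \<comment> \<open>Makes both \<open>K * CC\<close> and \<open>K * \<Lambda>\<close> at most 1/2,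
    and \<open>K < 1\<close> because \<open>1 \<le> CC\<close>.\<close>
  define K where "K = 1 / (2 * (CC + \<Lambda>))"
  have pos: "0 < CC + \<Lambda>"
    using CC \<Lambda> by linarith
  have K: "0 < K" "K < 1" "K * CC \<le> 1/2" "K * \<Lambda> \<le> 1/2"
    using pos CC \<Lambda> by (auto simp: K_def field_simps)
  obtain E where E: "0 \<le> E"
    "\<forall>m. \<forall>l\<in>words r (2 ^ \<kappa>). close r (E * (1/2) ^ m) (mtree r m \<kappa> l) (monomial r l)"
    using mtree_close[OF r1, of \<kappa>] by blast
  define Ce where "Ce = 2 ^ (r + 1) * (3 + 2 ^ \<kappa> + 4 * E)"
  have Ce: "0 \<le> Ce"
    using E(1) by (simp add: Ce_def)
  have \<gamma>\<alpha>: "0 < \<gamma> * \<alpha>"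
    using \<gamma> r by (simp add: \<alpha>_def)
  define c where "c = (r + 1) ^ 2 ^ \<kappa> + 3"
  define w0 where "w0 = levels_width r \<kappa> + 6 * 2 ^ r + 2 * r + 3"
  \<comment> \<open>Bounds the number of parameters, apart from padding, in units of
    \<open>log 2 n * (n * rate \<gamma> r n)\<close>: the first summand is depth times width, the
    second collects the summation layer, the clipping and the output.\<close>
  define A where "A = B * real ((2 * c + 8) * w0) + real (3 * (2 ^ r + 1) + 7 * r + 6)"
  have w0: "3 \<le> w0"
    by (simp add: w0_def)
  have A: "0 < A"
    unfolding A_def
  proof (rule add_nonneg_pos)
    show "0 < real (3 * (2 ^ r + 1) + 7 * r + 6)"
      by (rule of_nat_0_less_iff[THEN iffD2]) simp
  qed (use B1 in auto)
  \<comment> \<open>From \<open>n0\<close> on, the part of the depth that does not grow with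
    \<open>n\<close> is at most a quarter of \<open>log 2 n\<close>, and the network error is at
    most 1/2.\<close>
  obtain n0 where n0: "1 \<le> n0" "\<And>n. n \<ge> n0 \<Longrightarrow> max 1 (4 * real (4 * \<kappa> + 2 * r + 9)) \<le> log 2 (real n)"
    "\<And>n. n \<ge> n0 \<Longrightarrow> Ce * real n powr (- (\<gamma> * \<alpha>)) \<le> 1/2"
    using eventually_params[OF \<gamma>\<alpha>, of "max 1 (4 * real (4 * \<kappa> + 2 * r + 9))" Ce] by blast
  \<comment> \<open>The summands answer for the quasi-interpolation error, the multiplication error
    and the small \<open>n\<close>.\<close>
  define C where "C = K * real r ^ q * 2 powr \<gamma> + Ce + real n0 powr (\<gamma> * \<alpha>)"
  have C: "0 < C" "real n0 powr (\<gamma> * \<alpha>) \<le> C" "K * real r ^ q * 2 powr \<gamma> + Ce \<le> C"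
    unfolding C_def using K(1) Ce n0(1) by (auto intro!: add_nonneg_pos add_nonneg_nonneg)
  have main: "\<exists>z\<in>critics_lip L p s F. \<forall>x\<in>cube r. \<bar>f x - z x\<bar> \<le> C * rate \<gamma> r n powr (1/2)"
    if F: "1 \<le> F" and n: "1 \<le> n" and s: "0 < s" and p: "p 0 = r" "p (Suc L) = 1"
      and L: "log 2 (real n) * B \<le> real L"
      and pw: "\<forall>i\<in>{1..L}. real w0 * (real n * rate \<gamma> r n) \<le> real (p i)"
      and s1: "2 * A / ln 2 * (ln (real n) * (real n * rate \<gamma> r n)) \<le> s" and s2: "18 * real L \<le> s"
      and f: "f \<in> hoelder_class r \<gamma> (cube r) K"
    for F :: real and n L :: nat and p s f
  \<comment> \<open>For small \<open>n\<close> the zero network will do, since \<open>f\<close> is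
    bounded by \<open>K < 1\<close> and \<open>C\<close> times the rate is at least 1.\<close>
  proof (cases "n < n0")
    case True
    have "(\<lambda>_. 0) \<in> critics L p s F"
      by (rule zero_critic) (use p(2) s F in auto)
    moreover have "lip_const (p 0) (vecs (p 0)) (\<lambda>_. 0) \<le> 1"
      unfolding lip_const_def by (rule SUP_least) auto
    ultimately have "(\<lambda>_. 0) \<in> critics_lip L p s F"
      by (simp add: critics_lip_def)
    moreover have "\<bar>f x - 0\<bar> \<le> C * rate \<gamma> r n powr (1/2)" if x: "x \<in> cube r" for x
    proof -
      have "\<bar>f x - 0\<bar> \<le> K"
      proof (rule hoelder_class_derivatives[OF f less_imp_le[OF K(1)] \<gamma> r1])
        fix D
        assume D: "\<And>x. x \<in> cube r \<Longrightarrow> D (\<lambda>_. 0) x = f x"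
          "\<And>\<alpha> x. \<alpha> \<in> multi_indices r \<Longrightarrow> mi_size r \<alpha> \<le> strict_floor \<gamma> \<Longrightarrow> x \<in> cube r \<Longrightarrow> \<bar>D \<alpha> x\<bar> \<le> K"
        show ?thesis
          using D(1)[OF x] D(2)[OF _ _ x, of "\<lambda>_. 0"] by (simp add: multi_indices_def mi_size_def)
      qed
      also have "K \<le> 1"
        using K(2) by simp
      also have "1 = real n powr (\<gamma> * \<alpha>) * real n powr (- (\<gamma> * \<alpha>))"
        unfolding powr_add[symmetric] using n by simp
      also have "\<dots> \<le> C * real n powr (- (\<gamma> * \<alpha>))"
      proof (rule mult_right_mono)
        have "real n powr (\<gamma> * \<alpha>) \<le> real n0 powr (\<gamma> * \<alpha>)"
          using True \<gamma>\<alpha> by (intro powr_mono2) auto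
        then show "real n powr (\<gamma> * \<alpha>) \<le> C"
          using C(2) by simp
      qed simp
      finally show ?thesis
        unfolding resolution_bounds(2)[OF r \<gamma> n] \<alpha>_def .
    qed
    ultimately show ?thesis
      by (intro bexI[of _ "\<lambda>_. 0"] ballI)
  next
    case False
    define l where "l = log 2 (real n)"
    define m where "m = nat \<lceil>log 2 (real n) / 2\<rceil>"
    define k where "k = nat \<lfloor>log 2 (real n) * \<alpha>\<rfloor>"
    define M where "M = (2::nat) ^ k"
    define N where "N = (M + 1) ^ r"
    define D where "D = 2 + \<kappa> * (m + 3) + (2 * r + m + 5) + 1 + k"
    define w where "w = levels_width r \<kappa> + 6 * N + 2 * r + 3"
    define \<rho> where "\<rho> = real n powr (- (\<gamma> * \<alpha>))"
    define Nn where "Nn = real n * rate \<gamma> r n"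
    note res = resolution_bounds[OF r \<gamma> n, folded \<alpha>_def, folded m_def k_def, folded M_def \<rho>_def Nn_def l_def]
    have l: "1 \<le> l" "4 * real (4 * \<kappa> + 2 * r + 9) \<le> l"
      using n0(2)[of n] False by (auto simp: l_def)
    have CeN: "Ce * \<rho> \<le> 1/2"
      using n0(3)[of n] False by (simp add: \<rho>_def)
    have M1: "1 \<le> M"
      by (simp add: M_def)
    have \<alpha>0: "0 < \<alpha>"
      using \<gamma> by (simp add: \<alpha>_def)
    have Nn1: "1 \<le> Nn"
      unfolding res(1) using n \<alpha>0 by (intro ge_one_powr_ge_zero) auto
    have NN: "real N \<le> 2 ^ r * Nn"
    proof -
      have "real N \<le> (2 * real M) ^ r"
        unfolding N_def of_nat_power using M1 by (intro power_mono) auto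
      also have "\<dots> \<le> (2 * real n powr \<alpha>) ^ r"
        using res(3) by (intro power_mono) auto
      also have "\<dots> = 2 ^ r * Nn"
        unfolding res(1) power_mult_distrib using n by (simp add: powr_powr powr_realpow[symmetric] mult.commute)
      finally show ?thesis .
    qed
    have wN: "real w \<le> real w0 * Nn"
    proof -
      have "real w = real (levels_width r \<kappa> + 2 * r + 3) * 1 + 6 * real N"
        by (simp add: w_def)
      also have "\<dots> \<le> real (levels_width r \<kappa> + 2 * r + 3) * Nn + 6 * (2 ^ r * Nn)"
        using Nn1 NN by (intro add_mono mult_left_mono) auto
      also have "\<dots> = real w0 * Nn"
        by (simp add: w0_def algebra_simps)
      finally show ?thesis .
    qed
    \<comment> \<open>The budget \<open>B * l\<close> is split into halves and quarters: the
      multiplications take \<open>B * (l / 2)\<close>, the doublings and the part independent of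
      \<open>n\<close> take \<open>B * (l / 4)\<close> each.\<close>
    have DB: "real D \<le> B * l"
    proof -
      have "real D = (real \<kappa> + 1) * real m + real (3 * \<kappa> + 2 * r + 8) + real k"
        by (simp add: D_def algebra_simps)
      also have "\<dots> \<le> (real \<kappa> + 1) * (l / 2 + 1) + real (3 * \<kappa> + 2 * r + 8) + l / 4"
        using res(6,7) by (intro add_mono mult_left_mono) auto
      also have "\<dots> = (real \<kappa> + 1) * (l / 2) + l / 4 + real (4 * \<kappa> + 2 * r + 9)"
        by (simp add: algebra_simps)
      also have "\<dots> \<le> B * (l / 2) + B * (l / 4) + B * (l / 4)"
      proof (intro add_mono)
        show "(real \<kappa> + 1) * (l / 2) \<le> B * (l / 2)"
          using B l by (intro mult_right_mono) auto
        have "1 * (l / 4) \<le> B * (l / 4)"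
          using B1 l by (intro mult_right_mono) auto
        then show le: "l / 4 \<le> B * (l / 4)"
          by simp
        have "real (4 * \<kappa> + 2 * r + 9) \<le> l / 4"
          using l(2) by simp
        then show "real (4 * \<kappa> + 2 * r + 9) \<le> B * (l / 4)"
          using le by (rule order.trans)
      qed
      finally show ?thesis
        by simp
    qed
    have DL: "D \<le> L"
    proof -
      have "real D \<le> real L"
        using DB L unfolding l_def by (simp add: mult.commute)
      then show ?thesis
        by simp
    qed
    have pwid: "\<forall>i\<in>{1..L}. w \<le> p i"
    proof
      fix i assume "i \<in> {1..L}"
      then have "real w \<le> real (p i)"
        using pw wN unfolding Nn_def by fastforce
      then show "w \<le> p i"
        by simp
    qed
    have size: "real (D * ((2 * c + 8) * w) + 9 * L + 3 * (N + 1) + 7 * r + 6) \<le> s"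
    proof -
      have lN: "0 \<le> l * Nn" "Nn \<le> l * Nn"
        using l Nn1 by auto
      have "real (D * ((2 * c + 8) * w)) = real D * (real (2 * c + 8) * real w)"
        by (simp only: of_nat_mult)
      also have "\<dots> \<le> (B * l) * (real (2 * c + 8) * (real w0 * Nn))"
        using DB wN B1 l by (intro mult_mono) auto
      also have "\<dots> = B * real ((2 * c + 8) * w0) * (l * Nn)"
        by (simp only: of_nat_mult mult_ac)
      finally have a: "real (D * ((2 * c + 8) * w)) \<le> B * real ((2 * c + 8) * w0) * (l * Nn)" .
      have "real (3 * (N + 1) + 7 * r + 6) = 3 * real N + real (3 + 7 * r + 6) * 1"
        by simp
      also have "\<dots> \<le> 3 * (2 ^ r * Nn) + real (3 + 7 * r + 6) * Nn"
        using NN Nn1 by (intro add_mono mult_left_mono) auto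
      also have "\<dots> = real (3 * (2 ^ r + 1) + 7 * r + 6) * Nn"
        by (simp add: algebra_simps)
      also have "\<dots> \<le> real (3 * (2 ^ r + 1) + 7 * r + 6) * (l * Nn)"
        using lN by (intro mult_left_mono) auto
      finally have b: "real (3 * (N + 1) + 7 * r + 6) \<le> real (3 * (2 ^ r + 1) + 7 * r + 6) * (l * Nn)" .
      \<comment> \<open>Division by \<open>ln 2\<close> converts the natural into the binary
        logarithm. The factor 2 confines this part to half of \<open>s\<close>; the other half pays
        for padding, which is why 18 appears instead of 9.\<close>
      have "2 * (A * (l * Nn)) = 2 * A / ln 2 * (ln (real n) * Nn)"
        by (simp add: l_def log_def)
      then have c: "2 * (A * (l * Nn)) \<le> s"
        using s1 by (simp add: Nn_def)
      have "A * (l * Nn) = B * real ((2 * c + 8) * w0) * (l * Nn) + real (3 * (2 ^ r + 1) + 7 * r + 6) * (l * Nn)"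
        unfolding A_def by (rule distrib_right)
      then have "real (D * ((2 * c + 8) * w)) + real (3 * (N + 1) + 7 * r + 6) \<le> s / 2"
        using a b c by linarith
      moreover have "9 * real L \<le> s / 2"
        using s2 by simp
      moreover have "real (D * ((2 * c + 8) * w) + 9 * L + 3 * (N + 1) + 7 * r + 6) =
          real (D * ((2 * c + 8) * w)) + real (3 * (N + 1) + 7 * r + 6) + 9 * real L"
        by (simp only: of_nat_add of_nat_mult of_nat_numeral)
      ultimately show ?thesis
        by linarith
    qed
    define e where "e = real M * (2 ^ (r + 1) * ((3 + 2 ^ \<kappa> + 4 * E) * (1/2) ^ m))"
    have e: "e \<le> Ce * \<rho>"
    proof -
      have "e = Ce * (real M * (1/2) ^ m)"
        by (simp add: e_def Ce_def)
      also have "\<dots> \<le> Ce * \<rho>"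
        using res(5) Ce by (intro mult_left_mono) auto
      finally show ?thesis .
    qed
    show ?thesis
    proof (rule hoelder_approximant[OF r1 \<gamma> _ less_imp_le[OF K(1)] K(3,4)[unfolded CC_def \<Lambda>_def] f M1 E(1)])
      show "strict_floor \<gamma> \<le> 2 ^ \<kappa>"
        using q\<kappa> by (simp add: q_def)
      show "close r (E * (1/2) ^ m) (mtree r m \<kappa> l) (monomial r l)" if "l \<in> words r (2 ^ \<kappa>)" for l
        using E(2) that by blast
      fix T
      assume T: "\<And>j. j \<in> grid M r \<Longrightarrow> lc (levels r m \<kappa>) 1 ((r + 1) ^ 2 ^ \<kappa> + 3) (T j)"
          "\<And>j x. 0 \<le> T j x \<and> T j x \<le> 1"
        and err: "\<And>x. x \<in> cube r \<Longrightarrow> \<bar>f x - approximant r m M T x\<bar> \<le>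
          K * real r ^ strict_floor \<gamma> * (1 / real M) powr \<gamma> +
          real M * (2 ^ (r + 1) * ((3 + 2 ^ \<kappa> + 4 * E) * (1/2) ^ m))"
        and bnd: "\<And>x. x \<in> cube r \<Longrightarrow> \<bar>approximant r m M T x\<bar> \<le>
          1/2 + real M * (2 ^ (r + 1) * ((3 + 2 ^ \<kappa> + 4 * E) * (1/2) ^ m))"
        and lip: "lip_on r (1/2 + real M * (2 ^ (r + 1) * ((3 + 2 ^ \<kappa> + 4 * E) * (1/2) ^ m))) (approximant r m M T)"
        and inv: "\<And>x. approximant r m M T (clip_vec r x) = approximant r m M T x"
      let ?z = "approximant r m M T"
      have "?z \<in> critics L p s F"
      proof (rule approximant_critic[where r=r and m=m and k=k and \<kappa>=\<kappa> and c=c and L=L, folded M_def, folded N_def D_def, folded w_def])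
        show "\<bar>?z x\<bar> \<le> F" if "x \<in> cube r" for x
          using bnd[OF that, folded e_def] e CeN F by linarith
      qed (use T size p pwid DL in \<open>simp_all add: c_def\<close>)
      moreover have "lip_const (p 0) (vecs (p 0)) ?z \<le> 1"
        unfolding p(1)
      proof (rule lip_const_le_1[where z="?z", OF r1 inv])
        show "lip_on r 1 ?z"
          using lip_on_mono[OF r1 lip[folded e_def], of 1] e CeN by simp
      qed
      ultimately have "?z \<in> critics_lip L p s F"
        by (simp add: critics_lip_def)
      moreover have "\<bar>f x - ?z x\<bar> \<le> C * rate \<gamma> r n powr (1/2)" if x: "x \<in> cube r" for x
      proof -
        have "\<bar>f x - ?z x\<bar> \<le> K * real r ^ q * (1 / real M) powr \<gamma> + e"
          using err[OF x] by (simp add: e_def q_def)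
        also have "\<dots> \<le> K * real r ^ q * (2 powr \<gamma> * \<rho>) + Ce * \<rho>"
          using res(4) e K(1) by (intro add_mono mult_left_mono) auto
        also have "\<dots> = (K * real r ^ q * 2 powr \<gamma> + Ce) * \<rho>"
          by (simp add: algebra_simps)
        also have "\<dots> \<le> C * \<rho>"
          using C(3) by (intro mult_right_mono) (auto simp: \<rho>_def)
        finally show ?thesis
          unfolding res(2) .
      qed
      ultimately show ?thesis
        by (intro bexI[of _ ?z] ballI)
    qed
  qed
  show ?thesis
    apply (rule exI[of _ "real w0"], rule conjI)
    subgoal using w0 by simp
    apply (rule exI[of _ "2 * A / ln 2"], rule conjI)
    subgoal using A by simp
    apply (rule exI[of _ 18], rule conjI)
    subgoal by simp
    apply (rule exI[of _ C], rule conjI)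
    subgoal by (rule C(1))
    apply (rule exI[of _ K])
    apply (intro conjI allI impI ballI)
    subgoal by (rule K(1))
    subgoal by (rule K(2))
    subgoal by (rule main[unfolded B_def])
    done
qed

subsection \<open>Measurability and the comparison of the distances\<close>

lemma network_measurable:
  "i < p (Suc l) \<Longrightarrow> (\<lambda>x. network p W v l x i) \<in> borel_measurable (vec_borel (p 0))"
proof (induction l arbitrary: i)
  case 0
  have "(\<lambda>x. x j) \<in> borel_measurable (vec_borel (p 0))" if "j < p 0" for j
    unfolding vec_borel_def by (rule measurable_component_singleton) (use that in simp)
  then have "(\<lambda>x. \<Sum>j<p 0. W 0 i j * x j) \<in> borel_measurable (vec_borel (p 0))"
    by (intro borel_measurable_sum borel_measurable_times borel_measurable_const) simp
  then show ?case
    using 0 by simp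
next
  case (Suc l)
  have "(\<lambda>x. relu (network p W v l x j - v (Suc l) j)) \<in> borel_measurable (vec_borel (p 0))"
    if "j < p (Suc l)" for j
    unfolding relu_def using Suc.IH[OF that]
    by (intro borel_measurable_max borel_measurable_diff borel_measurable_const)
  then have "(\<lambda>x. \<Sum>j<p (Suc l). W (Suc l) i j * relu (network p W v l x j - v (Suc l) j)) \<in>
      borel_measurable (vec_borel (p 0))"
    by (intro borel_measurable_sum borel_measurable_times borel_measurable_const) simp
  then show ?case
    using Suc.prems by simp
qed

lemma critics_measurable:
  assumes "z \<in> critics L p s F" "p (Suc L) = 1"
  shows "z \<in> borel_measurable (vec_borel (p 0))"
proof -
  obtain W v where z: "z = (\<lambda>x. network p W v L x 0)"
    using assms(1) unfolding critics_def relu_networks_def by blast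
  show ?thesis
    unfolding z by (rule network_measurable) (simp add: assms(2))
qed

lemma critics_bounded:
  assumes "z \<in> critics L p s F" "p (Suc L) = 1" "x \<in> cube (p 0)"
  shows "\<bar>z x\<bar> \<le> F"
  using assms unfolding critics_def relu_networks_def by auto

lemma vec_append_measurable:
  assumes "X \<in> M \<rightarrow>\<^sub>M vec_borel d" "Y \<in> M \<rightarrow>\<^sub>M vec_borel e"
  shows "(\<lambda>\<omega>. vec_append d e (X \<omega>) (Y \<omega>)) \<in> M \<rightarrow>\<^sub>M vec_borel (d + e)"
  unfolding vec_append_def vec_borel_def
proof (rule measurable_restrict)
  fix i assume i: "i \<in> {..<d + e}"
  show "(\<lambda>\<omega>. if i < d then X \<omega> i else Y \<omega> (i - d)) \<in> borel_measurable M"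
  proof (cases "i < d")
    case True
    have "(\<lambda>\<omega>. X \<omega> i) \<in> borel_measurable M"
      using assms(1) unfolding vec_borel_def
      by (rule measurable_compose[OF _ measurable_component_singleton]) (use True in simp)
    then show ?thesis
      using True by simp
  next
    case False
    have "(\<lambda>\<omega>. Y \<omega> (i - d)) \<in> borel_measurable M"
      using assms(2) unfolding vec_borel_def
      by (rule measurable_compose[OF _ measurable_component_singleton]) (use False i in auto)
    then show ?thesis
      using False by simp
  qed
qed

lemma vec_append_cube: "x \<in> cube d \<Longrightarrow> y \<in> cube e \<Longrightarrow> vec_append d e x y \<in> cube (d + e)"
  by (auto simp: vec_append_def cube_def PiE_def Pi_def)

lemma rate_powr_tendsto_0:
  assumes "0 < \<gamma>"
  shows "(\<lambda>n. C * rate \<gamma> r (Suc n) powr (1/2)) \<longlonglongrightarrow> 0"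
proof -
  have "(\<lambda>n. real n powr (- (2 * \<gamma> / (2 * \<gamma> + real r)) * (1/2))) \<longlonglongrightarrow> 0"
    using assms by (intro tendsto_neg_powr filterlim_real_sequentially) (auto intro!: divide_pos_pos)
  then have "(\<lambda>n. C * rate \<gamma> r n powr (1/2)) \<longlonglongrightarrow> 0"
    unfolding rate_def powr_powr by (rule tendsto_mult_right_zero)
  then show ?thesis
    by (rule LIMSEQ_Suc)
qed

text \<open>
  Uniform approximability by networks also shows that \<open>f \<circ> U\<close> is measurable, although \<open>f\<close> is
  arbitrary outside the cube.
\<close>

lemma measurable_of_approximation:
  fixes f :: "(nat \<Rightarrow> real) \<Rightarrow> real"
  assumes "U \<in> M \<rightarrow>\<^sub>M vec_borel r" "\<And>\<omega>. \<omega> \<in> space M \<Longrightarrow> U \<omega> \<in> cube r" and \<epsilon>: "\<epsilon> \<longlonglongrightarrow> 0"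
    and z: "\<And>n::nat. \<exists>z\<in>borel_measurable (vec_borel r). \<forall>x\<in>cube r. \<bar>f x - z x\<bar> \<le> \<epsilon> n"
  shows "(\<lambda>\<omega>. f (U \<omega>)) \<in> borel_measurable M"
proof -
  have "\<exists>z. z \<in> borel_measurable (vec_borel r) \<and> (\<forall>x\<in>cube r. \<bar>f x - z x\<bar> \<le> \<epsilon> n)" for n
    using z[of n] by (elim bexE) (intro exI conjI)
  then have "\<forall>n. \<exists>z. z \<in> borel_measurable (vec_borel r) \<and> (\<forall>x\<in>cube r. \<bar>f x - z x\<bar> \<le> \<epsilon> n)" ..
  from choice[OF this] obtain z where z: "\<forall>n. z n \<in> borel_measurable (vec_borel r) \<and> (\<forall>x\<in>cube r. \<bar>f x - z n x\<bar> \<le> \<epsilon> n)" ..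
  show ?thesis
  proof (rule borel_measurable_LIMSEQ_real)
    fix \<omega> assume \<omega>: "\<omega> \<in> space M"
    show "(\<lambda>n. z n (U \<omega>)) \<longlonglongrightarrow> f (U \<omega>)"
    proof (rule LIMSEQ_I)
      fix e :: real assume "0 < e"
      then obtain N where N: "\<And>n. n \<ge> N \<Longrightarrow> norm (\<epsilon> n - 0) < e"
        using LIMSEQ_D[OF \<epsilon>] by blast
      have "norm (z n (U \<omega>) - f (U \<omega>)) < e" if "n \<ge> N" for n
      proof -
        have "\<bar>f (U \<omega>) - z n (U \<omega>)\<bar> \<le> \<epsilon> n"
          using z assms(2)[OF \<omega>] by blast
        then show ?thesis
          using N[OF that] by (simp add: abs_minus_commute)
      qed
      then show "\<exists>N. \<forall>n\<ge>N. norm (z n (U \<omega>) - f (U \<omega>)) < e"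
        by blast
    qed
  next
    show "(\<lambda>\<omega>. z n (U \<omega>)) \<in> borel_measurable M" for n
      by (rule measurable_compose[OF assms(1)]) (use z in blast)
  qed
qed

text \<open>Each of the two expectations changes by at most \<open>\<epsilon>\<close>, hence the 2.
  The bounded function \<open>z\<close> is integrable, and so is \<open>f - z\<close>; thus
  \<open>f\<close> is integrable along both variables and the integrals may be subtracted.\<close>

lemma ipm_le_of_approximation:
  fixes \<F> \<G> :: "((nat \<Rightarrow> real) \<Rightarrow> real) set"
  assumes "prob_space M"
    and U: "U \<in> M \<rightarrow>\<^sub>M vec_borel r" "\<And>\<omega>. \<omega> \<in> space M \<Longrightarrow> U \<omega> \<in> cube r"
    and V: "V \<in> M \<rightarrow>\<^sub>M vec_borel r" "\<And>\<omega>. \<omega> \<in> space M \<Longrightarrow> V \<omega> \<in> cube r"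
    and fm: "\<And>f. f \<in> \<F> \<Longrightarrow> (\<lambda>\<omega>. f (U \<omega>)) \<in> borel_measurable M \<and> (\<lambda>\<omega>. f (V \<omega>)) \<in> borel_measurable M"
    and z: "\<And>f. f \<in> \<F> \<Longrightarrow> \<exists>z\<in>\<G>. \<forall>x\<in>cube r. \<bar>f x - z x\<bar> \<le> \<epsilon>"
    and zm: "\<And>z. z \<in> \<G> \<Longrightarrow> z \<in> borel_measurable (vec_borel r) \<and> (\<forall>x\<in>cube r. \<bar>z x\<bar> \<le> B)"
  shows "ipm M \<F> U V \<le> ipm M \<G> U V + ereal (2 * \<epsilon>)"
  unfolding ipm_def
proof (rule SUP_least)
  interpret prob_space M by fact
  fix f assume f: "f \<in> \<F>"
  obtain z where z: "z \<in> \<G>" "\<And>x. x \<in> cube r \<Longrightarrow> \<bar>f x - z x\<bar> \<le> \<epsilon>"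
    using z[OF f] by blast
  have bnd: "\<bar>z x\<bar> \<le> B" if "x \<in> cube r" for x
    using zm[OF z(1)] that by blast
  have I: "\<bar>(\<integral>\<omega>. f (T \<omega>) \<partial>M) - (\<integral>\<omega>. z (T \<omega>) \<partial>M)\<bar> \<le> \<epsilon>"
    if T: "T \<in> M \<rightarrow>\<^sub>M vec_borel r" "\<And>\<omega>. \<omega> \<in> space M \<Longrightarrow> T \<omega> \<in> cube r"
      "(\<lambda>\<omega>. f (T \<omega>)) \<in> borel_measurable M" for T
  proof -
    have zT: "(\<lambda>\<omega>. z (T \<omega>)) \<in> borel_measurable M"
      by (rule measurable_compose[OF T(1)]) (use zm[OF z(1)] in blast)
    have iz: "integrable M (\<lambda>\<omega>. z (T \<omega>))"
      by (rule integrable_const_bound[of _ B, OF AE_I2 zT]) (use bnd T(2) in simp)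
    have fz: "\<bar>f (T \<omega>) - z (T \<omega>)\<bar> \<le> \<epsilon>" if "\<omega> \<in> space M" for \<omega>
      using z(2)[OF T(2)[OF that]] .
    have id: "integrable M (\<lambda>\<omega>. f (T \<omega>) - z (T \<omega>))"
    proof (rule integrable_const_bound[of _ \<epsilon>, OF AE_I2])
      show "norm (f (T \<omega>) - z (T \<omega>)) \<le> \<epsilon>" if "\<omega> \<in> space M" for \<omega>
        using fz[OF that] by simp
    qed (intro borel_measurable_diff T(3) zT)
    have "integrable M (\<lambda>\<omega>. (f (T \<omega>) - z (T \<omega>)) + z (T \<omega>))"
      by (rule Bochner_Integration.integrable_add[OF id iz])
    then have int_f: "integrable M (\<lambda>\<omega>. f (T \<omega>))"
      by simp
    have "\<bar>\<integral>\<omega>. f (T \<omega>) - z (T \<omega>) \<partial>M\<bar> \<le> (\<integral>\<omega>. \<bar>f (T \<omega>) - z (T \<omega>)\<bar> \<partial>M)"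
      by (rule integral_abs_bound)
    also have "\<dots> \<le> (\<integral>\<omega>. \<epsilon> \<partial>M)"
      by (intro integral_mono integrable_abs id integrable_const fz)
    also have "\<dots> = \<epsilon>"
      by (simp add: prob_space)
    finally show ?thesis
      using Bochner_Integration.integral_diff[OF int_f iz] by simp
  qed
  have "(\<integral>\<omega>. f (U \<omega>) \<partial>M) - (\<integral>\<omega>. f (V \<omega>) \<partial>M) \<le> ((\<integral>\<omega>. z (U \<omega>) \<partial>M) - (\<integral>\<omega>. z (V \<omega>) \<partial>M)) + 2 * \<epsilon>"
    using I[OF U conjunct1[OF fm[OF f]]] I[OF V conjunct2[OF fm[OF f]]] by linarith
  then have "ereal ((\<integral>\<omega>. f (U \<omega>) \<partial>M) - (\<integral>\<omega>. f (V \<omega>) \<partial>M)) \<le>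
      ereal ((\<integral>\<omega>. z (U \<omega>) \<partial>M) - (\<integral>\<omega>. z (V \<omega>) \<partial>M)) + ereal (2 * \<epsilon>)"
    by simp
  also have "\<dots> \<le> (SUP z\<in>\<G>. ereal ((\<integral>\<omega>. z (U \<omega>) \<partial>M) - (\<integral>\<omega>. z (V \<omega>) \<partial>M))) + ereal (2 * \<epsilon>)"
    by (intro add_right_mono SUP_upper z(1))
  finally show "ereal ((\<integral>\<omega>. f (U \<omega>) \<partial>M) - (\<integral>\<omega>. f (V \<omega>) \<partial>M)) \<le>
      (SUP z\<in>\<G>. ereal ((\<integral>\<omega>. z (U \<omega>) \<partial>M) - (\<integral>\<omega>. z (V \<omega>) \<partial>M))) + ereal (2 * \<epsilon>)" .
qed

theorem lemma4p1:
  fixes \<gamma> :: real and d dY :: nat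
  assumes "\<gamma> \<ge> 1" and "d \<ge> 1" and "dY \<ge> 1"
  shows "\<exists>c\<^sub>p > 0. \<exists>c\<^sub>s > 0. \<exists>c\<^sub>L > 0. \<forall>F \<ge> 1. \<exists>C > 0. \<exists>K. 0 < K \<and> K < 1 \<and>
    (\<forall>(n::nat) (L::nat) (p :: nat \<Rightarrow> nat) (s::real).
       n \<ge> 1 \<and> s > 0 \<and> p 0 = d + dY \<and> p (Suc L) = 1 \<and>
       real L \<ge> log 2 (real n) * log 2 (max (4 * real (d + dY)) (4 * \<gamma>)) \<and>
       (\<forall>i\<in>{1..L}. real (p i) \<ge> c\<^sub>p * (real n * rate \<gamma> (d + dY) n)) \<and>
       s \<ge> c\<^sub>s * (ln (real n) * (real n * rate \<gamma> (d + dY) n)) \<and>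
       s \<ge> c\<^sub>L * real L
       \<longrightarrow>
       (SUP f\<in>hoelder_lip (d + dY) \<gamma> K. INF f'\<in>critics L p s F.
          sup_norm_on (cube (d + dY)) (\<lambda>x. f x - f' x))
         \<le> ennreal (C * rate \<gamma> (d + dY) n powr (1/2)) \<and>
       (\<forall>(dZ::nat) (M :: 'w measure) X Y Z g.
          cgan_setup M d dY dZ X Y Z \<and>
          g \<in> vec_borel (dZ + dY) \<rightarrow>\<^sub>M vec_borel d \<and>
          (\<forall>\<omega>\<in>space M. g (vec_append dZ dY (Z \<omega>) (Y \<omega>)) \<in> cube d)
          \<longrightarrow>
          W1_hoelder M d dY dZ X Y Z \<gamma> K g
            \<le> W1_network M d dY dZ X Y Z L p s F g
              + ereal (C * rate \<gamma> (d + dY) n powr (1/2))))"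
proof -
  define r where "r = d + dY"
  have r: "2 \<le> r"
    using assms(2,3) by (simp add: r_def)
  obtain cp cs cL C K where c: "0 < cp" "0 < cs" "0 < cL" "0 < C" "0 < K" "K < 1"
    and approx: "\<forall>F\<ge>1. \<forall>(n::nat) (L::nat) (p :: nat \<Rightarrow> nat) (s::real).
       n \<ge> 1 \<longrightarrow> s > 0 \<longrightarrow> p 0 = r \<longrightarrow> p (Suc L) = 1 \<longrightarrow>
       real L \<ge> log 2 (real n) * log 2 (max (4 * real r) (4 * \<gamma>)) \<longrightarrow>
       (\<forall>i\<in>{1..L}. real (p i) \<ge> cp * (real n * rate \<gamma> r n)) \<longrightarrow>
       s \<ge> cs * (ln (real n) * (real n * rate \<gamma> r n)) \<longrightarrow> s \<ge> cL * real L \<longrightarrow>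
       (\<forall>f\<in>hoelder_class r \<gamma> (cube r) K. \<exists>z\<in>critics_lip L p s F. \<forall>x\<in>cube r.
          \<bar>f x - z x\<bar> \<le> C * rate \<gamma> r n powr (1/2))"
    using network_approximation[OF r assms(1)] by (elim exE conjE)
  \<comment> \<open>Measurability of \<open>f\<close> along a random vector needs a sequence of
    approximations, whereas the statement fixes one \<open>n\<close>. Hence networks with parameters
    of their own, and with \<open>F = 1\<close>, are taken for every sample size
    \<open>Suc n\<close>.\<close>
  have measurable: "\<exists>z\<in>borel_measurable (vec_borel r). \<forall>x\<in>cube r. \<bar>f x - z x\<bar> \<le> C * rate \<gamma> r (Suc n) powr (1/2)"
    if f: "f \<in> hoelder_class r \<gamma> (cube r) K" for f n
  proof -
    let ?n = "Suc n"
    define L where "L = nat \<lceil>log 2 (real ?n) * log 2 (max (4 * real r) (4 * \<gamma>))\<rceil>"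
    define p where "p = (\<lambda>i. if i = 0 then r else if i = Suc L then 1 else nat \<lceil>cp * (real ?n * rate \<gamma> r ?n)\<rceil>)"
    define s where "s = max 1 (max (cs * (ln (real ?n) * (real ?n * rate \<gamma> r ?n))) (cL * real L))"
    have "\<exists>z\<in>critics_lip L p s 1. \<forall>x\<in>cube r. \<bar>f x - z x\<bar> \<le> C * rate \<gamma> r ?n powr (1/2)"
    proof (rule approx[rule_format])
      show "log 2 (real ?n) * log 2 (max (4 * real r) (4 * \<gamma>)) \<le> real L"
        unfolding L_def by (rule real_nat_ceiling_ge)
      show "cp * (real ?n * rate \<gamma> r ?n) \<le> real (p i)" if "i \<in> {1..L}" for i
        using that real_nat_ceiling_ge[of "cp * (real ?n * rate \<gamma> r ?n)"] by (simp add: p_def)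
    qed (use f in \<open>simp_all add: p_def s_def\<close>)
    then obtain z where z: "z \<in> critics_lip L p s 1" "\<forall>x\<in>cube r. \<bar>f x - z x\<bar> \<le> C * rate \<gamma> r ?n powr (1/2)"
      by (elim bexE)
    have "z \<in> borel_measurable (vec_borel (p 0))"
      by (rule critics_measurable[of z L p s 1]) (use z(1) in \<open>simp_all add: critics_lip_def p_def\<close>)
    then show ?thesis
      using z(2) by (intro bexI[of _ z]) (simp_all add: p_def)
  qed
  have main: "(SUP f\<in>hoelder_lip r \<gamma> K. INF f'\<in>critics L p s F. sup_norm_on (cube r) (\<lambda>x. f x - f' x))
      \<le> ennreal (2 * C * rate \<gamma> r n powr (1/2)) \<and>
    (\<forall>(dZ::nat) (M :: 'w measure) X Y Z g.
      cgan_setup M d dY dZ X Y Z \<and> g \<in> vec_borel (dZ + dY) \<rightarrow>\<^sub>M vec_borel d \<and>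
      (\<forall>\<omega>\<in>space M. g (vec_append dZ dY (Z \<omega>) (Y \<omega>)) \<in> cube d) \<longrightarrow>
      W1_hoelder M d dY dZ X Y Z \<gamma> K g \<le>
        W1_network M d dY dZ X Y Z L p s F g + ereal (2 * C * rate \<gamma> r n powr (1/2)))"
    if F: "1 \<le> F" and H: "1 \<le> n \<and> 0 < s \<and> p 0 = r \<and> p (Suc L) = 1 \<and>
       log 2 (real n) * log 2 (max (4 * real r) (4 * \<gamma>)) \<le> real L \<and>
       (\<forall>i\<in>{1..L}. cp * (real n * rate \<gamma> r n) \<le> real (p i)) \<and>
       cs * (ln (real n) * (real n * rate \<gamma> r n)) \<le> s \<and> cL * real L \<le> s"
    for F :: real and n L :: nat and p :: "nat \<Rightarrow> nat" and s :: real
  proof -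
    let ?\<epsilon> = "C * rate \<gamma> r n powr (1/2)"
    have p: "p 0 = r" "p (Suc L) = 1"
      using H by simp_all
    have z: "\<exists>z\<in>critics_lip L p s F. \<forall>x\<in>cube r. \<bar>f x - z x\<bar> \<le> ?\<epsilon>" if "f \<in> hoelder_lip r \<gamma> K" for f
    proof (rule approx[rule_format])
      show "f \<in> hoelder_class r \<gamma> (cube r) K"
        using that by (simp add: hoelder_lip_def)
      show "cp * (real n * rate \<gamma> r n) \<le> real (p i)" if "i \<in> {1..L}" for i
        using H that by blast
    qed (use F H in simp_all)
    have \<epsilon>: "0 \<le> ?\<epsilon>"
      using c(4) by simp
    have 1: "(SUP f\<in>hoelder_lip r \<gamma> K. INF f'\<in>critics L p s F. sup_norm_on (cube r) (\<lambda>x. f x - f' x))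
      \<le> ennreal (2 * C * rate \<gamma> r n powr (1/2))"
    proof (rule SUP_least)
      fix f assume "f \<in> hoelder_lip r \<gamma> K"
      from z[OF this] obtain z where z: "z \<in> critics_lip L p s F" "\<forall>x\<in>cube r. \<bar>f x - z x\<bar> \<le> ?\<epsilon>"
        by (elim bexE)
      have "(INF f'\<in>critics L p s F. sup_norm_on (cube r) (\<lambda>x. f x - f' x)) \<le> sup_norm_on (cube r) (\<lambda>x. f x - z x)"
        by (rule INF_lower) (use z(1) in \<open>simp add: critics_lip_def\<close>)
      also have "\<dots> \<le> ennreal (2 * C * rate \<gamma> r n powr (1/2))"
        unfolding sup_norm_on_def
      proof (intro SUP_least ennreal_leI)
        fix x assume "x \<in> cube r"
        then have "\<bar>f x - z x\<bar> \<le> ?\<epsilon>"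
          using z(2) by blast
        then show "\<bar>f x - z x\<bar> \<le> 2 * C * rate \<gamma> r n powr (1/2)"
          using \<epsilon> by linarith
      qed
      finally show "(INF f'\<in>critics L p s F. sup_norm_on (cube r) (\<lambda>x. f x - f' x)) \<le>
          ennreal (2 * C * rate \<gamma> r n powr (1/2))" .
    qed
    have 2: "W1_hoelder M d dY dZ X Y Z \<gamma> K g \<le>
        W1_network M d dY dZ X Y Z L p s F g + ereal (2 * C * rate \<gamma> r n powr (1/2))"
      if M: "cgan_setup M d dY dZ X Y Z \<and> g \<in> vec_borel (dZ + dY) \<rightarrow>\<^sub>M vec_borel d \<and>
        (\<forall>\<omega>\<in>space M. g (vec_append dZ dY (Z \<omega>) (Y \<omega>)) \<in> cube d)"
      for dZ :: nat and M :: "'w measure" and X Y Z g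
    proof -
      let ?U = "\<lambda>\<omega>. vec_append d dY (X \<omega>) (Y \<omega>)"
      let ?V = "\<lambda>\<omega>. vec_append d dY (g (vec_append dZ dY (Z \<omega>) (Y \<omega>))) (Y \<omega>)"
      have XYZ: "X \<in> M \<rightarrow>\<^sub>M vec_borel d" "Y \<in> M \<rightarrow>\<^sub>M vec_borel dY" "Z \<in> M \<rightarrow>\<^sub>M vec_borel dZ" "prob_space M"
        and cubes: "\<And>\<omega>. \<omega> \<in> space M \<Longrightarrow> X \<omega> \<in> cube d" "\<And>\<omega>. \<omega> \<in> space M \<Longrightarrow> Y \<omega> \<in> cube dY"
        and g: "g \<in> vec_borel (dZ + dY) \<rightarrow>\<^sub>M vec_borel d"
          "\<And>\<omega>. \<omega> \<in> space M \<Longrightarrow> g (vec_append dZ dY (Z \<omega>) (Y \<omega>)) \<in> cube d"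
        using M unfolding cgan_setup_def by blast+
      have U: "?U \<in> M \<rightarrow>\<^sub>M vec_borel r"
        unfolding r_def by (intro vec_append_measurable XYZ)
      have V: "?V \<in> M \<rightarrow>\<^sub>M vec_borel r"
        unfolding r_def
        by (intro vec_append_measurable XYZ measurable_compose[OF vec_append_measurable[OF XYZ(3,2)] g(1)])
      have Uc: "?U \<omega> \<in> cube r" and Vc: "?V \<omega> \<in> cube r" if "\<omega> \<in> space M" for \<omega>
        unfolding r_def using that by (auto intro!: vec_append_cube cubes g(2))
      have fm: "(\<lambda>\<omega>. f (T \<omega>)) \<in> borel_measurable M"
        if "f \<in> hoelder_lip r \<gamma> K" "T \<in> M \<rightarrow>\<^sub>M vec_borel r" "\<And>\<omega>. \<omega> \<in> space M \<Longrightarrow> T \<omega> \<in> cube r" for f T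
      proof (rule measurable_of_approximation[OF that(2,3)])
        show "(\<lambda>n. C * rate \<gamma> r (Suc n) powr (1/2)) \<longlonglongrightarrow> 0"
          by (rule rate_powr_tendsto_0) (use assms(1) in simp)
        show "\<exists>z\<in>borel_measurable (vec_borel r). \<forall>x\<in>cube r. \<bar>f x - z x\<bar> \<le> C * rate \<gamma> r (Suc n) powr (1/2)" for n
          by (rule measurable) (use that(1) in \<open>simp add: hoelder_lip_def\<close>)
      qed
      have "ipm M (hoelder_lip r \<gamma> K) ?U ?V \<le> ipm M (critics_lip L p s F) ?U ?V + ereal (2 * ?\<epsilon>)"
      proof (rule ipm_le_of_approximation[OF XYZ(4) U Uc V Vc])
        show "(\<lambda>\<omega>. f (?U \<omega>)) \<in> borel_measurable M \<and> (\<lambda>\<omega>. f (?V \<omega>)) \<in> borel_measurable M"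
          if "f \<in> hoelder_lip r \<gamma> K" for f
          using fm[OF that U Uc] fm[OF that V Vc] by (rule conjI)
        show "\<exists>z\<in>critics_lip L p s F. \<forall>x\<in>cube r. \<bar>f x - z x\<bar> \<le> ?\<epsilon>" if "f \<in> hoelder_lip r \<gamma> K" for f
          by (rule z[OF that])
        show "z \<in> borel_measurable (vec_borel r) \<and> (\<forall>x\<in>cube r. \<bar>z x\<bar> \<le> F)" if "z \<in> critics_lip L p s F" for z
        proof -
          have z: "z \<in> critics L p s F"
            using that by (simp add: critics_lip_def)
          show ?thesis
            using critics_measurable[OF z p(2)] critics_bounded[OF z p(2)] p(1) by simp
        qed
      qed
      then show ?thesis
        unfolding W1_hoelder_def W1_network_def r_def[symmetric] by (simp only: mult.assoc)
    qed
    show ?thesis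
      using 1 2 by (intro conjI allI impI)
  qed
  show ?thesis
    unfolding r_def[symmetric]
    apply (rule exI[of _ cp], rule conjI[OF c(1)])
    apply (rule exI[of _ cs], rule conjI[OF c(2)])
    apply (rule exI[of _ cL], rule conjI[OF c(3)])
    \<comment> \<open>The doubled constant is the one from the comparison of the distances, where
      the approximation is used for both expectations. It also covers the uniform error.\<close>
    apply (rule allI, rule impI, rule exI[of _ "2 * C"], rule conjI)
    subgoal using c(4) by simp
    apply (rule exI[of _ K], rule conjI[OF c(5)], rule conjI[OF c(6)])
    apply (rule allI, rule allI, rule allI, rule allI, rule impI)
    by (rule main)
qed

end
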